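(* Assume that $f_1(t,\omega)<\cdots<f_n(t,\omega)$ for all $(t,\omega)\in[0,T]\times\Omega$, and that $\mathbb{E}\big[\int_0^T|f_i(t)|\,\mu^A(dt)+\int_0^T|g_i(t)|\,\mu^P(dt)\big]<\infty$ for $i=1,\dots,n$. Assume further that, for each $i=1,\dots,n$, $$\mathbb{E}\Big[\sup_{t\in[0,T]}|g_i(t)|\Big]+\mathbb{E}\Big[\sup_{t\in[0,T]}|f_i(t)|\Big]<+\infty,$$ and, almost surely, $$\lim_{m\to\infty}\sum_{j=1}^m\int_{(t^m_{j-1},t^m_j]}\big|f_i(t)-f_i(t^m_j)\big|\,\mu^A(dt)=0,\qquad \lim_{m\to\infty}\sum_{j=1}^m\int_{(t^m_{j-1},t^m_j]}\big|g_i(t)-g_i(t^m_j)\big|\,\mu^P(dt)=0.$$ Then $$\lim_{m\to\infty}V^{P,\pi_m}=V^P.$$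
   Context: Setting: $(\Omega,\mathcal{F},\mathbb{P})$ is a complete probability space with a filtration $\mathbb{F}=(\mathcal{F}_t)_{t\in[0,T]}$ satisfying the usual conditions, $0<T<\infty$. $\mathcal{T}$ is the set of $\mathbb{F}$-stopping times with values in $[0,T]$. $n\ge1$ is an integer (number of agents); $\mu^A,\mu^P$ are deterministic atomless finite Borel measures on $[0,T]$; $f_i,g_i:[0,T]\times\Omega\to\mathbb{R}$, $i=1,\dots,n$, are progressively measurable; $\xi$ is an $\mathcal{F}_T$-measurable random variable with $\mathbb{E}|\xi|<\infty$. USCE: an optional process $Y$ of class (D) (i.e. $(Y_\tau)_{\tau\in\mathcal{T}}$ is uniformly integrable) is upper-semicontinuous in expectation (USCE) if for any $\tau\in\mathcal{T}$ and any sequence $(\tau_k)_{k\ge1}\subset\mathcal{T}$ with $\lim_k\tau_k=\tau$ such that either $(\tau_k)$ is non-decreasing with $\tau_k<\tau$ on $\{\tau>0\}$ for each $k$, or $\tau_k\ge\tau$ a.s. for each $k$, one has $\mathbb{E}[Y_\tau]\ge\limsup_k\mathbb{E}[Y_{\tau_k}]$. Continuous-time problem: $\mathcal{Y}$ is the set of $\mathbb{F}$-optional processes $Y$ that are USCE, of class (D), with $Y_T\ge\xi$. Given $Y\in\mathcal{Y}$, $\hat\tau_i=\hat\tau_i(Y)$ denotes the smallest optimal stopping time (it exists) of agent $i$'s problem $\sup_{\tau\in\mathcal{T}}\mathbb{E}\big[\int_{[0,\tau]}f_i(t)\,\mu^A(dt)+Y_\tau\big]$. Then $V^P:=\sup_{Y\in\mathcal{Y}}\mathbb{E}\big[\sum_{i=1}^n\big(\int_{[0,\hat\tau_i]}g_i(t)\,\mu^P(dt)-Y_{\hat\tau_i}\big)\big]$.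 Discrete-time problems: $(\pi_m)_{m\ge1}$ is a sequence of partitions of $[0,T]$, $\pi_m=(t^m_j)_{0\le j\le m}$ with $0=t^m_0<\cdots<t^m_m=T$, and $|\pi_m|:=\max_{0\le j\le m-1}(t^m_{j+1}-t^m_j)\to0$ as $m\to\infty$. Set $\mu^{A,\pi_m}(dt):=\sum_{j=1}^m\mu^A((t^m_{j-1},t^m_j])\,\delta_{t^m_j}(dt)$ and $\mu^{P,\pi_m}(dt):=\sum_{j=1}^m\mu^P((t^m_{j-1},t^m_j])\,\delta_{t^m_j}(dt)$. For $\pi=\pi_m$ (write $t_j=t^m_j$): $\mathbb{F}^\pi$ is the filtration with $\mathcal{F}^\pi_t:=\mathcal{F}_{t_j}$ for $t\in[t_j,t_{j+1})$ and $\mathcal{F}^\pi_T:=\mathcal{F}_T$; $\mathcal{T}^\pi$ is the set of $\mathbb{F}^\pi$-stopping times with values in $\pi$; $\mathcal{Y}^\pi$ is the set of $\mathbb{F}^\pi$-adapted processes $Y$ with $Y_t=Y_{t_j}$ for $t\in[t_j,t_{j+1})$, $\mathbb{E}[|Y_{t_j}|]<\infty$ for all $j=0,\dots,m$, and $Y_T\ge\xi$. Given $Y\in\mathcal{Y}^\pi$, $\hat\tau_i\in\mathcal{T}^\pi$ denotes the smallest optimal stopping time of $\sup_{\tau\in\mathcal{T}^\pi}\mathbb{E}\big[\int_{[0,\tau]}f_i(t)\,\mu^{A,\pi}(dt)+Y_\tau\big]$, and $V^{P,\pi}:=\sup_{Y\in\mathcal{Y}^\pi}\mathbb{E}\big[\sum_{i=1}^n\big(\int_{[0,\hat\tau_i]}g_i(t)\,\mu^{P,\pi}(dt)-Y_{\hat\tau_i}\big)\big]$.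 *)

theory Defs
  imports "HOL-Probability.Probability"
begin

text \<open>
  Filtrations and stopping times are those of \<open>HOL-Probability.Stopping_Time\<close>, indexed by the
  type \<^typ>\<open>real\<close>. Only the members of a filtration with index in \<open>[0,T]\<close> matter below: a filtration
  on \<open>[0,T]\<close> is extended by constants, and for a random time with values in \<open>[0,T]\<close>
  the stopping time condition is vacuous outside \<open>[0,T]\<close>. Likewise processes are functions
  \<open>X t \<omega>\<close> of which only the values with \<open>t \<in> [0,T]\<close> and \<open>\<omega>\<close> in the sample space matter.
\<close>

section \<open>Processes on \<open>[0,T]\<close>\<close>

definition usual_conditions :: "'a measure \<Rightarrow> (real \<Rightarrow> 'a measure) \<Rightarrow> real \<Rightarrow> bool" where
  "usual_conditions M F T \<longleftrightarrow>
     null_sets M \<subseteq> sets (F 0) \<and>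
     (\<forall>t\<in>{0..<T}. sets (F t) = (\<Inter>s\<in>{t<..T}. sets (F s)))"

definition adapted :: "(real \<Rightarrow> 'a measure) \<Rightarrow> real \<Rightarrow> (real \<Rightarrow> 'a \<Rightarrow> real) \<Rightarrow> bool" where
  "adapted F T X \<longleftrightarrow> (\<forall>t\<in>{0..T}. X t \<in> borel_measurable (F t))"

definition progressively_measurable ::
    "(real \<Rightarrow> 'a measure) \<Rightarrow> real \<Rightarrow> (real \<Rightarrow> 'a \<Rightarrow> real) \<Rightarrow> bool" where
  "progressively_measurable F T X \<longleftrightarrow>
     (\<forall>t\<in>{0..T}. (\<lambda>(s, \<omega>). X s \<omega>) \<in> borel_measurable (restrict_space borel {0..t} \<Otimes>\<^sub>M F t))"

definition cadlag :: "real \<Rightarrow> (real \<Rightarrow> real) \<Rightarrow> bool" where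
  "cadlag T x \<longleftrightarrow>
     (\<forall>t\<in>{0..<T}. (x \<longlongrightarrow> x t) (at_right t)) \<and>
     (\<forall>t\<in>{0<..T}. \<exists>l. (x \<longlongrightarrow> l) (at_left t))"

definition optional_sigma :: "(real \<Rightarrow> 'a measure) \<Rightarrow> real \<Rightarrow> (real \<times> 'a) measure" where
  "optional_sigma F T =
     sigma ({0..T} \<times> space (F T))
       {{(t, \<omega>). t \<in> {0..T} \<and> \<omega> \<in> space (F T) \<and> X t \<omega> \<in> B} | X B.
          adapted F T X \<and> (\<forall>\<omega>\<in>space (F T). cadlag T (\<lambda>t. X t \<omega>)) \<and> B \<in> sets borel}"

definition optional_process ::
    "(real \<Rightarrow> 'a measure) \<Rightarrow> real \<Rightarrow> (real \<Rightarrow> 'a \<Rightarrow> real) \<Rightarrow> bool" where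
  "optional_process F T Y \<longleftrightarrow> (\<lambda>(t, \<omega>). Y t \<omega>) \<in> borel_measurable (optional_sigma F T)"

definition stopping_times :: "(real \<Rightarrow> 'a measure) \<Rightarrow> real \<Rightarrow> ('a \<Rightarrow> real) set" where
  "stopping_times F T = {\<tau>. stopping_time F \<tau> \<and> (\<forall>\<omega>\<in>space (F T). \<tau> \<omega> \<in> {0..T})}"

definition uniformly_integrable :: "'a measure \<Rightarrow> ('a \<Rightarrow> real) set \<Rightarrow> bool" where
  "uniformly_integrable M \<X> \<longleftrightarrow>
     \<X> \<subseteq> borel_measurable M \<and>
     ((\<lambda>c. SUP X\<in>\<X>. \<integral>\<^sup>+\<omega>\<in>{\<omega>. c < \<bar>X \<omega>\<bar>}. ennreal \<bar>X \<omega>\<bar> \<partial>M) \<longlongrightarrow> 0) (at_top :: real filter)"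

definition class_D ::
    "'a measure \<Rightarrow> (real \<Rightarrow> 'a measure) \<Rightarrow> real \<Rightarrow> (real \<Rightarrow> 'a \<Rightarrow> real) \<Rightarrow> bool" where
  "class_D M F T Y \<longleftrightarrow>
     uniformly_integrable M ((\<lambda>\<tau> \<omega>. Y (\<tau> \<omega>) \<omega>) ` stopping_times F T)"

text \<open>
  Relations between stopping times are understood almost surely. For a complete filtration, this
  gives the same notion as demanding them everywhere, since all the stopping times involved
  may be set to \<open>0\<close> on a null set without changing the expectations.
\<close>

definition USCE ::
    "'a measure \<Rightarrow> (real \<Rightarrow> 'a measure) \<Rightarrow> real \<Rightarrow> (real \<Rightarrow> 'a \<Rightarrow> real) \<Rightarrow> bool" where
  "USCE M F T Y \<longleftrightarrow>
     (\<forall>\<tau> \<tau>s. \<tau> \<in> stopping_times F T \<and> (\<forall>k::nat. \<tau>s k \<in> stopping_times F T) \<and>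
        (AE \<omega> in M. (\<lambda>k. \<tau>s k \<omega>) \<longlonglongrightarrow> \<tau> \<omega>) \<and>
        ((AE \<omega> in M. \<forall>k. \<tau>s k \<omega> \<le> \<tau>s (Suc k) \<omega> \<and> (\<tau> \<omega> > 0 \<longrightarrow> \<tau>s k \<omega> < \<tau> \<omega>)) \<or>
         (\<forall>k. AE \<omega> in M. \<tau>s k \<omega> \<ge> \<tau> \<omega>)) \<longrightarrow>
        ereal (\<integral>\<omega>. Y (\<tau> \<omega>) \<omega> \<partial>M) \<ge> limsup (\<lambda>k. ereal (\<integral>\<omega>. Y (\<tau>s k \<omega>) \<omega> \<partial>M)))"

definition contracts ::
    "'a measure \<Rightarrow> (real \<Rightarrow> 'a measure) \<Rightarrow> real \<Rightarrow> ('a \<Rightarrow> real) \<Rightarrow> (real \<Rightarrow> 'a \<Rightarrow> real) set" where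
  "contracts M F T \<xi> =
     {Y. optional_process F T Y \<and> USCE M F T Y \<and> class_D M F T Y \<and> (AE \<omega> in M. Y T \<omega> \<ge> \<xi> \<omega>)}"

definition atomless :: "'a measure \<Rightarrow> bool" where
  "atomless \<mu> \<longleftrightarrow>
     (\<forall>A\<in>sets \<mu>. emeasure \<mu> A > 0 \<longrightarrow>
        (\<exists>B\<in>sets \<mu>. B \<subseteq> A \<and> 0 < emeasure \<mu> B \<and> emeasure \<mu> B < emeasure \<mu> A))"

section \<open>The principal-agent problem\<close>

definition agent_payoff ::
    "'a measure \<Rightarrow> real measure \<Rightarrow> (real \<Rightarrow> 'a \<Rightarrow> real) \<Rightarrow> (real \<Rightarrow> 'a \<Rightarrow> real) \<Rightarrow> ('a \<Rightarrow> real) \<Rightarrow> real" where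
  "agent_payoff M \<mu> f Y \<tau> = (\<integral>\<omega>. (LINT t:{0..\<tau> \<omega>}|\<mu>. f t \<omega>) + Y (\<tau> \<omega>) \<omega> \<partial>M)"

definition optimal_in :: "'b set \<Rightarrow> ('b \<Rightarrow> real) \<Rightarrow> 'b \<Rightarrow> bool" where
  "optimal_in S J \<tau> \<longleftrightarrow> \<tau> \<in> S \<and> (\<forall>\<sigma>\<in>S. J \<sigma> \<le> J \<tau>)"

definition smallest_optimal ::
    "'a measure \<Rightarrow> ('a \<Rightarrow> real) set \<Rightarrow> (('a \<Rightarrow> real) \<Rightarrow> real) \<Rightarrow> ('a \<Rightarrow> real) \<Rightarrow> bool" where
  "smallest_optimal M S J \<tau> \<longleftrightarrow>
     optimal_in S J \<tau> \<and> (\<forall>\<sigma>. optimal_in S J \<sigma> \<longrightarrow> (AE \<omega> in M. \<tau> \<omega> \<le> \<sigma> \<omega>))"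

definition principal_payoff ::
    "'a measure \<Rightarrow> nat \<Rightarrow> real measure \<Rightarrow> (nat \<Rightarrow> real \<Rightarrow> 'a \<Rightarrow> real) \<Rightarrow>
     (real \<Rightarrow> 'a \<Rightarrow> real) \<Rightarrow> (nat \<Rightarrow> 'a \<Rightarrow> real) \<Rightarrow> real" where
  "principal_payoff M n \<mu> g Y \<tau> =
     (\<integral>\<omega>. (\<Sum>i=1..n. (LINT t:{0..\<tau> i \<omega>}|\<mu>. g i t \<omega>) - Y (\<tau> i \<omega>) \<omega>) \<partial>M)"

text \<open>
  The smallest optimal stopping time is unique only up to null sets, so the supremum ranges over
  the contracts \<open>Y \<in> C\<close> together with any versions \<open>\<tau> i\<close> of the agents' smallest optimal
  stopping times in \<open>S\<close>; the payoff does not depend on the version. The supremum is taken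
  in the extended reals.
\<close>

definition principal_value ::
    "'a measure \<Rightarrow> nat \<Rightarrow> real measure \<Rightarrow> real measure \<Rightarrow> (nat \<Rightarrow> real \<Rightarrow> 'a \<Rightarrow> real) \<Rightarrow>
     (nat \<Rightarrow> real \<Rightarrow> 'a \<Rightarrow> real) \<Rightarrow> ('a \<Rightarrow> real) set \<Rightarrow> (real \<Rightarrow> 'a \<Rightarrow> real) set \<Rightarrow> ereal" where
  "principal_value M n \<mu>A \<mu>P f g S C =
     Sup {ereal (principal_payoff M n \<mu>P g Y \<tau>) | Y \<tau>.
            Y \<in> C \<and> (\<forall>i\<in>{1..n}. smallest_optimal M S (agent_payoff M \<mu>A (f i) Y) (\<tau> i))}"

definition V_P ::
    "'a measure \<Rightarrow> (real \<Rightarrow> 'a measure) \<Rightarrow> real \<Rightarrow> nat \<Rightarrow> real measure \<Rightarrow> real measure \<Rightarrow>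
     (nat \<Rightarrow> real \<Rightarrow> 'a \<Rightarrow> real) \<Rightarrow> (nat \<Rightarrow> real \<Rightarrow> 'a \<Rightarrow> real) \<Rightarrow> ('a \<Rightarrow> real) \<Rightarrow> ereal" where
  "V_P M F T n \<mu>A \<mu>P f g \<xi> =
     principal_value M n \<mu>A \<mu>P f g (stopping_times F T) (contracts M F T \<xi>)"

section \<open>The discretized problem\<close>

text \<open>A partition with \<open>m\<close> steps is a function \<open>p\<close> of which only \<open>p 0, \<dots>, p m\<close> matter.\<close>

definition is_partition :: "real \<Rightarrow> nat \<Rightarrow> (nat \<Rightarrow> real) \<Rightarrow> bool" where
  "is_partition T m p \<longleftrightarrow> p 0 = 0 \<and> p m = T \<and> (\<forall>j<m. p j < p (Suc j))"

definition mesh :: "nat \<Rightarrow> (nat \<Rightarrow> real) \<Rightarrow> real" where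
  "mesh m p = Max ((\<lambda>j. p (Suc j) - p j) ` {..<m})"

text \<open>
  \<open>\<Sum>\<^sub>j \<mu>((p\<^sub>j\<^sub>-\<^sub>1, p\<^sub>j]) \<delta>\<^bsub>p\<^sub>j\<^esub>\<close>, written as the image under \<open>p\<close> of the measure on \<open>{1..m}\<close> with these
  weights; see \<open>emeasure_grid_measure\<close> below.
\<close>

definition grid_measure :: "real measure \<Rightarrow> nat \<Rightarrow> (nat \<Rightarrow> real) \<Rightarrow> real measure" where
  "grid_measure \<mu> m p = distr (point_measure {1..m} (\<lambda>j. emeasure \<mu> {p (j - 1)<..p j})) \<mu> p"

text \<open>The maximum is the last partition point not exceeding \<open>s\<close>.\<close>

definition grid_filtration :: "(real \<Rightarrow> 'a measure) \<Rightarrow> nat \<Rightarrow> (nat \<Rightarrow> real) \<Rightarrow> real \<Rightarrow> 'a measure" where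
  "grid_filtration F m p s = F (Max (insert (p 0) {p j | j. j \<le> m \<and> p j \<le> s}))"

definition grid_stopping_times ::
    "(real \<Rightarrow> 'a measure) \<Rightarrow> real \<Rightarrow> nat \<Rightarrow> (nat \<Rightarrow> real) \<Rightarrow> ('a \<Rightarrow> real) set" where
  "grid_stopping_times F T m p =
     {\<tau>. stopping_time (grid_filtration F m p) \<tau> \<and> (\<forall>\<omega>\<in>space (F T). \<tau> \<omega> \<in> p ` {0..m})}"

definition grid_contracts ::
    "'a measure \<Rightarrow> (real \<Rightarrow> 'a measure) \<Rightarrow> real \<Rightarrow> ('a \<Rightarrow> real) \<Rightarrow> nat \<Rightarrow> (nat \<Rightarrow> real) \<Rightarrow>
     (real \<Rightarrow> 'a \<Rightarrow> real) set" where
  "grid_contracts M F T \<xi> m p =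
     {Y. adapted (grid_filtration F m p) T Y \<and>
         (\<forall>j<m. \<forall>t\<in>{p j..<p (Suc j)}. \<forall>\<omega>\<in>space M. Y t \<omega> = Y (p j) \<omega>) \<and>
         (\<forall>j\<le>m. integrable M (Y (p j))) \<and>
         (AE \<omega> in M. Y T \<omega> \<ge> \<xi> \<omega>)}"

definition V_P_grid ::
    "'a measure \<Rightarrow> (real \<Rightarrow> 'a measure) \<Rightarrow> real \<Rightarrow> nat \<Rightarrow> real measure \<Rightarrow> real measure \<Rightarrow>
     (nat \<Rightarrow> real \<Rightarrow> 'a \<Rightarrow> real) \<Rightarrow> (nat \<Rightarrow> real \<Rightarrow> 'a \<Rightarrow> real) \<Rightarrow> ('a \<Rightarrow> real) \<Rightarrow>
     nat \<Rightarrow> (nat \<Rightarrow> real) \<Rightarrow> ereal" where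
  "V_P_grid M F T n \<mu>A \<mu>P f g \<xi> m p =
     principal_value M n (grid_measure \<mu>A m p) (grid_measure \<mu>P m p) f g
       (grid_stopping_times F T m p) (grid_contracts M F T \<xi> m p)"

lemma is_partition_mono:
  assumes "is_partition T m p" "i < j" "j \<le> m"
  shows "p i < p j"
  using assms(2,3)
proof (induction j)
  case (Suc j)
  have "p j < p (Suc j)"
    using assms(1) Suc.prems by (simp add: is_partition_def)
  then show ?case
    using Suc by (cases "i = j") auto
qed simp

lemma is_partition_range:
  assumes "is_partition T m p" "j \<le> m"
  shows "p j \<in> {0..T}"
proof -
  have "p 0 \<le> p j" "p j \<le> p m"
    using is_partition_mono[OF assms(1), of 0 j] is_partition_mono[OF assms(1), of j m] assms(2)
    by (cases "j = 0"; cases "j = m"; force)+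
  then show ?thesis
    using assms(1) by (simp add: is_partition_def)
qed

lemma emeasure_grid_measure:
  assumes p: "is_partition T m p" and \<mu>: "sets \<mu> = sets (restrict_space borel {0..T})"
    and B: "B \<in> sets \<mu>"
  shows "emeasure (grid_measure \<mu> m p) B =
    (\<Sum>j=1..m. emeasure \<mu> {p (j - 1)<..p j} * indicator B (p j))"
proof -
  let ?N = "point_measure {1..m} (\<lambda>j. emeasure \<mu> {p (j - 1)<..p j})"
  have "space \<mu> = {0..T}"
    using sets_eq_imp_space_eq[OF \<mu>] by (simp add: space_restrict_space)
  then have "p \<in> ?N \<rightarrow>\<^sub>M \<mu>"
    using is_partition_range[OF p] by (auto simp: measurable_point_measure_eq1)
  then have "emeasure (grid_measure \<mu> m p) B = emeasure ?N (p -` B \<inter> {1..m})"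
    using B by (simp add: grid_measure_def emeasure_distr space_point_measure)
  also have "\<dots> = (\<Sum>j\<in>p -` B \<inter> {1..m}. emeasure \<mu> {p (j - 1)<..p j})"
    by (rule emeasure_point_measure_finite) auto
  also have "\<dots> = (\<Sum>j=1..m. emeasure \<mu> {p (j - 1)<..p j} * indicator B (p j))"
    by (rule sum.mono_neutral_cong_left) (auto simp: indicator_def)
  finally show ?thesis .
qed

lemma grid_filtration_eq:
  assumes p: "is_partition T m p" and j: "j < m" and s: "s \<in> {p j..<p (Suc j)}"
  shows "grid_filtration F m p s = F (p j)"
proof -
  have le: "p i \<le> p j" if "i \<le> m" "p i \<le> s" for i
  proof (rule ccontr)
    assume "\<not> p i \<le> p j"
    then have "Suc j \<le> i"
      using is_partition_mono[OF p, of i j] j by (cases "i = j"; cases "i < j") auto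
    then have "p (Suc j) \<le> p i"
      using is_partition_mono[OF p, of "Suc j" i] that by (cases "i = Suc j") auto
    with that s show False by simp
  qed
  have "p 0 \<le> p j"
    using is_partition_mono[OF p, of 0 j] j by (cases "j = 0") auto
  then have "Max (insert (p 0) {p i | i. i \<le> m \<and> p i \<le> s}) = p j"
    using le j s by (intro Max_eqI) auto
  then show ?thesis
    by (simp add: grid_filtration_def)
qed

lemma grid_filtration_end:
  assumes p: "is_partition T m p"
  shows "grid_filtration F m p T = F T"
proof -
  have "p m = T" "p 0 \<le> T"
    using is_partition_range[OF p, of 0] p by (auto simp: is_partition_def)
  then have "Max (insert (p 0) {p i | i. i \<le> m \<and> p i \<le> T}) = T"
    by (intro Max_eqI) auto
  then show ?thesis
    by (simp add: grid_filtration_def)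
qed

end

theory Submission
  imports Defs
begin

text \<open>
  Both values, that of the original problem and that of a discretized one, are suprema over
  chains of stopping times of functionals of the same form, and these depend continuously on
  the chain and on the discretization.

  Since \<open>f\<^sub>1 < \<dots> < f\<^sub>n\<close>, any contract makes the agents stop in the order \<open>\<tau>\<^sub>1 \<le> \<dots> \<le> \<tau>\<^sub>n\<close>
  (\<open>smallest_optimal_mono\<close>). Agent \<open>k\<close> weakly prefers \<open>\<tau>\<^sub>k\<close> to \<open>\<tau>\<^bsub>k+1\<^esub>\<close>, so the payment at \<open>\<tau>\<^sub>k\<close> is worth
  at least the gains that agent \<open>k\<close> forgoes up to \<open>\<tau>\<^bsub>k+1\<^esub>\<close> and the payment at \<open>\<tau>\<^bsub>k+1\<^esub>\<close>. Adding up,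
  the principal gets at most the value \<open>W\<close> of the chain (\<open>chain_value\<close>), in which the
  payment to an agent is worth \<open>\<xi>\<close> and, at every date after he has stopped, the rate \<open>f\<^sub>k\<close> of the
  last agent \<open>k\<close> to have stopped (\<open>marginal_wage\<close>). Which chains occur? When \<open>\<mu>\<^sup>A\<close> has gaps, two agents have identical
  interests while the clock \<open>\<mu>\<^sup>A\<close> stands still, and they cannot be made to stop at different times
  unless this is compatible with what they know: no event of positive probability known at \<open>\<tau>\<^sub>k\<close>
  may imply \<open>\<tau>\<^sub>k < \<tau>\<^bsub>k+1\<^esub>\<close> and \<open>\<mu>\<^sup>A (\<tau>\<^sub>k, \<tau>\<^bsub>k+1\<^esub>] = 0\<close>. Such chains are called separated. Hence
  \<open>principal_payoff_le_chain_value\<close>.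

  Conversely, the value of a separated chain is approached by contracts. Only the payments at
  the times \<open>\<tau>\<^sub>k\<close> and at \<open>T\<close> matter; elsewhere the contract pays too little for anybody to stop
  (\<open>chain_implemented\<close>). In discrete time the payments are conditional expectations on the
  partition (\<open>grid_implementation\<close>). In continuous time the path of a martingale need not be
  followed between the \<open>\<tau>\<^sub>k\<close>: after stopping everybody once the agents' rates have spent a large
  budget \<open>c\<close>, a constant is low enough. Such a contract has upper semicontinuous paths, which
  gives semicontinuity in expectation at once, and \<open>c \<rightarrow> \<infinity>\<close> (\<open>chain_value_le_continuous\<close>).

  It remains to compare the two suprema of \<open>W\<close>. Stopping times of a discretized problem are
  stopping times of the original one, the two notions of separation agree for them, and the two
  functionals differ by at most a multiple of the oscillation of the rates in the cells of the partition, whose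
  expectation vanishes in the limit (\<open>deviation_tendsto\<close>). In the other direction a chain is
  rounded up to the partition. This may destroy separation; it is restored by moving each time down
  to the least one that the clock does not distinguish from it (\<open>separated_chain_below\<close>), and
  right-continuity of the filtration shows that almost surely nothing is moved in the end
  (\<open>separated_approximation\<close>).
\<close>

section \<open>Stopping times and integrable rates\<close>

locale filtered_prob_space = prob_space M + filtration "space M" F
  for M :: "'a measure" and F :: "real \<Rightarrow> 'a measure" +
  fixes T :: real
  assumes sets_F: "\<And>t. sets (F t) \<subseteq> sets M" and T_pos: "0 < T"
    and usual: "usual_conditions M F T"
begin

text \<open>
  The stopping times of a discretized problem are those of \<open>F\<close> with values in the partition (see
  \<open>grid_stopping_times_eq\<close> below), so that the set \<open>D\<close> of dates is all that changes between the problems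
  as far as stopping is concerned.
\<close>

definition times :: "real set \<Rightarrow> ('a \<Rightarrow> real) set" where
  "times D = {\<tau> \<in> stopping_times F T. \<forall>\<omega>\<in>space M. \<tau> \<omega> \<in> D}"

lemma stopping_times_eq_times: "stopping_times F T = times {0..T}"
  by (auto simp: times_def stopping_times_def space_F)

lemma timesD:
  assumes "\<tau> \<in> times D"
  shows "stopping_time F \<tau>" "\<tau> \<in> borel_measurable M"
    "\<And>\<omega>. \<omega> \<in> space M \<Longrightarrow> 0 \<le> \<tau> \<omega>" "\<And>\<omega>. \<omega> \<in> space M \<Longrightarrow> \<tau> \<omega> \<le> T"
    "\<And>\<omega>. \<omega> \<in> space M \<Longrightarrow> \<tau> \<omega> \<in> D"
  using assms measurable_stopping_time[of F \<tau> M] sets_F space_F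
  by (auto simp: times_def stopping_times_def)

lemma timesI:
  assumes "stopping_time F \<tau>" "\<And>\<omega>. \<omega> \<in> space M \<Longrightarrow> 0 \<le> \<tau> \<omega> \<and> \<tau> \<omega> \<le> T \<and> \<tau> \<omega> \<in> D"
  shows "\<tau> \<in> times D"
  using assms by (auto simp: times_def stopping_times_def space_F)

lemma times_subset: "times D \<subseteq> times {0..T}"
  by (auto simp: times_def stopping_times_def space_F)

lemma times_min: "\<sigma> \<in> times D \<Longrightarrow> \<tau> \<in> times D \<Longrightarrow> (\<lambda>\<omega>. min (\<sigma> \<omega>) (\<tau> \<omega>)) \<in> times D"
  by (rule timesI, rule stopping_time_min) (auto dest: timesD simp: min_def)

lemma times_max: "\<sigma> \<in> times D \<Longrightarrow> \<tau> \<in> times D \<Longrightarrow> (\<lambda>\<omega>. max (\<sigma> \<omega>) (\<tau> \<omega>)) \<in> times D"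
  by (rule timesI, rule stopping_time_max) (auto dest: timesD simp: max_def)

lemma times_T: "T \<in> D \<Longrightarrow> (\<lambda>_. T) \<in> times D"
  using T_pos by (intro timesI stopping_time_const) auto

lemma pre_sigma_into_M:
  assumes "\<tau> \<in> times D" "B \<in> sets (pre_sigma \<tau>)"
  shows "B \<in> sets M"
proof -
  have sub: "B \<subseteq> space M"
    using sets.sets_into_space[OF assms(2)] by (simp add: space_pre_sigma)
  have "{\<omega> \<in> B. \<tau> \<omega> \<le> T} \<in> sets (F T)"
    by (rule sets_pre_sigmaD[OF timesD(1)[OF assms(1)] assms(2)])
  moreover have "{\<omega> \<in> B. \<tau> \<omega> \<le> T} = B"
    using sub timesD(4)[OF assms(1)] by auto
  ultimately show ?thesis using sets_F[of T] by auto
qed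

lemma subalgebra_pre_sigma: "\<tau> \<in> times D \<Longrightarrow> subalgebra M (pre_sigma \<tau>)"
  using pre_sigma_into_M by (auto simp: subalgebra_def space_pre_sigma)

lemma times_cong:
  assumes "\<sigma> \<in> times D" "\<And>\<omega>. \<omega> \<in> space M \<Longrightarrow> \<sigma> \<omega> = \<tau> \<omega>"
  shows "\<tau> \<in> times D"
proof -
  have "stopping_time F \<tau> \<longleftrightarrow> stopping_time F \<sigma>"
    by (rule stopping_time_cong) (simp add: assms(2) space_F)
  then show ?thesis
    using assms by (auto simp: times_def stopping_times_def space_F)
qed

text \<open>
  At \<open>\<sigma>\<close> one may decide, on the basis of what is known then, to wait until \<open>\<tau>\<close>.
\<close>

lemma switch_times:
  assumes \<sigma>: "\<sigma> \<in> times D" and \<tau>: "\<tau> \<in> times D"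
    and le: "\<And>\<omega>. \<omega> \<in> space M \<Longrightarrow> \<sigma> \<omega> \<le> \<tau> \<omega>" and B: "B \<in> sets (pre_sigma \<sigma>)"
  shows "(\<lambda>\<omega>. if \<omega> \<in> B then \<sigma> \<omega> else \<tau> \<omega>) \<in> times D"
proof (rule timesI)
  show "stopping_time F (\<lambda>\<omega>. if \<omega> \<in> B then \<sigma> \<omega> else \<tau> \<omega>)"
    unfolding stopping_time_def
  proof
    fix t
    have 1: "{\<omega>\<in>B. \<sigma> \<omega> \<le> t} \<in> sets (F t)"
      by (rule sets_pre_sigmaD[OF timesD(1)[OF \<sigma>] B])
    have "B \<in> sets (pre_sigma \<tau>)"
      using mono_pre_sigma[OF timesD(1)[OF \<sigma>] timesD(1)[OF \<tau>] le] B by auto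
    then have 2: "{\<omega>\<in>B. \<tau> \<omega> \<le> t} \<in> sets (F t)"
      by (rule sets_pre_sigmaD[OF timesD(1)[OF \<tau>]])
    have 3: "{\<omega>\<in>space (F t). \<tau> \<omega> \<le> t} \<in> sets (F t)"
      using stopping_timeD[OF timesD(1)[OF \<tau>]] by (auto simp: pred_def)
    have "B \<subseteq> space M"
      using sets.sets_into_space[OF B] by (simp add: space_pre_sigma)
    then have "{\<omega>\<in>space (F t). (if \<omega> \<in> B then \<sigma> \<omega> else \<tau> \<omega>) \<le> t}
      = {\<omega>\<in>B. \<sigma> \<omega> \<le> t} \<union> ({\<omega>\<in>space (F t). \<tau> \<omega> \<le> t} - {\<omega>\<in>B. \<tau> \<omega> \<le> t})"
      by (auto simp: space_F)
    also have "\<dots> \<in> sets (F t)" using 1 2 3 by auto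
    finally show "Measurable.pred (F t) (\<lambda>\<omega>. (if \<omega> \<in> B then \<sigma> \<omega> else \<tau> \<omega>) \<le> t)"
      by (simp add: pred_def)
  qed
qed (use timesD[OF \<sigma>] timesD[OF \<tau>] in auto)

lemma switch_times':
  assumes \<sigma>: "\<sigma> \<in> times D" and \<tau>: "\<tau> \<in> times D"
    and le: "\<And>\<omega>. \<omega> \<in> space M \<Longrightarrow> \<sigma> \<omega> \<le> \<tau> \<omega>" and B: "B \<in> sets (pre_sigma \<sigma>)"
  shows "(\<lambda>\<omega>. if \<omega> \<in> B then \<tau> \<omega> else \<sigma> \<omega>) \<in> times D"
proof -
  have "space M - B \<in> sets (pre_sigma \<sigma>)"
    using B sets.compl_sets[of B "pre_sigma \<sigma>"] by (simp add: space_pre_sigma)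
  from switch_times[OF \<sigma> \<tau> le this]
  show ?thesis by (rule times_cong) auto
qed

lemma less_pre_sigma:
  assumes "\<sigma> \<in> times D" "\<tau> \<in> times D'"
  shows "{\<omega> \<in> space M. \<sigma> \<omega> < \<tau> \<omega>} \<in> sets (pre_sigma \<sigma>)"
  using stopping_time_less[OF timesD(1)[OF assms(1)] timesD(1)[OF assms(2)]]
  by (simp add: pred_def space_pre_sigma)

text \<open>On \<open>{\<sigma> = \<tau>}\<close> the two stopping times carry the same information.\<close>

lemma pre_sigma_local:
  assumes \<sigma>: "\<sigma> \<in> times D" and \<tau>: "\<tau> \<in> times D'"
    and B: "B \<in> sets (pre_sigma \<sigma>)" and eq: "\<And>\<omega>. \<omega> \<in> B \<Longrightarrow> \<sigma> \<omega> = \<tau> \<omega>"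
  shows "B \<in> sets (pre_sigma \<tau>)"
proof (rule sets_pre_sigmaI[OF timesD(1)[OF \<tau>]])
  fix t
  have "{\<omega> \<in> B. \<tau> \<omega> \<le> t} = {\<omega> \<in> B. \<sigma> \<omega> \<le> t}" using eq by auto
  then show "{\<omega> \<in> B. \<tau> \<omega> \<le> t} \<in> sets (F t)"
    using sets_pre_sigmaD[OF timesD(1)[OF \<sigma>] B] by simp
qed

lemma coincidence_pre_sigma:
  assumes \<sigma>: "\<sigma> \<in> times D" and \<tau>: "\<tau> \<in> times D'"
  shows "{\<omega> \<in> space M. \<sigma> \<omega> = \<tau> \<omega>} \<in> sets (pre_sigma \<sigma>)" (is "?E \<in> _")
proof -
  have \<sigma>': "\<sigma> \<in> times {0..T}" and \<tau>': "\<tau> \<in> times {0..T}"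
    using \<sigma> \<tau> times_subset by auto
  let ?m = "\<lambda>\<omega>. min (\<sigma> \<omega>) (\<tau> \<omega>)"
  have m: "?m \<in> times {0..T}" by (rule times_min[OF \<sigma>' \<tau>'])
  have "{\<omega> \<in> space M. ?m \<omega> < \<sigma> \<omega>} \<in> sets (pre_sigma \<sigma>)"
    using less_pre_sigma[OF m \<sigma>] mono_pre_sigma[OF timesD(1)[OF m] timesD(1)[OF \<sigma>]] by auto
  moreover have "{\<omega> \<in> space M. \<sigma> \<omega> < \<tau> \<omega>} \<in> sets (pre_sigma \<sigma>)"
    by (rule less_pre_sigma[OF \<sigma> \<tau>])
  ultimately have "space M - {\<omega> \<in> space M. ?m \<omega> < \<sigma> \<omega>} - {\<omega> \<in> space M. \<sigma> \<omega> < \<tau> \<omega>}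
      \<in> sets (pre_sigma \<sigma>)"
    using sets.top[of "pre_sigma \<sigma>"] by (auto simp: space_pre_sigma)
  moreover have "space M - {\<omega> \<in> space M. ?m \<omega> < \<sigma> \<omega>} - {\<omega> \<in> space M. \<sigma> \<omega> < \<tau> \<omega>} = ?E"
    by (auto simp: min_def not_less split: if_splits)
  ultimately show ?thesis by simp
qed

end

text \<open>
  The measures against which the rates of the agents and of the principal are integrated. The
  discretized measures are clocks as well.
\<close>

locale clock = filtered_prob_space M F T + clock: finite_measure \<mu>
  for M :: "'a measure" and F T and \<mu> :: "real measure" +
  assumes sets_clock: "sets \<mu> = sets (restrict_space borel {0..T})"

sublocale clock \<subseteq> pair_sigma_finite \<mu> M ..

context clock begin

lemma space_clock: "space \<mu> = {0..T}"
  using sets_eq_imp_space_eq[OF sets_clock] by (simp add: space_restrict_space)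

lemma interval_clock [simp, measurable]:
  "0 \<le> a \<Longrightarrow> b \<le> T \<Longrightarrow> {a..b} \<in> sets \<mu>" "0 \<le> a \<Longrightarrow> b \<le> T \<Longrightarrow> {a<..b} \<in> sets \<mu>"
  by (auto simp: sets_clock sets_restrict_space_iff)

lemma clock_measurable_id [measurable]: "(\<lambda>s. s) \<in> borel_measurable \<mu>"
  unfolding measurable_cong_sets[OF sets_clock refl, of borel] by (simp add: measurable_restrict_space1)

text \<open>
  Integrability on the product: by Fubini's theorem almost every path is integrable against the
  clock, and the accumulated gains are integrable random variables.
\<close>

definition rate :: "(real \<Rightarrow> 'a \<Rightarrow> real) \<Rightarrow> bool" where
  "rate u \<longleftrightarrow> integrable (\<mu> \<Otimes>\<^sub>M M) (\<lambda>(s, \<omega>). u s \<omega>)"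

lemma rate_measurable: "rate u \<Longrightarrow> (\<lambda>(s, \<omega>). u s \<omega>) \<in> borel_measurable (\<mu> \<Otimes>\<^sub>M M)"
  by (simp add: rate_def)

lemma rateI:
  assumes "(\<lambda>(s, \<omega>). u s \<omega>) \<in> borel_measurable (\<mu> \<Otimes>\<^sub>M M)"
    and "(\<integral>\<^sup>+\<omega>. (\<integral>\<^sup>+s. ennreal \<bar>u s \<omega>\<bar> \<partial>\<mu>) \<partial>M) < \<infinity>"
  shows "rate u"
proof -
  have "(\<integral>\<^sup>+\<omega>. (\<integral>\<^sup>+s. ennreal \<bar>u s \<omega>\<bar> \<partial>\<mu>) \<partial>M)
      = (\<integral>\<^sup>+z. ennreal (norm (case z of (s, \<omega>) \<Rightarrow> u s \<omega>)) \<partial>(\<mu> \<Otimes>\<^sub>M M))"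
    using assms(1) by (subst nn_integral_snd[symmetric]) (auto simp: case_prod_beta')
  then show ?thesis using assms unfolding rate_def by (intro integrableI_bounded) auto
qed

lemma rate_bound:
  assumes "rate v" "(\<lambda>(s, \<omega>). u s \<omega>) \<in> borel_measurable (\<mu> \<Otimes>\<^sub>M M)"
    and "\<And>s \<omega>. s \<in> {0..T} \<Longrightarrow> \<omega> \<in> space M \<Longrightarrow> \<bar>u s \<omega>\<bar> \<le> \<bar>v s \<omega>\<bar>"
  shows "rate u"
  using assms(1,2) unfolding rate_def
  by (rule Bochner_Integration.integrable_bound)
    (auto intro!: AE_I2 assms(3) simp: space_pair_measure space_clock)

lemma rate_add: "rate u \<Longrightarrow> rate v \<Longrightarrow> rate (\<lambda>s \<omega>. u s \<omega> + v s \<omega>)"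
  unfolding rate_def case_prod_beta' by (rule Bochner_Integration.integrable_add)

lemma rate_diff: "rate u \<Longrightarrow> rate v \<Longrightarrow> rate (\<lambda>s \<omega>. u s \<omega> - v s \<omega>)"
  unfolding rate_def case_prod_beta' by (rule Bochner_Integration.integrable_diff)

lemma rate_sum: "(\<And>i. i \<in> I \<Longrightarrow> rate (u i)) \<Longrightarrow> rate (\<lambda>s \<omega>. \<Sum>i\<in>I. u i s \<omega>)"
  unfolding rate_def case_prod_beta' by (rule Bochner_Integration.integrable_sum)

lemma rate_abs: "rate u \<Longrightarrow> rate (\<lambda>s \<omega>. \<bar>u s \<omega>\<bar>)"
  unfolding rate_def case_prod_beta' by (rule Bochner_Integration.integrable_abs)

lemma rate_indicator:
  assumes "rate u" "Measurable.pred (\<mu> \<Otimes>\<^sub>M M) (\<lambda>(s, \<omega>). P s \<omega>)"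
  shows "rate (\<lambda>s \<omega>. of_bool (P s \<omega>) * u s \<omega>)"
proof (rule rate_bound[OF assms(1)])
  have [measurable]: "Measurable.pred (\<mu> \<Otimes>\<^sub>M M) (\<lambda>z. P (fst z) (snd z))"
    "(\<lambda>z. u (fst z) (snd z)) \<in> borel_measurable (\<mu> \<Otimes>\<^sub>M M)"
    using assms rate_measurable[OF assms(1)] by (simp_all add: case_prod_beta')
  show "(\<lambda>(s, \<omega>). of_bool (P s \<omega>) * u s \<omega>) \<in> borel_measurable (\<mu> \<Otimes>\<^sub>M M)"
    unfolding case_prod_beta' by measurable
qed auto

lemma rate_cut:
  assumes u: "rate u" and \<tau>: "\<tau> \<in> borel_measurable M"
  shows "rate (\<lambda>s \<omega>. of_bool (s \<le> \<tau> \<omega>) * u s \<omega>)" "rate (\<lambda>s \<omega>. of_bool (\<tau> \<omega> < s) * u s \<omega>)"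
  using \<tau> by (auto intro!: rate_indicator[OF u])

lemma rate_AE: "rate u \<Longrightarrow> AE \<omega> in M. integrable \<mu> (\<lambda>s. u s \<omega>)"
  unfolding rate_def by (rule AE_integrable_snd)

lemma rate_integrable: "rate u \<Longrightarrow> integrable M (\<lambda>\<omega>. \<integral>s. u s \<omega> \<partial>\<mu>)"
  unfolding rate_def by (rule integrable_snd)

lemma set_integral_upto:
  fixes v :: "real \<Rightarrow> real"
  assumes "t \<le> T"
  shows "(LINT s:{0..t}|\<mu>. v s) = (\<integral>s. of_bool (s \<le> t) * v s \<partial>\<mu>)"
  unfolding set_lebesgue_integral_def
  by (rule Bochner_Integration.integral_cong) (auto simp: space_clock indicator_def)

lemma set_integral_after:
  fixes v :: "real \<Rightarrow> real"
  assumes "0 \<le> t"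
  shows "(LINT s:{t<..T}|\<mu>. v s) = (\<integral>s. of_bool (t < s) * v s \<partial>\<mu>)"
  unfolding set_lebesgue_integral_def
  by (rule Bochner_Integration.integral_cong) (auto simp: space_clock indicator_def)

lemma integrable_cut:
  fixes v :: "real \<Rightarrow> real"
  assumes "integrable \<mu> v"
  shows "integrable \<mu> (\<lambda>s. of_bool (s \<le> t) * v s)" "integrable \<mu> (\<lambda>s. of_bool (t < s) * v s)"
  by (rule Bochner_Integration.integrable_bound[OF assms]; use borel_measurable_integrable[OF assms] in auto)+

lemma
  assumes u: "rate u" and \<tau>: "\<tau> \<in> times D"
  shows upto_integrable: "integrable M (\<lambda>\<omega>. LINT s:{0..\<tau> \<omega>}|\<mu>. u s \<omega>)"
    and after_integrable: "integrable M (\<lambda>\<omega>. LINT s:{\<tau> \<omega><..T}|\<mu>. u s \<omega>)"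
proof -
  show "integrable M (\<lambda>\<omega>. LINT s:{0..\<tau> \<omega>}|\<mu>. u s \<omega>)"
    using rate_integrable[OF rate_cut(1)[OF u timesD(2)[OF \<tau>]]] timesD(4)[OF \<tau>]
    by (simp add: set_integral_upto cong: Bochner_Integration.integrable_cong)
  show "integrable M (\<lambda>\<omega>. LINT s:{\<tau> \<omega><..T}|\<mu>. u s \<omega>)"
    using rate_integrable[OF rate_cut(2)[OF u timesD(2)[OF \<tau>]]] timesD(3)[OF \<tau>]
    by (simp add: set_integral_after cong: Bochner_Integration.integrable_cong)
qed

end

section \<open>The principal's value of a chain of stopping times\<close>

context clock begin

text \<open>
  Neighbours in the chain may stop at different times although the clock does not move in between,
  but it must not be certain, given what is known at the earlier time, that this happens. The
  pointwise condition \<open>\<tau> k \<omega> < \<tau> (Suc k) \<omega> \<longrightarrow> emeasure \<mu> {\<tau> k \<omega><..\<tau> (Suc k) \<omega>} \<noteq> 0\<close> would be too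
  strong: agent \<open>k + 1\<close> may wait at \<open>\<tau> k\<close> for news that make him work on, and stop before
  the clock moves if the news are bad.
\<close>

definition separated :: "nat \<Rightarrow> (nat \<Rightarrow> 'a \<Rightarrow> real) \<Rightarrow> bool" where
  "separated n \<tau> \<longleftrightarrow> (\<forall>k\<in>{1..<n}. \<forall>B\<in>sets (pre_sigma (\<tau> k)).
     (AE \<omega> in M. \<omega> \<in> B \<longrightarrow> \<tau> k \<omega> < \<tau> (Suc k) \<omega> \<and> emeasure \<mu> {\<tau> k \<omega><..\<tau> (Suc k) \<omega>} = 0) \<longrightarrow>
     emeasure M B = 0)"

definition ordered :: "nat \<Rightarrow> (nat \<Rightarrow> 'a \<Rightarrow> real) \<Rightarrow> bool" where
  "ordered n \<tau> \<longleftrightarrow> (\<forall>i j. 1 \<le> i \<longrightarrow> i \<le> j \<longrightarrow> j \<le> n \<longrightarrow> (\<forall>\<omega>\<in>space M. \<tau> i \<omega> \<le> \<tau> j \<omega>))"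

lemma orderedD:
  "ordered n \<tau> \<Longrightarrow> 1 \<le> i \<Longrightarrow> i \<le> j \<Longrightarrow> j \<le> n \<Longrightarrow> \<omega> \<in> space M \<Longrightarrow> \<tau> i \<omega> \<le> \<tau> j \<omega>"
  by (simp add: ordered_def)

definition chains :: "real set \<Rightarrow> nat \<Rightarrow> (nat \<Rightarrow> 'a \<Rightarrow> real) set" where
  "chains D n = {\<tau>. (\<forall>i\<in>{1..n}. \<tau> i \<in> times D) \<and> ordered n \<tau> \<and> separated n \<tau>}"

text \<open>
  Running maxima turn an almost sure order into an order everywhere.
\<close>

lemma ordered_version:
  assumes \<tau>: "\<And>i. i \<in> {1..n} \<Longrightarrow> \<tau> i \<in> times D"
    and AE: "AE \<omega> in M. \<forall>i\<in>{1..n}. \<forall>j\<in>{1..n}. i \<le> j \<longrightarrow> \<tau> i \<omega> \<le> \<tau> j \<omega>"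
  obtains \<tau>' where "\<And>i. i \<in> {1..n} \<Longrightarrow> \<tau>' i \<in> times D" "ordered n \<tau>'"
    "AE \<omega> in M. \<forall>i\<in>{1..n}. \<tau> i \<omega> = \<tau>' i \<omega>" "\<And>i \<omega>. i \<in> {1..n} \<Longrightarrow> \<exists>j\<in>{1..i}. \<tau>' i \<omega> = \<tau> j \<omega>"
proof -
  define \<tau>' where "\<tau>' k \<omega> = Max ((\<lambda>i. \<tau> i \<omega>) ` {1..k})" for k \<omega>
  have Suc: "\<tau>' (Suc k) = (\<lambda>\<omega>. max (\<tau> (Suc k) \<omega>) (\<tau>' k \<omega>))" if "1 \<le> k" for k
    using that by (auto simp: \<tau>'_def atLeastAtMostSuc_conv fun_eq_iff)
  have times: "\<tau>' i \<in> times D" if "1 \<le> i" "i \<le> n" for i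
    using that
  proof (induction i rule: dec_induct)
    case base
    then show ?case using \<tau>[of 1] by (simp add: \<tau>'_def)
  next
    case (step k)
    then show ?case using Suc[of k] times_max[OF \<tau>[of "Suc k"]] by simp
  qed
  show ?thesis
  proof (rule that[of \<tau>'])
    show "ordered n \<tau>'" unfolding ordered_def \<tau>'_def by (auto intro!: Max_mono)
    show "AE \<omega> in M. \<forall>i\<in>{1..n}. \<tau> i \<omega> = \<tau>' i \<omega>"
      using AE unfolding \<tau>'_def by eventually_elim (auto intro!: Max_eqI[symmetric])
    show "\<exists>j\<in>{1..i}. \<tau>' i \<omega> = \<tau> j \<omega>" if "i \<in> {1..n}" for i \<omega>
    proof -
      have "\<tau>' i \<omega> \<in> (\<lambda>i. \<tau> i \<omega>) ` {1..i}" unfolding \<tau>'_def by (rule Max_in) (use that in auto)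
      then show ?thesis by auto
    qed
  qed (use times in auto)
qed

lemma set_integral_split:
  fixes v :: "real \<Rightarrow> real"
  assumes v: "integrable \<mu> v" and st: "0 \<le> s" "s \<le> t" "t \<le> T"
  shows "(LINT r:{0..t}|\<mu>. v r) = (LINT r:{0..s}|\<mu>. v r) + (LINT r:{s<..t}|\<mu>. v r)"
    "(LINT r:{s<..T}|\<mu>. v r) = (LINT r:{s<..t}|\<mu>. v r) + (LINT r:{t<..T}|\<mu>. v r)"
proof -
  have 1: "set_integrable \<mu> {a..b} v" "set_integrable \<mu> {a<..b} v" if "0 \<le> a" "b \<le> T" for a b
    using v that unfolding set_integrable_def by (intro integrable_mult_indicator; simp)+
  have "{0..t} = {0..s} \<union> {s<..t}" "{s<..T} = {s<..t} \<union> {t<..T}"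
    using st by auto
  moreover have "{0..s} \<inter> {s<..t} = {}" "{s<..t} \<inter> {t<..T} = {}" by auto
  ultimately show "(LINT r:{0..t}|\<mu>. v r) = (LINT r:{0..s}|\<mu>. v r) + (LINT r:{s<..t}|\<mu>. v r)"
    "(LINT r:{s<..T}|\<mu>. v r) = (LINT r:{s<..t}|\<mu>. v r) + (LINT r:{t<..T}|\<mu>. v r)"
    using st by (auto intro!: set_integral_Un 1)
qed

lemma set_integrable_interval:
  fixes v :: "real \<Rightarrow> real"
  assumes "integrable \<mu> v" "0 \<le> a" "b \<le> T"
  shows "set_integrable \<mu> {a<..b} v"
  using assms unfolding set_integrable_def by (intro integrable_mult_indicator; simp)

lemma set_integral_null:
  fixes v :: "real \<Rightarrow> real"
  assumes "0 \<le> a" "b \<le> T" "emeasure \<mu> {a<..b} = 0"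
  shows "(LINT s:{a<..b}|\<mu>. v s) = 0"
  unfolding set_lebesgue_integral_def
proof (rule integral_eq_zero_AE)
  have "{a<..b} \<in> null_sets \<mu>" using assms by auto
  then show "AE s in \<mu>. indicat_real {a<..b} s *\<^sub>R v s = 0"
    by (rule AE_I') (auto simp: indicator_def)
qed

end

text \<open>
  The rate of the agent who stopped last, or of agent \<open>1\<close> as long as nobody has stopped. The
  telescoping form is linear in \<open>f\<close> and visibly measurable and, off finitely many dates, continuous in
  \<open>\<tau>\<close>; for ordered times \<open>marginal_wage_between\<close> gives back the description.
\<close>

definition marginal_wage ::
    "nat \<Rightarrow> (nat \<Rightarrow> real \<Rightarrow> 'a \<Rightarrow> real) \<Rightarrow> (nat \<Rightarrow> 'a \<Rightarrow> real) \<Rightarrow> real \<Rightarrow> 'a \<Rightarrow> real" where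
  "marginal_wage n f \<tau> s \<omega> = f 1 s \<omega> +
     (\<Sum>k\<in>{1..<n}. of_bool (\<tau> (Suc k) \<omega> < s) * (f (Suc k) s \<omega> - f k s \<omega>))"

text \<open>
  The principal's gain if agent \<open>i\<close> stops at \<open>\<tau> i\<close> and is paid, in expectation, no more than
  the agents' incentives require.
\<close>

definition chain_value ::
    "'a measure \<Rightarrow> real \<Rightarrow> nat \<Rightarrow> real measure \<Rightarrow> real measure \<Rightarrow> (nat \<Rightarrow> real \<Rightarrow> 'a \<Rightarrow> real) \<Rightarrow>
     (nat \<Rightarrow> real \<Rightarrow> 'a \<Rightarrow> real) \<Rightarrow> ('a \<Rightarrow> real) \<Rightarrow> (nat \<Rightarrow> 'a \<Rightarrow> real) \<Rightarrow> real" where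
  "chain_value M T n \<mu>A \<mu>P f g \<xi> \<tau> = (\<integral>\<omega>. (\<Sum>i=1..n. (LINT s:{0..\<tau> i \<omega>}|\<mu>P. g i s \<omega>)
     - (LINT s:{\<tau> i \<omega><..T}|\<mu>A. marginal_wage n f \<tau> s \<omega>) - \<xi> \<omega>) \<partial>M)"

locale principal_agent = filtered_prob_space M F T + A: clock M F T \<mu>A + P: clock M F T \<mu>P
  for M :: "'a measure" and F T \<mu>A \<mu>P +
  fixes D :: "real set" and n :: nat and f g :: "nat \<Rightarrow> real \<Rightarrow> 'a \<Rightarrow> real" and \<xi> :: "'a \<Rightarrow> real"
  assumes T_D: "T \<in> D" and n_pos: "1 \<le> n"
    and f_rate: "\<And>i. i \<in> {1..n} \<Longrightarrow> A.rate (f i)"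
    and g_rate: "\<And>i. i \<in> {1..n} \<Longrightarrow> P.rate (g i)"
    and f_less: "\<And>i j t \<omega>. 1 \<le> i \<Longrightarrow> i < j \<Longrightarrow> j \<le> n \<Longrightarrow> t \<in> {0..T} \<Longrightarrow> \<omega> \<in> space M \<Longrightarrow>
      f i t \<omega> < f j t \<omega>"
    and \<xi>_integrable: "integrable M \<xi>"
begin

lemma f_le: "1 \<le> i \<Longrightarrow> i \<le> j \<Longrightarrow> j \<le> n \<Longrightarrow> t \<in> {0..T} \<Longrightarrow> \<omega> \<in> space M \<Longrightarrow> f i t \<omega> \<le> f j t \<omega>"
  using f_less[of i j t \<omega>] by (cases "i = j") auto

lemma f_AE: "AE \<omega> in M. \<forall>i\<in>{1..n}. integrable \<mu>A (\<lambda>s. f i s \<omega>)"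
  using A.rate_AE[OF f_rate] by (intro AE_finite_allI) auto

lemma marginal_wage_rate:
  assumes \<tau>: "\<And>i. i \<in> {1..n} \<Longrightarrow> \<tau> i \<in> times D'"
  shows "A.rate (marginal_wage n f \<tau>)"
  unfolding marginal_wage_def
proof (intro A.rate_add A.rate_sum f_rate)
  fix k assume k: "k \<in> {1..<n}"
  show "A.rate (\<lambda>s \<omega>. of_bool (\<tau> (Suc k) \<omega> < s) * (f (Suc k) s \<omega> - f k s \<omega>))"
    using k by (intro A.rate_cut A.rate_diff f_rate timesD(2)[OF \<tau>]) auto
qed (use n_pos in auto)

lemma sum_increments:
  assumes "a \<le> b" "1 \<le> a"
  shows "(\<Sum>k\<in>{a..<b}. f (Suc k) s \<omega> - f k s \<omega>) = f b s \<omega> - f a s \<omega>"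
  using sum_Suc_diff'[OF assms(1), of "\<lambda>k. f k s \<omega>"] .

text \<open>
  Between the \<open>k\<close>-th and the next stopping time the sum has picked up exactly the increments from
  \<open>f 1\<close> to \<open>f k\<close>.
\<close>

lemma marginal_wage_between:
  assumes k: "k \<in> {1..n}" and \<tau>: "A.ordered n \<tau>" and \<omega>: "\<omega> \<in> space M"
    and s: "\<tau> k \<omega> < s" "k < n \<Longrightarrow> s \<le> \<tau> (Suc k) \<omega>"
  shows "marginal_wage n f \<tau> s \<omega> = f k s \<omega>"
proof -
  have "(\<Sum>l\<in>{1..<n}. of_bool (\<tau> (Suc l) \<omega> < s) * (f (Suc l) s \<omega> - f l s \<omega>))
    = (\<Sum>l\<in>{1..<k}. f (Suc l) s \<omega> - f l s \<omega>)"
  proof (rule sum.mono_neutral_cong_right)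
    show "\<forall>l\<in>{1..<n} - {1..<k}. of_bool (\<tau> (Suc l) \<omega> < s) * (f (Suc l) s \<omega> - f l s \<omega>) = 0"
    proof
      fix l assume "l \<in> {1..<n} - {1..<k}"
      then have l: "k \<le> l" "l < n" by auto
      then have "\<tau> (Suc k) \<omega> \<le> \<tau> (Suc l) \<omega>"
        using \<tau> \<omega> by (auto simp: A.ordered_def)
      then show "of_bool (\<tau> (Suc l) \<omega> < s) * (f (Suc l) s \<omega> - f l s \<omega>) = 0"
        using s l by auto
    qed
    fix l assume "l \<in> {1..<k}"
    then have "\<tau> (Suc l) \<omega> \<le> \<tau> k \<omega>"
      using \<tau> \<omega> k by (auto simp: A.ordered_def)
    then show "of_bool (\<tau> (Suc l) \<omega> < s) * (f (Suc l) s \<omega> - f l s \<omega>) = f (Suc l) s \<omega> - f l s \<omega>"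
      using s by auto
  qed (use k in auto)
  then show ?thesis
    unfolding marginal_wage_def using sum_increments[of 1 k s \<omega>] k by auto
qed

abbreviation W :: "(nat \<Rightarrow> 'a \<Rightarrow> real) \<Rightarrow> real" where
  "W \<equiv> chain_value M T n \<mu>A \<mu>P f g \<xi>"

lemma agent_payoff_split:
  assumes i: "i \<in> {1..n}" and \<sigma>: "\<sigma> \<in> times D" and Y: "integrable M (\<lambda>\<omega>. Y (\<sigma> \<omega>) \<omega>)"
  shows "agent_payoff M \<mu>A (f i) Y \<sigma>
    = (\<integral>\<omega>. (LINT s:{0..\<sigma> \<omega>}|\<mu>A. f i s \<omega>) \<partial>M) + (\<integral>\<omega>. Y (\<sigma> \<omega>) \<omega> \<partial>M)"
  unfolding agent_payoff_def
  by (rule Bochner_Integration.integral_add[OF A.upto_integrable[OF f_rate[OF i] \<sigma>] Y])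

lemma agent_payoff_cong:
  assumes i: "i \<in> {1..n}" and \<sigma>: "\<sigma> \<in> times D" and \<tau>: "\<tau> \<in> times D"
    and Y: "integrable M (\<lambda>\<omega>. Y (\<sigma> \<omega>) \<omega>)" "integrable M (\<lambda>\<omega>. Y (\<tau> \<omega>) \<omega>)"
    and eq: "AE \<omega> in M. \<sigma> \<omega> = \<tau> \<omega>"
  shows "agent_payoff M \<mu>A (f i) Y \<sigma> = agent_payoff M \<mu>A (f i) Y \<tau>"
  unfolding agent_payoff_def
proof (rule integral_cong_AE)
  show "(\<lambda>\<omega>. (LINT t:{0..\<sigma> \<omega>}|\<mu>A. f i t \<omega>) + Y (\<sigma> \<omega>) \<omega>) \<in> borel_measurable M"
    "(\<lambda>\<omega>. (LINT t:{0..\<tau> \<omega>}|\<mu>A. f i t \<omega>) + Y (\<tau> \<omega>) \<omega>) \<in> borel_measurable M"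
    using A.upto_integrable[OF f_rate[OF i] \<sigma>] A.upto_integrable[OF f_rate[OF i] \<tau>] Y by auto
qed (use eq in auto)

text \<open>
  An agent who values working more stops later. Stopping at the maximum and the minimum of two
  times redistributes the two rewards, while the working gains of the two agents together can
  only increase, so the minimum is optimal for the agent with the smaller rate.
\<close>

lemma smallest_optimal_mono:
  assumes Y: "\<And>\<sigma>. \<sigma> \<in> times D \<Longrightarrow> integrable M (\<lambda>\<omega>. Y (\<sigma> \<omega>) \<omega>)"
    and ij: "i \<in> {1..n}" "j \<in> {1..n}" "i \<le> j"
    and \<sigma>: "smallest_optimal M (times D) (agent_payoff M \<mu>A (f i) Y) \<sigma>"
    and \<tau>: "smallest_optimal M (times D) (agent_payoff M \<mu>A (f j) Y) \<tau>"
  shows "AE \<omega> in M. \<sigma> \<omega> \<le> \<tau> \<omega>"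
proof -
  let ?a = "\<lambda>\<omega>. min (\<sigma> \<omega>) (\<tau> \<omega>)" and ?b = "\<lambda>\<omega>. max (\<sigma> \<omega>) (\<tau> \<omega>)"
  let ?U = "\<lambda>i \<sigma> \<omega>. LINT s:{0..\<sigma> \<omega>}|\<mu>A. f i s \<omega>"
  have S: "\<sigma> \<in> times D" "\<tau> \<in> times D"
    using \<sigma> \<tau> by (auto simp: smallest_optimal_def optimal_in_def)
  have ab: "?a \<in> times D" "?b \<in> times D" using times_min times_max S by auto
  note int = A.upto_integrable[OF f_rate[OF ij(1)]] A.upto_integrable[OF f_rate[OF ij(2)]]
  have "(\<integral>\<omega>. ?U i \<sigma> \<omega> + ?U j \<tau> \<omega> \<partial>M) \<le> (\<integral>\<omega>. ?U i ?a \<omega> + ?U j ?b \<omega> \<partial>M)"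
  proof (rule integral_mono_AE)
    show "AE \<omega> in M. ?U i \<sigma> \<omega> + ?U j \<tau> \<omega> \<le> ?U i ?a \<omega> + ?U j ?b \<omega>"
      using f_AE AE_space
    proof eventually_elim
      case (elim \<omega>)
      then have fi: "integrable \<mu>A (\<lambda>s. f i s \<omega>)" and fj: "integrable \<mu>A (\<lambda>s. f j s \<omega>)"
        using ij by auto
      show ?case
      proof (cases "\<sigma> \<omega> \<le> \<tau> \<omega>")
        case False
        then have le: "\<tau> \<omega> \<le> \<sigma> \<omega>" and ab: "?a \<omega> = \<tau> \<omega>" "?b \<omega> = \<sigma> \<omega>" by auto
        have bnd: "0 \<le> \<tau> \<omega>" "\<sigma> \<omega> \<le> T" using timesD(3,4)[OF S(1)] timesD(3,4)[OF S(2)] elim by auto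
        have "(LINT r:{\<tau> \<omega><..\<sigma> \<omega>}|\<mu>A. f i r \<omega>) \<le> (LINT r:{\<tau> \<omega><..\<sigma> \<omega>}|\<mu>A. f j r \<omega>)"
          using bnd f_le ij elim
          by (intro set_integral_mono A.set_integrable_interval fi fj) auto
        then show ?thesis
          using A.set_integral_split(1)[OF fi bnd(1) le bnd(2)]
            A.set_integral_split(1)[OF fj bnd(1) le bnd(2)]
          unfolding ab by simp
      qed (simp add: min_def max_def)
    qed
  qed (use int S ab in auto)
  then have 1: "(\<integral>\<omega>. ?U i \<sigma> \<omega> \<partial>M) + (\<integral>\<omega>. ?U j \<tau> \<omega> \<partial>M)
      \<le> (\<integral>\<omega>. ?U i ?a \<omega> \<partial>M) + (\<integral>\<omega>. ?U j ?b \<omega> \<partial>M)"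
    using int S ab by simp
  have "(\<integral>\<omega>. Y (?a \<omega>) \<omega> + Y (?b \<omega>) \<omega> \<partial>M) = (\<integral>\<omega>. Y (\<sigma> \<omega>) \<omega> + Y (\<tau> \<omega>) \<omega> \<partial>M)"
    by (rule Bochner_Integration.integral_cong) (auto simp: min_def max_def)
  then have 2: "(\<integral>\<omega>. Y (?a \<omega>) \<omega> \<partial>M) + (\<integral>\<omega>. Y (?b \<omega>) \<omega> \<partial>M)
      = (\<integral>\<omega>. Y (\<sigma> \<omega>) \<omega> \<partial>M) + (\<integral>\<omega>. Y (\<tau> \<omega>) \<omega> \<partial>M)"
    using Y S ab by simp
  have opt: "agent_payoff M \<mu>A (f j) Y ?b \<le> agent_payoff M \<mu>A (f j) Y \<tau>"
    using \<tau> ab by (auto simp: smallest_optimal_def optimal_in_def)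
  have "agent_payoff M \<mu>A (f i) Y \<sigma> \<le> agent_payoff M \<mu>A (f i) Y ?a"
    using 1 2 opt agent_payoff_split[where Y=Y, OF ij(1) S(1) Y[OF S(1)]] agent_payoff_split[where Y=Y, OF ij(1) ab(1) Y[OF ab(1)]]
      agent_payoff_split[where Y=Y, OF ij(2) S(2) Y[OF S(2)]] agent_payoff_split[where Y=Y, OF ij(2) ab(2) Y[OF ab(2)]] by linarith
  then have "optimal_in (times D) (agent_payoff M \<mu>A (f i) Y) ?a"
    using \<sigma> ab unfolding smallest_optimal_def optimal_in_def by (meson order_trans)
  then have "AE \<omega> in M. \<sigma> \<omega> \<le> ?a \<omega>"
    using \<sigma> by (auto simp: smallest_optimal_def)
  then show ?thesis by eventually_elim auto
qed

lemma smallest_optimal_cong: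
  assumes Y: "\<And>\<sigma>. \<sigma> \<in> times D \<Longrightarrow> integrable M (\<lambda>\<omega>. Y (\<sigma> \<omega>) \<omega>)"
    and i: "i \<in> {1..n}" and \<sigma>: "smallest_optimal M (times D) (agent_payoff M \<mu>A (f i) Y) \<sigma>"
    and \<tau>: "\<tau> \<in> times D" and eq: "AE \<omega> in M. \<sigma> \<omega> = \<tau> \<omega>"
  shows "smallest_optimal M (times D) (agent_payoff M \<mu>A (f i) Y) \<tau>"
proof -
  have S: "\<sigma> \<in> times D" using \<sigma> by (auto simp: smallest_optimal_def optimal_in_def)
  have "agent_payoff M \<mu>A (f i) Y \<sigma> = agent_payoff M \<mu>A (f i) Y \<tau>"
    by (rule agent_payoff_cong[OF i S \<tau> Y[OF S] Y[OF \<tau>] eq])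
  moreover have "AE \<omega> in M. \<tau> \<omega> \<le> \<rho> \<omega>" if "AE \<omega> in M. \<sigma> \<omega> \<le> \<rho> \<omega>" for \<rho>
    using that eq by eventually_elim auto
  ultimately show ?thesis
    using \<sigma> \<tau> by (auto simp: smallest_optimal_def optimal_in_def)
qed

text \<open>
  Agents \<open>k\<close> and \<open>k + 1\<close> face the same problem on an event, known at \<open>\<tau>\<^sub>k\<close>, on which the agents'
  clock stands still between \<open>\<tau>\<^sub>k\<close> and \<open>\<tau>\<^bsub>k+1\<^esub>\<close>; hence agent \<open>k + 1\<close> could have stopped at \<open>\<tau>\<^sub>k\<close>.
\<close>

lemma smallest_optimal_separated:
  assumes Y: "\<And>\<sigma>. \<sigma> \<in> times D \<Longrightarrow> integrable M (\<lambda>\<omega>. Y (\<sigma> \<omega>) \<omega>)"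
    and \<tau>: "\<And>i. i \<in> {1..n} \<Longrightarrow> smallest_optimal M (times D) (agent_payoff M \<mu>A (f i) Y) (\<tau> i)"
    and ord: "A.ordered n \<tau>"
  shows "A.separated n \<tau>"
  unfolding A.separated_def
proof (intro ballI impI)
  fix k B assume k: "k \<in> {1..<n}" and B: "B \<in> sets (pre_sigma (\<tau> k))"
    and AEB: "AE \<omega> in M. \<omega> \<in> B \<longrightarrow>
      \<tau> k \<omega> < \<tau> (Suc k) \<omega> \<and> emeasure \<mu>A {\<tau> k \<omega><..\<tau> (Suc k) \<omega>} = 0"
  have k': "k \<in> {1..n}" "Suc k \<in> {1..n}" using k by auto
  have S: "\<tau> k \<in> times D" "\<tau> (Suc k) \<in> times D"
    using \<tau>[OF k'(1)] \<tau>[OF k'(2)] by (auto simp: smallest_optimal_def optimal_in_def)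
  have le: "\<tau> k \<omega> \<le> \<tau> (Suc k) \<omega>" if "\<omega> \<in> space M" for \<omega>
    using ord k that by (auto simp: A.ordered_def)
  \<comment> \<open>Agent \<open>k + 1\<close> stops early on \<open>B\<close> and agent \<open>k\<close> stops late; together they collect the same payments.\<close>
  let ?early = "\<lambda>\<omega>. if \<omega> \<in> B then \<tau> k \<omega> else \<tau> (Suc k) \<omega>"
  let ?late = "\<lambda>\<omega>. if \<omega> \<in> B then \<tau> (Suc k) \<omega> else \<tau> k \<omega>"
  have S': "?early \<in> times D" "?late \<in> times D"
    using switch_times[OF S le B] switch_times'[OF S le B] by auto
  let ?U = "\<lambda>i \<sigma> \<omega>. LINT s:{0..\<sigma> \<omega>}|\<mu>A. f i s \<omega>"
  have frozen: "AE \<omega> in M. \<omega> \<in> B \<longrightarrow> (\<forall>i\<in>{1..n}. ?U i (\<tau> k) \<omega> = ?U i (\<tau> (Suc k)) \<omega>)"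
    using f_AE AEB AE_space
  proof eventually_elim
    case (elim \<omega>)
    show ?case
    proof (intro impI ballI)
      fix i assume "\<omega> \<in> B" "i \<in> {1..n}"
      have bnd: "0 \<le> \<tau> k \<omega>" "\<tau> (Suc k) \<omega> \<le> T"
        using timesD(3)[OF S(1)] timesD(4)[OF S(2)] elim by auto
      have "(LINT s:{\<tau> k \<omega><..\<tau> (Suc k) \<omega>}|\<mu>A. f i s \<omega>) = 0"
        using elim \<open>\<omega> \<in> B\<close> bnd by (intro A.set_integral_null) auto
      then show "?U i (\<tau> k) \<omega> = ?U i (\<tau> (Suc k)) \<omega>"
        using A.set_integral_split(1)[of "\<lambda>s. f i s \<omega>" "\<tau> k \<omega>" "\<tau> (Suc k) \<omega>"] elim le bnd \<open>i \<in> {1..n}\<close>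
        by simp
    qed
  qed
  have 1: "(\<integral>\<omega>. ?U (Suc k) ?early \<omega> \<partial>M) = (\<integral>\<omega>. ?U (Suc k) (\<tau> (Suc k)) \<omega> \<partial>M)"
    "(\<integral>\<omega>. ?U k ?late \<omega> \<partial>M) = (\<integral>\<omega>. ?U k (\<tau> k) \<omega> \<partial>M)"
    using frozen k' A.upto_integrable[OF f_rate[OF k'(2)] S'(1)]
      A.upto_integrable[OF f_rate[OF k'(2)] S(2)] A.upto_integrable[OF f_rate[OF k'(1)] S'(2)]
      A.upto_integrable[OF f_rate[OF k'(1)] S(1)]
    by (auto intro!: integral_cong_AE borel_measurable_integrable elim!: eventually_mono)
  have "(\<integral>\<omega>. Y (?early \<omega>) \<omega> + Y (?late \<omega>) \<omega> \<partial>M) = (\<integral>\<omega>. Y (\<tau> k \<omega>) \<omega> + Y (\<tau> (Suc k) \<omega>) \<omega> \<partial>M)"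
    by (rule Bochner_Integration.integral_cong) auto
  then have 2: "(\<integral>\<omega>. Y (?early \<omega>) \<omega> \<partial>M) + (\<integral>\<omega>. Y (?late \<omega>) \<omega> \<partial>M)
      = (\<integral>\<omega>. Y (\<tau> k \<omega>) \<omega> \<partial>M) + (\<integral>\<omega>. Y (\<tau> (Suc k) \<omega>) \<omega> \<partial>M)"
    using Y S S' by simp
  have opt: "agent_payoff M \<mu>A (f k) Y ?late \<le> agent_payoff M \<mu>A (f k) Y (\<tau> k)"
    using \<tau>[OF k'(1)] S' by (auto simp: smallest_optimal_def optimal_in_def)
  have "agent_payoff M \<mu>A (f (Suc k)) Y (\<tau> (Suc k)) \<le> agent_payoff M \<mu>A (f (Suc k)) Y ?early"
    using 1 2 opt agent_payoff_split[where Y=Y, OF k'(1) S(1) Y[OF S(1)]]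
      agent_payoff_split[where Y=Y, OF k'(1) S'(2) Y[OF S'(2)]]
      agent_payoff_split[where Y=Y, OF k'(2) S(2) Y[OF S(2)]]
      agent_payoff_split[where Y=Y, OF k'(2) S'(1) Y[OF S'(1)]] by linarith
  then have "optimal_in (times D) (agent_payoff M \<mu>A (f (Suc k)) Y) ?early"
    using \<tau>[OF k'(2)] S' unfolding smallest_optimal_def optimal_in_def by (meson order_trans)
  then have "AE \<omega> in M. \<tau> (Suc k) \<omega> \<le> ?early \<omega>"
    using \<tau>[OF k'(2)] by (auto simp: smallest_optimal_def)
  with AEB have "AE \<omega> in M. \<omega> \<notin> B"
    by eventually_elim (auto split: if_splits)
  then show "emeasure M B = 0"
    using pre_sigma_into_M[OF S(1) B] by (subst (asm) AE_iff_measurable[of B]) (auto dest: sets.sets_into_space)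
qed

text \<open>
  Agent \<open>k\<close> prefers \<open>\<tau>\<^sub>k\<close> to \<open>\<tau>\<^bsub>k+1\<^esub>\<close>. Adding up these inequalities down from the terminal payment
  \<open>Y\<^sub>T \<ge> \<xi>\<close> bounds the payment at \<open>\<tau>\<^sub>k\<close> from below by \<open>\<xi>\<close> and the marginal wage after \<open>\<tau>\<^sub>k\<close>.
\<close>

lemma payment_lower_bound:
  assumes Y: "\<And>\<sigma>. \<sigma> \<in> times D \<Longrightarrow> integrable M (\<lambda>\<omega>. Y (\<sigma> \<omega>) \<omega>)"
    and YT: "AE \<omega> in M. \<xi> \<omega> \<le> Y T \<omega>"
    and \<tau>: "\<And>i. i \<in> {1..n} \<Longrightarrow> smallest_optimal M (times D) (agent_payoff M \<mu>A (f i) Y) (\<tau> i)"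
    and ord: "A.ordered n \<tau>" and k: "k \<in> {1..n}"
  shows "(\<integral>\<omega>. (LINT s:{\<tau> k \<omega><..T}|\<mu>A. marginal_wage n f \<tau> s \<omega>) + \<xi> \<omega> \<partial>M) \<le> (\<integral>\<omega>. Y (\<tau> k \<omega>) \<omega> \<partial>M)"
proof -
  have S: "\<tau> i \<in> times D" if "i \<in> {1..n}" for i
    using \<tau>[OF that] by (auto simp: smallest_optimal_def optimal_in_def)
  let ?w = "marginal_wage n f \<tau>"
  let ?R = "\<lambda>i. \<integral>\<omega>. (LINT s:{\<tau> i \<omega><..T}|\<mu>A. ?w s \<omega>) \<partial>M"
  have rate: "A.rate ?w" by (rule marginal_wage_rate[OF S])
  have gain: "(\<integral>\<omega>. (LINT s:{0..\<sigma> \<omega>}|\<mu>A. f i s \<omega>) \<partial>M) - (\<integral>\<omega>. (LINT s:{0..\<tau> i \<omega>}|\<mu>A. f i s \<omega>) \<partial>M)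
      = (\<integral>\<omega>. (LINT s:{\<tau> i \<omega><..T}|\<mu>A. ?w s \<omega>) \<partial>M) - (\<integral>\<omega>. (LINT s:{\<sigma> \<omega><..T}|\<mu>A. ?w s \<omega>) \<partial>M)"
    if i: "i \<in> {1..n}" and \<sigma>: "\<sigma> \<in> times D"
      and le: "\<And>\<omega>. \<omega> \<in> space M \<Longrightarrow> \<tau> i \<omega> \<le> \<sigma> \<omega>"
      and next': "\<And>\<omega>. \<omega> \<in> space M \<Longrightarrow> i < n \<Longrightarrow> \<sigma> \<omega> \<le> \<tau> (Suc i) \<omega>" for i \<sigma>
  proof -
    have "AE \<omega> in M. (LINT s:{0..\<sigma> \<omega>}|\<mu>A. f i s \<omega>) - (LINT s:{0..\<tau> i \<omega>}|\<mu>A. f i s \<omega>)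
      = (LINT s:{\<tau> i \<omega><..T}|\<mu>A. ?w s \<omega>) - (LINT s:{\<sigma> \<omega><..T}|\<mu>A. ?w s \<omega>)"
      using f_AE A.rate_AE[OF rate] AE_space
    proof eventually_elim
      case (elim \<omega>)
      have bnd: "0 \<le> \<tau> i \<omega>" "\<tau> i \<omega> \<le> \<sigma> \<omega>" "\<sigma> \<omega> \<le> T"
        using timesD(3)[OF S[OF i]] timesD(4)[OF \<sigma>] le elim by auto
      have "(LINT s:{\<tau> i \<omega><..\<sigma> \<omega>}|\<mu>A. f i s \<omega>) = (LINT s:{\<tau> i \<omega><..\<sigma> \<omega>}|\<mu>A. ?w s \<omega>)"
        unfolding set_lebesgue_integral_def
      proof (rule Bochner_Integration.integral_cong[OF refl])
        fix s
        show "indicator {\<tau> i \<omega><..\<sigma> \<omega>} s *\<^sub>R f i s \<omega> = indicator {\<tau> i \<omega><..\<sigma> \<omega>} s *\<^sub>R ?w s \<omega>"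
          using marginal_wage_between[OF i ord, of \<omega> s] elim next'[of \<omega>]
          by (cases "s \<in> {\<tau> i \<omega><..\<sigma> \<omega>}") force+
      qed
      then show ?case
        using A.set_integral_split(1)[of "\<lambda>s. f i s \<omega>", OF _ bnd]
          A.set_integral_split(2)[of "\<lambda>s. ?w s \<omega>", OF _ bnd] elim i by simp
    qed
    then have "(\<integral>\<omega>. (LINT s:{0..\<sigma> \<omega>}|\<mu>A. f i s \<omega>) - (LINT s:{0..\<tau> i \<omega>}|\<mu>A. f i s \<omega>) \<partial>M)
      = (\<integral>\<omega>. (LINT s:{\<tau> i \<omega><..T}|\<mu>A. ?w s \<omega>) - (LINT s:{\<sigma> \<omega><..T}|\<mu>A. ?w s \<omega>) \<partial>M)"
      using A.upto_integrable[OF f_rate[OF i] S[OF i]] A.upto_integrable[OF f_rate[OF i] \<sigma>]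
        A.after_integrable[OF rate S[OF i]] A.after_integrable[OF rate \<sigma>]
      by (intro integral_cong_AE) auto
    then show ?thesis
      using A.upto_integrable[OF f_rate[OF i] S[OF i]] A.upto_integrable[OF f_rate[OF i] \<sigma>]
        A.after_integrable[OF rate S[OF i]] A.after_integrable[OF rate \<sigma>] by simp
  qed
  have revealed: "(\<integral>\<omega>. Y (\<sigma> \<omega>) \<omega> \<partial>M) + ?R i - (\<integral>\<omega>. (LINT s:{\<sigma> \<omega><..T}|\<mu>A. ?w s \<omega>) \<partial>M)
      \<le> (\<integral>\<omega>. Y (\<tau> i \<omega>) \<omega> \<partial>M)"
    if i: "i \<in> {1..n}" and \<sigma>: "\<sigma> \<in> times D"
      and le: "\<And>\<omega>. \<omega> \<in> space M \<Longrightarrow> \<tau> i \<omega> \<le> \<sigma> \<omega>"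
      and next': "\<And>\<omega>. \<omega> \<in> space M \<Longrightarrow> i < n \<Longrightarrow> \<sigma> \<omega> \<le> \<tau> (Suc i) \<omega>" for i \<sigma>
  proof -
    have "agent_payoff M \<mu>A (f i) Y \<sigma> \<le> agent_payoff M \<mu>A (f i) Y (\<tau> i)"
      using \<tau>[OF i] \<sigma> by (auto simp: smallest_optimal_def optimal_in_def)
    then show ?thesis
      using gain[OF that] agent_payoff_split[where Y=Y, OF i \<sigma> Y[OF \<sigma>]]
        agent_payoff_split[where Y=Y, OF i S[OF i] Y[OF S[OF i]]] by linarith
  qed
  have "?R k + (\<integral>\<omega>. \<xi> \<omega> \<partial>M) \<le> (\<integral>\<omega>. Y (\<tau> k \<omega>) \<omega> \<partial>M)"
    using k
  proof (induction "n - k" arbitrary: k)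
    case 0
    then have k: "k = n" "n \<in> {1..n}" using n_pos by auto
    have "(\<integral>\<omega>. \<xi> \<omega> \<partial>M) \<le> (\<integral>\<omega>. Y T \<omega> \<partial>M)"
      using Y[OF times_T[OF T_D]] YT \<xi>_integrable by (intro integral_mono_AE) auto
    moreover have "(\<integral>\<omega>. Y T \<omega> \<partial>M) + ?R n \<le> (\<integral>\<omega>. Y (\<tau> n \<omega>) \<omega> \<partial>M)"
      using revealed[OF k(2) times_T[OF T_D]] timesD(4)[OF S[OF k(2)]]
      by (simp add: set_lebesgue_integral_def)
    ultimately show ?case using k by simp
  next
    case (Suc m)
    then have k: "Suc k \<in> {1..n}" "m = n - Suc k" by auto
    have "?R (Suc k) + (\<integral>\<omega>. \<xi> \<omega> \<partial>M) \<le> (\<integral>\<omega>. Y (\<tau> (Suc k) \<omega>) \<omega> \<partial>M)"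
      by (rule Suc.hyps(1)[OF k(2,1)])
    moreover have "(\<integral>\<omega>. Y (\<tau> (Suc k) \<omega>) \<omega> \<partial>M) + ?R k - ?R (Suc k) \<le> (\<integral>\<omega>. Y (\<tau> k \<omega>) \<omega> \<partial>M)"
      using Suc.prems k ord by (intro revealed S) (auto simp: A.ordered_def)
    ultimately show ?case by linarith
  qed
  then show ?thesis
    using A.after_integrable[OF rate S[OF k]] \<xi>_integrable by simp
qed

lemma principal_payoff_split:
  assumes \<tau>: "\<And>i. i \<in> {1..n} \<Longrightarrow> \<tau> i \<in> times D" and Y: "\<And>i. i \<in> {1..n} \<Longrightarrow> integrable M (\<lambda>\<omega>. Y (\<tau> i \<omega>) \<omega>)"
  shows "principal_payoff M n \<mu>P g Y \<tau>
    = (\<Sum>i=1..n. (\<integral>\<omega>. (LINT s:{0..\<tau> i \<omega>}|\<mu>P. g i s \<omega>) \<partial>M) - (\<integral>\<omega>. Y (\<tau> i \<omega>) \<omega> \<partial>M))"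
proof -
  have "principal_payoff M n \<mu>P g Y \<tau>
    = (\<Sum>i=1..n. \<integral>\<omega>. (LINT s:{0..\<tau> i \<omega>}|\<mu>P. g i s \<omega>) - Y (\<tau> i \<omega>) \<omega> \<partial>M)"
    unfolding principal_payoff_def using \<tau> Y
    by (intro Bochner_Integration.integral_sum Bochner_Integration.integrable_diff
        P.upto_integrable[OF g_rate]) auto
  also have "\<dots> = (\<Sum>i=1..n. (\<integral>\<omega>. (LINT s:{0..\<tau> i \<omega>}|\<mu>P. g i s \<omega>) \<partial>M) - (\<integral>\<omega>. Y (\<tau> i \<omega>) \<omega> \<partial>M))"
    using \<tau> Y by (intro sum.cong refl Bochner_Integration.integral_diff P.upto_integrable[OF g_rate]) auto
  finally show ?thesis .
qed

lemma chain_value_split: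
  assumes \<tau>: "\<And>i. i \<in> {1..n} \<Longrightarrow> \<tau> i \<in> times D"
  shows "W \<tau> = (\<Sum>i=1..n. (\<integral>\<omega>. (LINT s:{0..\<tau> i \<omega>}|\<mu>P. g i s \<omega>) \<partial>M)
    - (\<integral>\<omega>. (LINT s:{\<tau> i \<omega><..T}|\<mu>A. marginal_wage n f \<tau> s \<omega>) + \<xi> \<omega> \<partial>M))"
proof -
  note int = P.upto_integrable[OF g_rate \<tau>] A.after_integrable[OF marginal_wage_rate[OF \<tau>] \<tau>] \<xi>_integrable
  have "W \<tau> = (\<Sum>i=1..n. \<integral>\<omega>. (LINT s:{0..\<tau> i \<omega>}|\<mu>P. g i s \<omega>)
      - (LINT s:{\<tau> i \<omega><..T}|\<mu>A. marginal_wage n f \<tau> s \<omega>) - \<xi> \<omega> \<partial>M)"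
    unfolding chain_value_def using int
    by (intro Bochner_Integration.integral_sum Bochner_Integration.integrable_diff) auto
  also have "\<dots> = (\<Sum>i=1..n. (\<integral>\<omega>. (LINT s:{0..\<tau> i \<omega>}|\<mu>P. g i s \<omega>) \<partial>M)
    - (\<integral>\<omega>. (LINT s:{\<tau> i \<omega><..T}|\<mu>A. marginal_wage n f \<tau> s \<omega>) + \<xi> \<omega> \<partial>M))"
    using int by (intro sum.cong refl) simp
  finally show ?thesis .
qed

lemma principal_payoff_le_chain_value:
  assumes Y: "\<And>\<sigma>. \<sigma> \<in> times D \<Longrightarrow> integrable M (\<lambda>\<omega>. Y (\<sigma> \<omega>) \<omega>)"
    and YT: "AE \<omega> in M. \<xi> \<omega> \<le> Y T \<omega>"
    and opt: "\<And>i. i \<in> {1..n} \<Longrightarrow> smallest_optimal M (times D) (agent_payoff M \<mu>A (f i) Y) (\<tau> i)"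
  shows "\<exists>\<tau>'\<in>A.chains D n. principal_payoff M n \<mu>P g Y \<tau> \<le> W \<tau>'"
proof -
  have S: "\<tau> i \<in> times D" if "i \<in> {1..n}" for i
    using opt[OF that] by (auto simp: smallest_optimal_def optimal_in_def)
  have almost: "AE \<omega> in M. \<forall>i\<in>{1..n}. \<forall>j\<in>{1..n}. i \<le> j \<longrightarrow> \<tau> i \<omega> \<le> \<tau> j \<omega>"
  proof (intro AE_finite_allI finite_atLeastAtMost)
    fix i j assume "i \<in> {1..n}" "j \<in> {1..n}"
    then show "AE \<omega> in M. i \<le> j \<longrightarrow> \<tau> i \<omega> \<le> \<tau> j \<omega>"
      using smallest_optimal_mono[OF Y _ _ _ opt opt] by (cases "i \<le> j") auto
  qed
  obtain \<tau>' where S': "\<And>i. i \<in> {1..n} \<Longrightarrow> \<tau>' i \<in> times D"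
    and ord: "A.ordered n \<tau>'" and eq: "AE \<omega> in M. \<forall>i\<in>{1..n}. \<tau> i \<omega> = \<tau>' i \<omega>"
  proof (rule A.ordered_version[OF _ almost])
    show "\<tau> i \<in> times D" if "i \<in> {1..n}" for i by (rule S[OF that])
  qed (rule that)
  have opt': "smallest_optimal M (times D) (agent_payoff M \<mu>A (f i) Y) (\<tau>' i)" if "i \<in> {1..n}" for i
  proof (rule smallest_optimal_cong[OF Y that opt[OF that] S'[OF that]])
    show "AE \<omega> in M. \<tau> i \<omega> = \<tau>' i \<omega>" using eq that by (auto elim!: eventually_mono)
  qed
  have chain: "\<tau>' \<in> A.chains D n"
    using S' ord smallest_optimal_separated[OF Y opt' ord] by (auto simp: A.chains_def)
  have pay: "principal_payoff M n \<mu>P g Y \<tau> = principal_payoff M n \<mu>P g Y \<tau>'"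
    unfolding principal_payoff_def
  proof (rule integral_cong_AE)
    show "AE \<omega> in M. (\<Sum>i = 1..n. (LINT t:{0..\<tau> i \<omega>}|\<mu>P. g i t \<omega>) - Y (\<tau> i \<omega>) \<omega>)
      = (\<Sum>i = 1..n. (LINT t:{0..\<tau>' i \<omega>}|\<mu>P. g i t \<omega>) - Y (\<tau>' i \<omega>) \<omega>)"
      using eq by eventually_elim (auto intro!: sum.cong)
  qed (use P.upto_integrable[OF g_rate] S S' Y in \<open>auto intro!: borel_measurable_sum borel_measurable_diff borel_measurable_integrable\<close>)
  have "principal_payoff M n \<mu>P g Y \<tau>' \<le> W \<tau>'"
    using S' Y payment_lower_bound[OF Y YT opt' ord]
    by (subst principal_payoff_split, simp, simp, subst chain_value_split, simp)
      (auto intro!: sum_mono diff_mono)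
  then show ?thesis using chain pay by auto
qed

end

section \<open>Contracts that implement a chain\<close>

context principal_agent begin

text \<open>
  The dates at which a contract implementing the chain pays something acceptable. The
  terminal date is one of them, for the payment there is at least \<open>\<xi>\<close>.
\<close>

definition stops :: "(nat \<Rightarrow> 'a \<Rightarrow> real) \<Rightarrow> 'a \<Rightarrow> real set" where
  "stops \<tau> \<omega> = insert T ((\<lambda>i. \<tau> i \<omega>) ` {1..n})"

lemma chainsD:
  assumes "\<tau> \<in> A.chains D n"
  shows "i \<in> {1..n} \<Longrightarrow> \<tau> i \<in> times D" "A.ordered n \<tau>" "A.separated n \<tau>"
    "1 \<le> i \<Longrightarrow> i \<le> j \<Longrightarrow> j \<le> n \<Longrightarrow> \<omega> \<in> space M \<Longrightarrow> \<tau> i \<omega> \<le> \<tau> j \<omega>"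
  using assms unfolding A.chains_def A.ordered_def by blast+

lemma stops_measurable:
  assumes \<tau>: "\<And>i. i \<in> {1..n} \<Longrightarrow> \<tau> i \<in> borel_measurable M" and \<sigma>: "\<sigma> \<in> borel_measurable M"
  shows "{\<omega>\<in>space M. \<sigma> \<omega> \<notin> stops \<tau> \<omega>} \<in> sets M"
proof -
  have "{\<omega>\<in>space M. \<sigma> \<omega> \<notin> stops \<tau> \<omega>}
      = {\<omega>\<in>space M. \<sigma> \<omega> \<noteq> T} - (\<Union>i\<in>{1..n}. {\<omega>\<in>space M. \<sigma> \<omega> = \<tau> i \<omega>})"
    by (auto simp: stops_def)
  also have "\<dots> \<in> sets M"
    using \<tau> \<sigma> by (intro sets.Diff sets.finite_UN) auto
  finally show ?thesis .
qed

text \<open>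
  Suppose that a contract is worth no more than the future wage \<open>\<psi>\<close> plus \<open>\<zeta>\<close>, less a penalty for
  stopping off the prescribed dates. Then agent \<open>i\<close> trades his rate against \<open>\<psi>\<close>: he gains by
  waiting as long as \<open>\<psi> \<le> f i\<close> and loses afterwards, so \<open>\<tau> i\<close> is optimal. Any other optimal time lies
  on the prescribed dates, and if it were \<open>\<tau> k < \<tau> i\<close> on some event, then the clock would
  stand still from \<open>\<tau> k\<close> to \<open>\<tau> (k + 1)\<close> there because \<open>\<psi> < f i\<close> in between. Separation excludes this.
\<close>

lemma chain_implemented:
  assumes \<tau>: "\<tau> \<in> A.chains D n"
    and Y: "\<And>\<sigma>. \<sigma> \<in> times D \<Longrightarrow> integrable M (\<lambda>\<omega>. Y (\<sigma> \<omega>) \<omega>)"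
    and \<psi>: "A.rate \<psi>" and \<zeta>: "integrable M \<zeta>"
    and low: "\<And>i s \<omega>. i \<in> {1..n} \<Longrightarrow> \<omega> \<in> space M \<Longrightarrow> s \<in> {0..T} \<Longrightarrow> s \<le> \<tau> i \<omega> \<Longrightarrow> \<psi> s \<omega> \<le> f i s \<omega>"
    and high: "\<And>i s \<omega>. i \<in> {1..n} \<Longrightarrow> \<omega> \<in> space M \<Longrightarrow> s \<in> {0..T} \<Longrightarrow> \<tau> i \<omega> < s \<Longrightarrow> f i s \<omega> \<le> \<psi> s \<omega>"
    and strict: "\<And>i k s \<omega>. k \<in> {1..<n} \<Longrightarrow> k < i \<Longrightarrow> i \<le> n \<Longrightarrow> \<omega> \<in> space M \<Longrightarrow> s \<in> {0..T} \<Longrightarrow>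
      \<tau> k \<omega> < s \<Longrightarrow> s \<le> \<tau> (Suc k) \<omega> \<Longrightarrow> \<psi> s \<omega> < f i s \<omega>"
    and le: "\<And>\<sigma>. \<sigma> \<in> times D \<Longrightarrow> (\<integral>\<omega>. Y (\<sigma> \<omega>) \<omega> \<partial>M)
      \<le> (\<integral>\<omega>. (LINT s:{\<sigma> \<omega><..T}|\<mu>A. \<psi> s \<omega>) + \<zeta> \<omega> \<partial>M) - prob {\<omega>\<in>space M. \<sigma> \<omega> \<notin> stops \<tau> \<omega>}"
    and eq: "\<And>i. i \<in> {1..n} \<Longrightarrow> (\<integral>\<omega>. Y (\<tau> i \<omega>) \<omega> \<partial>M)
      = (\<integral>\<omega>. (LINT s:{\<tau> i \<omega><..T}|\<mu>A. \<psi> s \<omega>) + \<zeta> \<omega> \<partial>M)"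
    and i: "i \<in> {1..n}"
  shows "smallest_optimal M (times D) (agent_payoff M \<mu>A (f i) Y) (\<tau> i)"
proof -
  note S = chainsD(1)[OF \<tau>]
  note ordD = chainsD(4)[OF \<tau>]
  let ?J = "agent_payoff M \<mu>A (f i) Y"
  let ?U = "\<lambda>\<sigma> \<omega>. (LINT s:{0..\<sigma> \<omega>}|\<mu>A. f i s \<omega>) + (LINT s:{\<sigma> \<omega><..T}|\<mu>A. \<psi> s \<omega>)"
  let ?off = "\<lambda>\<sigma>. {\<omega>\<in>space M. \<sigma> \<omega> \<notin> stops \<tau> \<omega>}"
  have U_int: "integrable M (?U \<sigma>)" if "\<sigma> \<in> times D" for \<sigma>
    using A.upto_integrable[OF f_rate[OF i] that] A.after_integrable[OF \<psi> that] by auto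
  have J_le: "?J \<sigma> \<le> (\<integral>\<omega>. ?U \<sigma> \<omega> \<partial>M) + (\<integral>\<omega>. \<zeta> \<omega> \<partial>M) - prob (?off \<sigma>)" if "\<sigma> \<in> times D" for \<sigma>
    using le[OF that] agent_payoff_split[where Y=Y, OF i that Y[OF that]] \<zeta>
      A.upto_integrable[OF f_rate[OF i] that] A.after_integrable[OF \<psi> that] by simp
  have J_eq: "?J (\<tau> i) = (\<integral>\<omega>. ?U (\<tau> i) \<omega> \<partial>M) + (\<integral>\<omega>. \<zeta> \<omega> \<partial>M)"
    using eq[OF i] agent_payoff_split[where Y=Y, OF i S[OF i] Y[OF S[OF i]]] \<zeta>
      A.upto_integrable[OF f_rate[OF i] S[OF i]] A.after_integrable[OF \<psi> S[OF i]] by simp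
  have good: "AE \<omega> in M. integrable \<mu>A (\<lambda>s. f i s \<omega>) \<and> integrable \<mu>A (\<lambda>s. \<psi> s \<omega>)"
    using A.rate_AE[OF f_rate[OF i]] A.rate_AE[OF \<psi>] by eventually_elim auto
  have early: "?U (\<tau> i) \<omega> - ?U \<sigma> \<omega> = (LINT s:{\<sigma> \<omega><..\<tau> i \<omega>}|\<mu>A. f i s \<omega> - \<psi> s \<omega>)"
    if "\<omega> \<in> space M" "\<sigma> \<in> times D" "\<sigma> \<omega> \<le> \<tau> i \<omega>"
      "integrable \<mu>A (\<lambda>s. f i s \<omega>)" "integrable \<mu>A (\<lambda>s. \<psi> s \<omega>)" for \<sigma> \<omega>
  proof -
    have bnd: "0 \<le> \<sigma> \<omega>" "\<tau> i \<omega> \<le> T" using that timesD(3) timesD(4)[OF S[OF i]] by auto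
    show ?thesis
      using A.set_integral_split[OF that(4) bnd(1) that(3) bnd(2)]
        A.set_integral_split[OF that(5) bnd(1) that(3) bnd(2)]
        A.set_integrable_interval[OF that(4) bnd] A.set_integrable_interval[OF that(5) bnd] by simp
  qed
  have gain: "AE \<omega> in M. 0 \<le> ?U (\<tau> i) \<omega> - ?U \<sigma> \<omega>" if \<sigma>: "\<sigma> \<in> times D" for \<sigma>
    using good AE_space
  proof eventually_elim
    case (elim \<omega>)
    then have v: "integrable \<mu>A (\<lambda>s. f i s \<omega>)" "integrable \<mu>A (\<lambda>s. \<psi> s \<omega>)" by auto
    have bnd: "0 \<le> \<sigma> \<omega>" "\<tau> i \<omega> \<le> T" "0 \<le> \<tau> i \<omega>" "\<sigma> \<omega> \<le> T"
      using elim timesD(3,4)[OF \<sigma>] timesD(3,4)[OF S[OF i]] by auto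
    show ?case
    proof (cases "\<sigma> \<omega> \<le> \<tau> i \<omega>")
      case True
      have "0 \<le> (LINT s:{\<sigma> \<omega><..\<tau> i \<omega>}|\<mu>A. f i s \<omega> - \<psi> s \<omega>)"
        unfolding set_lebesgue_integral_def
        using low[OF i elim(2)] bnd by (intro Bochner_Integration.integral_nonneg) (auto simp: indicator_def)
      then show ?thesis using early[OF _ \<sigma> True v] elim by simp
    next
      case False
      then have le': "\<tau> i \<omega> \<le> \<sigma> \<omega>" by simp
      have "(LINT s:{\<tau> i \<omega><..\<sigma> \<omega>}|\<mu>A. f i s \<omega>) \<le> (LINT s:{\<tau> i \<omega><..\<sigma> \<omega>}|\<mu>A. \<psi> s \<omega>)"
        using high[OF i elim(2)] bnd by (intro set_integral_mono A.set_integrable_interval v) auto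
      then show ?thesis
        using A.set_integral_split[OF v(1) bnd(3) le' bnd(4)]
          A.set_integral_split[OF v(2) bnd(3) le' bnd(4)] by simp
    qed
  qed
  have gain': "0 \<le> (\<integral>\<omega>. ?U (\<tau> i) \<omega> - ?U \<sigma> \<omega> \<partial>M)"
    "(\<integral>\<omega>. ?U (\<tau> i) \<omega> - ?U \<sigma> \<omega> \<partial>M) = (\<integral>\<omega>. ?U (\<tau> i) \<omega> \<partial>M) - (\<integral>\<omega>. ?U \<sigma> \<omega> \<partial>M)"
    if "\<sigma> \<in> times D" for \<sigma>
    using integral_nonneg_AE[OF gain[OF that]]
      Bochner_Integration.integral_diff[OF U_int[OF S[OF i]] U_int[OF that]] by auto
  have opt: "optimal_in (times D) ?J (\<tau> i)"
    unfolding optimal_in_def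
  proof (intro conjI ballI S i)
    fix \<sigma> assume "\<sigma> \<in> times D"
    then show "?J \<sigma> \<le> ?J (\<tau> i)"
      using J_le[of \<sigma>] J_eq gain'[of \<sigma>] measure_nonneg[of M "?off \<sigma>"] by linarith
  qed
  have "AE \<omega> in M. \<tau> i \<omega> \<le> \<sigma> \<omega>" if \<sigma>_opt: "optimal_in (times D) ?J \<sigma>" for \<sigma>
  proof -
    have \<sigma>: "\<sigma> \<in> times D" using \<sigma>_opt by (simp add: optimal_in_def)
    have "?J \<sigma> = ?J (\<tau> i)" using \<sigma>_opt opt \<sigma> S[OF i] by (auto simp: optimal_in_def intro!: antisym)
    then have 0: "prob (?off \<sigma>) = 0" "(\<integral>\<omega>. ?U (\<tau> i) \<omega> - ?U \<sigma> \<omega> \<partial>M) = 0"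
      using J_le[OF \<sigma>] J_eq gain'[OF \<sigma>] measure_nonneg[of M "?off \<sigma>"] by linarith+
    have "?off \<sigma> \<in> sets M" using timesD(2)[OF S] timesD(2)[OF \<sigma>] by (rule stops_measurable)
    then have on: "AE \<omega> in M. \<sigma> \<omega> \<in> stops \<tau> \<omega>"
      using 0(1) by (intro AE_I[of _ _ "?off \<sigma>"]) (auto simp: emeasure_eq_measure)
    have "AE \<omega> in M. ?U (\<tau> i) \<omega> - ?U \<sigma> \<omega> = 0"
      using integral_nonneg_eq_0_iff_AE[OF Bochner_Integration.integrable_diff[OF U_int[OF S[OF i]] U_int[OF \<sigma>]] gain[OF \<sigma>]] 0(2)
      by simp
    \<comment> \<open>Stopping strictly before \<open>\<tau>\<^sub>i\<close>, at \<open>\<tau>\<^sub>k\<close> for \<open>k < i\<close>, gives up a positive amount unless the clock stands still.\<close>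
    then have still: "AE \<omega> in M. \<forall>k\<in>{1..<i}. \<sigma> \<omega> = \<tau> k \<omega> \<longrightarrow> emeasure \<mu>A {\<tau> k \<omega><..\<tau> (Suc k) \<omega>} = 0"
      using good AE_space
    proof eventually_elim
      case (elim \<omega>)
      show ?case
      proof (intro ballI impI)
        fix k assume k: "k \<in> {1..<i}" and \<sigma>k: "\<sigma> \<omega> = \<tau> k \<omega>"
        have le1: "\<tau> k \<omega> \<le> \<tau> i \<omega>" "\<tau> (Suc k) \<omega> \<le> \<tau> i \<omega>" using ordD[of _ i \<omega>] k i elim(3) by auto
        have bnd: "0 \<le> \<tau> k \<omega>" "\<tau> i \<omega> \<le> T" "\<tau> (Suc k) \<omega> \<le> T"
          using timesD(3)[OF S[of k]] timesD(4)[OF S[of i]] timesD(4)[OF S[of "Suc k"]] k i elim(3) by auto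
        let ?h = "\<lambda>s. indicator {\<tau> k \<omega><..\<tau> i \<omega>} s *\<^sub>R (f i s \<omega> - \<psi> s \<omega>)"
        have "integrable \<mu>A ?h"
          using A.set_integrable_interval[of "\<lambda>s. f i s \<omega> - \<psi> s \<omega>", OF _ bnd(1,2)] elim
          by (simp add: set_integrable_def)
        moreover have "AE s in \<mu>A. 0 \<le> ?h s"
          using low[OF i elim(3)] bnd by (intro AE_I2) (auto simp: indicator_def)
        moreover have "(\<integral>s. ?h s \<partial>\<mu>A) = 0"
          using early[OF _ \<sigma>, of \<omega>] elim le1 \<sigma>k by (simp add: set_lebesgue_integral_def)
        ultimately have "AE s in \<mu>A. ?h s = 0"
          by (simp add: integral_nonneg_eq_0_iff_AE)
        then have "AE s in \<mu>A. s \<notin> {\<tau> k \<omega><..\<tau> (Suc k) \<omega>}"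
          using AE_space
        proof eventually_elim
          case (elim s)
          then show ?case
            using strict[of k i \<omega> s] k i \<open>\<omega> \<in> space M\<close> le1 by (auto simp: A.space_clock indicator_def)
        qed
        then show "emeasure \<mu>A {\<tau> k \<omega><..\<tau> (Suc k) \<omega>} = 0"
          using bnd by (subst (asm) AE_iff_measurable[of "{\<tau> k \<omega><..\<tau> (Suc k) \<omega>}"]) (auto simp: A.space_clock)
      qed
    qed
    have "AE \<omega> in M. \<forall>k\<in>{1..<i}. \<not> (\<sigma> \<omega> = \<tau> k \<omega> \<and> \<tau> k \<omega> < \<tau> (Suc k) \<omega>)"
    proof (intro AE_finite_allI finite_atLeastLessThan)
      fix k assume k: "k \<in> {1..<i}"
      then have Sk: "\<tau> k \<in> times D" "\<tau> (Suc k) \<in> times D" using S i by auto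
      let ?B = "{\<omega>\<in>space M. \<tau> k \<omega> = \<sigma> \<omega>} \<inter> {\<omega>\<in>space M. \<tau> k \<omega> < \<tau> (Suc k) \<omega>}"
      have B: "?B \<in> sets (pre_sigma (\<tau> k))"
        by (intro sets.Int coincidence_pre_sigma[OF Sk(1) \<sigma>] less_pre_sigma[OF Sk])
      have "AE \<omega> in M. \<omega> \<in> ?B \<longrightarrow> \<tau> k \<omega> < \<tau> (Suc k) \<omega> \<and> emeasure \<mu>A {\<tau> k \<omega><..\<tau> (Suc k) \<omega>} = 0"
        using still by eventually_elim (use k in \<open>auto dest!: bspec[of _ _ k]\<close>)
      moreover have "k \<in> {1..<n}" using k i by auto
      ultimately have "emeasure M ?B = 0"
        using chainsD(3)[OF \<tau>] B unfolding A.separated_def by blast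
      then show "AE \<omega> in M. \<not> (\<sigma> \<omega> = \<tau> k \<omega> \<and> \<tau> k \<omega> < \<tau> (Suc k) \<omega>)"
        using pre_sigma_into_M[OF Sk(1) B] by (intro AE_I[of _ _ ?B]) auto
    qed
    with on show ?thesis
      using AE_space
    proof eventually_elim
      case (elim \<omega>)
      show ?case
      proof (rule ccontr)
        assume "\<not> \<tau> i \<omega> \<le> \<sigma> \<omega>"
        then have lt: "\<sigma> \<omega> < \<tau> i \<omega>" by simp
        moreover have "\<tau> i \<omega> \<le> T" by (rule timesD(4)[OF S[OF i]]) (rule elim)
        ultimately obtain l where l: "l \<in> {1..n}" "\<sigma> \<omega> = \<tau> l \<omega>" using elim(1) by (auto simp: stops_def)
        have "l \<le> i"
        proof (rule ccontr)
          assume "\<not> l \<le> i"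
          then have "\<tau> i \<omega> \<le> \<tau> l \<omega>" using ordD[of i l \<omega>] l(1) i elim(3) by auto
          with lt l show False by simp
        qed
        then have "\<tau> i \<omega> = \<sigma> \<omega>"
        proof (induction i rule: dec_induct)
          case (step j)
          have "\<tau> j \<omega> \<le> \<tau> (Suc j) \<omega>" using ordD[of j "Suc j" \<omega>] step.hyps l(1) i elim(3) by auto
          moreover have "\<not> (\<sigma> \<omega> = \<tau> j \<omega> \<and> \<tau> j \<omega> < \<tau> (Suc j) \<omega>)" using elim(2) step.hyps l(1) by auto
          ultimately show ?case using step.IH by auto
        qed (use l in simp)
        with lt show False by simp
      qed
    qed
  qed
  with opt show ?thesis by (simp add: smallest_optimal_def)
qed

text \<open>
  The marginal wage crosses the rate of agent \<open>i\<close> from below at \<open>\<tau> i\<close>.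
\<close>

lemma marginal_wage_low:
  assumes \<tau>: "A.ordered n \<tau>" and i: "i \<in> {1..n}" and \<omega>: "\<omega> \<in> space M" "s \<in> {0..T}" and s: "s \<le> \<tau> i \<omega>"
  shows "marginal_wage n f \<tau> s \<omega> \<le> f i s \<omega>"
proof -
  have "(\<Sum>k\<in>{1..<n}. of_bool (\<tau> (Suc k) \<omega> < s) * (f (Suc k) s \<omega> - f k s \<omega>))
    \<le> (\<Sum>k\<in>{1..<n}. of_bool (k < i) * (f (Suc k) s \<omega> - f k s \<omega>))"
  proof (rule sum_mono)
    fix k assume k: "k \<in> {1..<n}"
    have "\<not> k < i \<Longrightarrow> \<not> \<tau> (Suc k) \<omega> < s"
      using A.orderedD[OF \<tau>, of i "Suc k" \<omega>] k i \<omega> s by auto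
    then show "of_bool (\<tau> (Suc k) \<omega> < s) * (f (Suc k) s \<omega> - f k s \<omega>)
      \<le> of_bool (k < i) * (f (Suc k) s \<omega> - f k s \<omega>)"
      using f_le[of k "Suc k" s \<omega>] k \<omega> by auto
  qed
  also have "\<dots> = (\<Sum>k\<in>{1..<i}. f (Suc k) s \<omega> - f k s \<omega>)"
    using i by (intro sum.mono_neutral_cong_right) auto
  also have "\<dots> = f i s \<omega> - f 1 s \<omega>" using i by (intro sum_increments) auto
  finally show ?thesis by (simp add: marginal_wage_def)
qed

lemma marginal_wage_high:
  assumes \<tau>: "A.ordered n \<tau>" and i: "i \<in> {1..n}" and \<omega>: "\<omega> \<in> space M" "s \<in> {0..T}" and s: "\<tau> i \<omega> < s"
  shows "f i s \<omega> \<le> marginal_wage n f \<tau> s \<omega>"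
proof -
  have "f i s \<omega> - f 1 s \<omega> = (\<Sum>k\<in>{1..<i}. f (Suc k) s \<omega> - f k s \<omega>)"
    using i by (intro sum_increments[symmetric]) auto
  also have "\<dots> = (\<Sum>k\<in>{1..<n}. of_bool (k < i) * (f (Suc k) s \<omega> - f k s \<omega>))"
    using i by (intro sum.mono_neutral_cong_left) auto
  also have "\<dots> \<le> (\<Sum>k\<in>{1..<n}. of_bool (\<tau> (Suc k) \<omega> < s) * (f (Suc k) s \<omega> - f k s \<omega>))"
  proof (rule sum_mono)
    fix k assume k: "k \<in> {1..<n}"
    have "k < i \<Longrightarrow> \<tau> (Suc k) \<omega> < s"
      using A.orderedD[OF \<tau>, of "Suc k" i \<omega>] k i \<omega> s by auto
    then show "of_bool (k < i) * (f (Suc k) s \<omega> - f k s \<omega>)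
      \<le> of_bool (\<tau> (Suc k) \<omega> < s) * (f (Suc k) s \<omega> - f k s \<omega>)"
      using f_le[of k "Suc k" s \<omega>] k \<omega> by auto
  qed
  finally show ?thesis by (simp add: marginal_wage_def)
qed

lemma marginal_wage_less:
  assumes \<tau>: "A.ordered n \<tau>" and k: "k \<in> {1..<n}" "k < i" "i \<le> n"
    and \<omega>: "\<omega> \<in> space M" "s \<in> {0..T}" and s: "\<tau> k \<omega> < s" "s \<le> \<tau> (Suc k) \<omega>"
  shows "marginal_wage n f \<tau> s \<omega> < f i s \<omega>"
  using marginal_wage_between[OF _ \<tau> \<omega>(1) s, of] f_less[of k i s \<omega>] k \<omega> by auto

end

section \<open>Implementation in discrete time\<close>

lemma grid_last:
  assumes p: "is_partition T m p" and t: "0 \<le> t"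
  defines "q \<equiv> Max (insert (p 0) {p j | j. j \<le> m \<and> p j \<le> t})"
  shows "q \<in> p ` {0..m}" "q \<le> t" "\<And>j. j \<le> m \<Longrightarrow> p j \<le> t \<Longrightarrow> p j \<le> q"
proof -
  have 0: "p 0 = 0" using p by (simp add: is_partition_def)
  have fin: "finite (insert (p 0) {p j | j. j \<le> m \<and> p j \<le> t})" by auto
  have "q \<in> insert (p 0) {p j | j. j \<le> m \<and> p j \<le> t}"
    unfolding q_def by (rule Max_in[OF fin]) simp
  then show "q \<in> p ` {0..m}" "q \<le> t" using 0 t by auto
  show "p j \<le> q" if "j \<le> m" "p j \<le> t" for j
    unfolding q_def using that by (intro Max_ge[OF fin]) auto
qed

context filtered_prob_space begin

text \<open>
  The information of the discretized filtration at \<open>t\<close> is that at the last partition point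
  \<open>q\<close> before \<open>t\<close>, and a time with values in the partition is at most \<open>t\<close> iff it is at most \<open>q\<close>.
\<close>

lemma stopping_time_grid_iff:
  assumes p: "is_partition T m p" and \<tau>: "\<And>\<omega>. \<omega> \<in> space M \<Longrightarrow> \<tau> \<omega> \<in> p ` {0..m}"
  shows "stopping_time (grid_filtration F m p) \<tau> \<longleftrightarrow> stopping_time F \<tau>"
proof -
  define q where "q t = Max (insert (p 0) {p j | j. j \<le> m \<and> p j \<le> t})" for t
  have G: "grid_filtration F m p t = F (q t)" for t by (simp add: grid_filtration_def q_def)
  have neg: "{\<omega> \<in> space M. \<tau> \<omega> \<le> t} = {}" if "t < 0" for t
  proof -
    have "t < \<tau> \<omega>" if \<omega>: "\<omega> \<in> space M" for \<omega>
    proof -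
      obtain j where "j \<le> m" "\<tau> \<omega> = p j" using \<tau>[OF \<omega>] by auto
      then show ?thesis using is_partition_range[OF p, of j] \<open>t < 0\<close> by simp
    qed
    then show ?thesis by (simp add: not_le)
  qed
  have pos: "{\<omega> \<in> space M. \<tau> \<omega> \<le> t} = {\<omega> \<in> space M. \<tau> \<omega> \<le> q t}" if t: "0 \<le> t" for t
  proof (intro Collect_cong conj_cong refl)
    fix \<omega> assume \<omega>: "\<omega> \<in> space M"
    obtain j where j: "j \<le> m" "\<tau> \<omega> = p j" using \<tau>[OF \<omega>] by auto
    show "\<tau> \<omega> \<le> t \<longleftrightarrow> \<tau> \<omega> \<le> q t"
      using grid_last(2)[OF p t] grid_last(3)[OF p t, of j] j unfolding q_def by linarith
  qed
  show ?thesis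
  proof
    assume g: "stopping_time (grid_filtration F m p) \<tau>"
    show "stopping_time F \<tau>"
      unfolding stopping_time_def pred_def space_F
    proof
      fix t
      have s: "{\<omega> \<in> space M. \<tau> \<omega> \<le> t} \<in> sets (F (q t))"
        using stopping_timeD[OF g, of t] unfolding G pred_def space_F .
      show "{\<omega> \<in> space M. \<tau> \<omega> \<le> t} \<in> sets (F t)"
      proof (cases "t < 0")
        case False
        then have "q t \<le> t" using grid_last(2)[OF p, of t] unfolding q_def by simp
        then show ?thesis by (rule subsetD[OF sets_F_mono s])
      qed (simp only: neg sets.empty_sets)
    qed
  next
    assume g: "stopping_time F \<tau>"
    show "stopping_time (grid_filtration F m p) \<tau>"
      unfolding stopping_time_def G pred_def space_F
    proof
      fix t
      show "{\<omega> \<in> space M. \<tau> \<omega> \<le> t} \<in> sets (F (q t))"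
      proof (cases "t < 0")
        case False
        then have "{\<omega> \<in> space M. \<tau> \<omega> \<le> t} = {\<omega> \<in> space M. \<tau> \<omega> \<le> q t}" by (intro pos) simp
        then show ?thesis using stopping_timeD[OF g, of "q t"] unfolding pred_def space_F by (simp only:)
      qed (simp only: neg sets.empty_sets)
    qed
  qed
qed

lemma grid_stopping_times_eq:
  assumes p: "is_partition T m p"
  shows "grid_stopping_times F T m p = times (p ` {0..m})"
proof (intro set_eqI)
  fix \<tau>
  have "p ` {0..m} \<subseteq> {0..T}"
    using is_partition_range[OF p] by (intro image_subsetI) simp
  then have "(\<forall>\<omega>\<in>space M. \<tau> \<omega> \<in> p ` {0..m}) \<Longrightarrow> (\<forall>\<omega>\<in>space M. \<tau> \<omega> \<in> {0..T})" by blast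
  then show "\<tau> \<in> grid_stopping_times F T m p \<longleftrightarrow> \<tau> \<in> times (p ` {0..m})"
    unfolding grid_stopping_times_def times_def stopping_times_def space_F mem_Collect_eq
    using stopping_time_grid_iff[OF p, of \<tau>] by metis
qed

lemma payment_at_finite_dates:
  fixes Y :: "real \<Rightarrow> 'a \<Rightarrow> real"
  assumes "finite D" "\<sigma> \<in> times D" "\<omega> \<in> space M"
  shows "Y (\<sigma> \<omega>) \<omega> = (\<Sum>d\<in>D. indicator {\<omega>\<in>space M. \<sigma> \<omega> = d} \<omega> * Y d \<omega>)"
proof -
  have "(\<Sum>d\<in>D. indicator {\<omega>\<in>space M. \<sigma> \<omega> = d} \<omega> * Y d \<omega>) = (\<Sum>d\<in>D. if d = \<sigma> \<omega> then Y d \<omega> else 0)"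
    using assms(3) by (intro sum.cong) (auto simp: indicator_def)
  then show ?thesis using timesD(5)[OF assms(2,3)] assms(1) by simp
qed

lemma times_event:
  assumes "\<sigma> \<in> times D"
  shows "{\<omega>\<in>space M. \<sigma> \<omega> = d} \<in> sets (F d)"
  using stopping_time_eq_const[OF timesD(1)[OF assms], of d] by (simp add: pred_def space_F)

lemma times_event_integrable:
  fixes X :: "'a \<Rightarrow> real"
  assumes "\<sigma> \<in> times D" "integrable M X"
  shows "integrable M (\<lambda>\<omega>. indicator {\<omega>\<in>space M. \<sigma> \<omega> = d} \<omega> * X \<omega>)"
  using integrable_mult_indicator[OF _ assms(2), of "{\<omega>\<in>space M. \<sigma> \<omega> = d}"]
    times_event[OF assms(1), of d] sets_F[of d] by auto

lemma finite_dates_integrable: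
  fixes Y :: "real \<Rightarrow> 'a \<Rightarrow> real"
  assumes D: "finite D" and Y: "\<And>d. d \<in> D \<Longrightarrow> integrable M (Y d)" and \<sigma>: "\<sigma> \<in> times D"
  shows "integrable M (\<lambda>\<omega>. Y (\<sigma> \<omega>) \<omega>)"
proof -
  have "integrable M (\<lambda>\<omega>. \<Sum>d\<in>D. indicator {\<omega>\<in>space M. \<sigma> \<omega> = d} \<omega> * Y d \<omega>)"
    by (rule Bochner_Integration.integrable_sum) (rule times_event_integrable[OF \<sigma> Y])
  then show ?thesis
    using payment_at_finite_dates[where Y=Y, OF D \<sigma>] by (simp cong: Bochner_Integration.integrable_cong)
qed

lemma real_cond_exp_expectation:
  assumes sub: "subalgebra M G" and X: "integrable M X" and B: "B \<in> sets G"
  shows "(\<integral>\<omega>. indicator B \<omega> * real_cond_exp M G X \<omega> \<partial>M) = (\<integral>\<omega>. indicator B \<omega> * X \<omega> \<partial>M)"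
proof -
  interpret finite_measure_subalgebra M G by unfold_locales (rule sub)
  show ?thesis using real_cond_exp_intA[OF X B] by (simp add: set_lebesgue_integral_def)
qed

lemma real_cond_exp_integrable:
  assumes sub: "subalgebra M G" and X: "integrable M X"
  shows "integrable M (real_cond_exp M G X)"
proof -
  interpret finite_measure_subalgebra M G by unfold_locales (rule sub)
  show ?thesis using real_cond_exp_int(1)[OF X] .
qed

end

lemma (in principal_agent) off_stops_integral:
  assumes \<tau>: "\<And>i. i \<in> {1..n} \<Longrightarrow> \<tau> i \<in> times D'" and \<sigma>: "\<sigma> \<in> borel_measurable M"
  shows "integrable M (\<lambda>\<omega>. of_bool (\<sigma> \<omega> \<notin> stops \<tau> \<omega>) :: real)"
    "(\<integral>\<omega>. of_bool (\<sigma> \<omega> \<notin> stops \<tau> \<omega>) \<partial>M) = prob {\<omega>\<in>space M. \<sigma> \<omega> \<notin> stops \<tau> \<omega>}"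
proof -
  have m: "{\<omega>\<in>space M. \<sigma> \<omega> \<notin> stops \<tau> \<omega>} \<in> sets M" by (rule stops_measurable[OF timesD(2)[OF \<tau>] \<sigma>])
  have "integrable M (indicat_real {\<omega>\<in>space M. \<sigma> \<omega> \<notin> stops \<tau> \<omega>})"
    "(\<integral>\<omega>. indicat_real {\<omega>\<in>space M. \<sigma> \<omega> \<notin> stops \<tau> \<omega>} \<omega> \<partial>M) = prob {\<omega>\<in>space M. \<sigma> \<omega> \<notin> stops \<tau> \<omega>}"
    using m by (auto simp: emeasure_eq_measure)
  moreover have "of_bool (\<sigma> \<omega> \<notin> stops \<tau> \<omega>) = indicat_real {\<omega>\<in>space M. \<sigma> \<omega> \<notin> stops \<tau> \<omega>} \<omega>"
    if "\<omega> \<in> space M" for \<omega>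
    using that by (auto simp: indicator_def)
  ultimately show "integrable M (\<lambda>\<omega>. of_bool (\<sigma> \<omega> \<notin> stops \<tau> \<omega>) :: real)"
    "(\<integral>\<omega>. of_bool (\<sigma> \<omega> \<notin> stops \<tau> \<omega>) \<partial>M) = prob {\<omega>\<in>space M. \<sigma> \<omega> \<notin> stops \<tau> \<omega>}"
    by (auto cong: Bochner_Integration.integrable_cong Bochner_Integration.integral_cong)
qed

text \<open>
  On a finite set of dates conditional expectations define a contract without further ado: pay
  the expected wage and \<open>\<xi>\<close>, and one unit less at the dates before \<open>T\<close> at which the chain does not stop.
\<close>

lemma (in principal_agent) grid_implementation:
  assumes p: "is_partition T m p" and D: "D = p ` {0..m}" and \<xi>T: "\<xi> \<in> borel_measurable (F T)"
    and \<tau>: "\<tau> \<in> A.chains D n"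
  shows "\<exists>Y \<in> grid_contracts M F T \<xi> m p.
    (\<forall>i\<in>{1..n}. smallest_optimal M (times D) (agent_payoff M \<mu>A (f i) Y) (\<tau> i)) \<and>
    principal_payoff M n \<mu>P g Y \<tau> = W \<tau>"
proof -
  note S = chainsD(1)[OF \<tau>]
  note ord = chainsD(2)[OF \<tau>]
  define q where "q t = Max (insert (p 0) {p j | j. j \<le> m \<and> p j \<le> t})" for t
  have grid: "0 \<le> d" "d \<le> T" "q d = d" if "d \<in> D" for d
  proof -
    show d: "0 \<le> d" "d \<le> T" using that is_partition_range[OF p] D by auto
    show "q d = d"
      using grid_last[OF p d(1)] that D unfolding q_def by (force intro: antisym)
  qed
  let ?w = "marginal_wage n f \<tau>"
  let ?X = "\<lambda>d \<omega>. (LINT s:{d<..T}|\<mu>A. ?w s \<omega>) + \<xi> \<omega> - of_bool (d \<notin> stops \<tau> \<omega>)"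
  have w: "A.rate ?w" by (rule marginal_wage_rate[OF S])
  have stops_int: "integrable M (\<lambda>\<omega>. of_bool (\<sigma> \<omega> \<notin> stops \<tau> \<omega>) :: real)"
    "(\<integral>\<omega>. of_bool (\<sigma> \<omega> \<notin> stops \<tau> \<omega>) \<partial>M) = prob {\<omega>\<in>space M. \<sigma> \<omega> \<notin> stops \<tau> \<omega>}"
    if "\<sigma> \<in> borel_measurable M" for \<sigma>
    using S that by (rule off_stops_integral, simp)+
  have const: "(\<lambda>_. d) \<in> times D" if "d \<in> D" for d
    using grid[OF that] that by (intro timesI stopping_time_const) auto
  have X_int: "integrable M (?X d)" if "d \<in> D" for d
    using A.after_integrable[OF w const[OF that]] stops_int(1)[of "\<lambda>_. d"] \<xi>_integrable by auto
  define c where "c d = real_cond_exp M (F d) (?X d)" for d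
  have subF: "subalgebra M (F d)" for d using sets_F space_F by (auto simp: subalgebra_def)
  have c_int: "integrable M (c d)" if "d \<in> D" for d
    unfolding c_def by (rule real_cond_exp_integrable[OF subF X_int[OF that]])
  define Y where "Y t = c (q t)" for t
  have finD: "finite D" by (simp add: D)
  have Y_at: "Y d = c d" if "d \<in> D" for d using grid(3)[OF that] by (simp add: Y_def)
  have Y_int: "integrable M (\<lambda>\<omega>. Y (\<sigma> \<omega>) \<omega>)" if \<sigma>: "\<sigma> \<in> times D" for \<sigma>
    by (rule finite_dates_integrable[where Y=Y, OF finD _ \<sigma>]) (simp add: Y_at c_int)
  have Y_exp: "(\<integral>\<omega>. Y (\<sigma> \<omega>) \<omega> \<partial>M)
      = (\<integral>\<omega>. (LINT s:{\<sigma> \<omega><..T}|\<mu>A. ?w s \<omega>) + \<xi> \<omega> \<partial>M) - prob {\<omega>\<in>space M. \<sigma> \<omega> \<notin> stops \<tau> \<omega>}"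
    if \<sigma>: "\<sigma> \<in> times D" for \<sigma>
  proof -
    have "(\<integral>\<omega>. Y (\<sigma> \<omega>) \<omega> \<partial>M) = (\<Sum>d\<in>D. \<integral>\<omega>. indicator {\<omega>\<in>space M. \<sigma> \<omega> = d} \<omega> * c d \<omega> \<partial>M)"
      using times_event_integrable[OF \<sigma> c_int] payment_at_finite_dates[where Y=Y, OF finD \<sigma>] Y_at
      by (simp cong: Bochner_Integration.integral_cong)
    also have "\<dots> = (\<Sum>d\<in>D. \<integral>\<omega>. indicator {\<omega>\<in>space M. \<sigma> \<omega> = d} \<omega> * ?X d \<omega> \<partial>M)"
      unfolding c_def by (intro sum.cong refl real_cond_exp_expectation subF X_int times_event[OF \<sigma>])
    also have "\<dots> = (\<integral>\<omega>. ?X (\<sigma> \<omega>) \<omega> \<partial>M)"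
      using times_event_integrable[OF \<sigma> X_int] payment_at_finite_dates[where Y="?X", OF finD \<sigma>]
      by (simp cong: Bochner_Integration.integral_cong)
    also have "\<dots> = (\<integral>\<omega>. (LINT s:{\<sigma> \<omega><..T}|\<mu>A. ?w s \<omega>) + \<xi> \<omega> \<partial>M) - prob {\<omega>\<in>space M. \<sigma> \<omega> \<notin> stops \<tau> \<omega>}"
      using A.after_integrable[OF w \<sigma>] \<xi>_integrable stops_int[OF timesD(2)[OF \<sigma>]] by simp
    finally show ?thesis .
  qed
  have Y_exp': "(\<integral>\<omega>. Y (\<tau> i \<omega>) \<omega> \<partial>M) = (\<integral>\<omega>. (LINT s:{\<tau> i \<omega><..T}|\<mu>A. ?w s \<omega>) + \<xi> \<omega> \<partial>M)"
    if "i \<in> {1..n}" for i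
  proof -
    have "{\<omega>\<in>space M. \<tau> i \<omega> \<notin> stops \<tau> \<omega>} = {}" using that by (auto simp: stops_def)
    then have "prob {\<omega>\<in>space M. \<tau> i \<omega> \<notin> stops \<tau> \<omega>} = 0" by (simp only: measure_empty)
    with Y_exp[OF S[OF that]] show ?thesis by linarith
  qed
  have "Y \<in> grid_contracts M F T \<xi> m p"
    unfolding grid_contracts_def
  proof (intro CollectI conjI allI ballI impI)
    show "adapted (grid_filtration F m p) T Y"
      unfolding adapted_def Y_def grid_filtration_def q_def[symmetric] c_def by auto
    fix j t \<omega> assume j: "j < m" and t: "t \<in> {p j..<p (Suc j)}"
    have "0 \<le> t" using is_partition_range[OF p, of j] j t by auto
    then obtain k where k: "k \<le> m" "q t = p k" using grid_last(1)[OF p, of t] by (auto simp: q_def)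
    have "p j \<le> q t" "q t \<le> t" using grid_last[OF p \<open>0 \<le> t\<close>] j t by (auto simp: q_def)
    moreover have "k \<le> j"
    proof (rule ccontr)
      assume "\<not> k \<le> j"
      then have "p (Suc j) \<le> p k" using is_partition_mono[OF p, of "Suc j" k] k by (cases "k = Suc j") auto
      then show False using k t \<open>q t \<le> t\<close> by auto
    qed
    then have "p k \<le> p j" using is_partition_mono[OF p, of k j] j by (cases "k = j") auto
    ultimately have "q t = p j" using k by simp
    then show "Y t \<omega> = Y (p j) \<omega>" using grid(3)[of "p j"] j D by (simp add: Y_def)
  next
    fix j assume "j \<le> m"
    then show "integrable M (Y (p j))" using grid(3)[of "p j"] c_int[of "p j"] D by (simp add: Y_def)
  next
    interpret sub: finite_measure_subalgebra M "F T" by unfold_locales (rule subF)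
    have "?X T = \<xi>" by (auto simp: fun_eq_iff stops_def set_lebesgue_integral_def)
    moreover have "AE \<omega> in M. real_cond_exp M (F T) \<xi> \<omega> = \<xi> \<omega>"
      by (rule sub.real_cond_exp_F_meas[OF \<xi>_integrable \<xi>T])
    ultimately show "AE \<omega> in M. \<xi> \<omega> \<le> Y T \<omega>"
      using grid(3)[OF T_D] by (auto simp: Y_def c_def elim!: eventually_mono)
  qed
  moreover have "smallest_optimal M (times D) (agent_payoff M \<mu>A (f i) Y) (\<tau> i)" if "i \<in> {1..n}" for i
    using Y_exp by (intro chain_implemented[OF \<tau> Y_int w \<xi>_integrable _ _ _ _ Y_exp' that]
        marginal_wage_low[OF ord] marginal_wage_high[OF ord] marginal_wage_less[OF ord]) auto
  moreover have "principal_payoff M n \<mu>P g Y \<tau> = W \<tau>"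
    using S Y_int Y_exp' by (subst principal_payoff_split, simp, simp, subst chain_value_split) auto
  ultimately show ?thesis by (intro bexI[of _ Y] conjI ballI)
qed

section \<open>Contracts that pay only at prescribed stopping times\<close>

lemma optional_sigma_space: "space (optional_sigma F T) = {0..T} \<times> space (F T)"
  unfolding optional_sigma_def by (rule space_measure_of) auto

lemma cadlag_adapted_optional:
  assumes "adapted F T X" "\<And>\<omega>. \<omega> \<in> space (F T) \<Longrightarrow> cadlag T (\<lambda>t. X t \<omega>)"
  shows "optional_process F T X"
  unfolding optional_process_def
proof (rule measurableI)
  fix B :: "real set" assume B: "B \<in> sets borel"
  have "(\<lambda>(t, \<omega>). X t \<omega>) -` B \<inter> space (optional_sigma F T)
      = {(t, \<omega>). t \<in> {0..T} \<and> \<omega> \<in> space (F T) \<and> X t \<omega> \<in> B}"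
    by (auto simp: optional_sigma_space)
  also have "\<dots> \<in> sets (optional_sigma F T)"
    unfolding optional_sigma_def using assms B
    by (subst sets_measure_of) (auto intro!: sigma_sets.Basic)
  finally show "(\<lambda>(t, \<omega>). X t \<omega>) -` B \<inter> space (optional_sigma F T) \<in> sets (optional_sigma F T)" .
qed auto

lemma optional_process_const: "optional_process F T (\<lambda>t \<omega>. c)"
  by (simp add: optional_process_def case_prod_beta')

lemma optional_process_add:
  "optional_process F T X \<Longrightarrow> optional_process F T Y \<Longrightarrow> optional_process F T (\<lambda>t \<omega>. X t \<omega> + Y t \<omega>)"
  unfolding optional_process_def case_prod_beta' by (rule borel_measurable_add)

lemma optional_process_diff:
  "optional_process F T X \<Longrightarrow> optional_process F T Y \<Longrightarrow> optional_process F T (\<lambda>t \<omega>. X t \<omega> - Y t \<omega>)"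
  unfolding optional_process_def case_prod_beta' by (rule borel_measurable_diff)

lemma optional_process_sum:
  "(\<And>i. i \<in> I \<Longrightarrow> optional_process F T (X i)) \<Longrightarrow> optional_process F T (\<lambda>t \<omega>. \<Sum>i\<in>I. X i t \<omega>)"
  unfolding optional_process_def case_prod_beta' by (rule borel_measurable_sum)

lemma optional_process_LIMSEQ:
  assumes "\<And>k::nat. optional_process F T (X k)" "\<And>t \<omega>. (\<lambda>k. X k t \<omega>) \<longlonglongrightarrow> Y t \<omega>"
  shows "optional_process F T Y"
  unfolding optional_process_def case_prod_beta'
proof (rule borel_measurable_LIMSEQ_real[where u="\<lambda>k z. X k (fst z) (snd z)"])
  show "(\<lambda>z. X k (fst z) (snd z)) \<in> borel_measurable (optional_sigma F T)" for k
    using assms(1)[of k] by (simp only: optional_process_def case_prod_beta')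
qed (rule assms(2))

lemma cadlag_step: "cadlag T (\<lambda>t. if a \<le> t then c else (0::real))"
  unfolding cadlag_def
proof (intro conjI ballI)
  fix t :: real
  let ?x = "\<lambda>t. if a \<le> t then c else (0::real)"
  show "(?x \<longlongrightarrow> ?x t) (at_right t)"
  proof (rule tendsto_eventually)
    show "\<forall>\<^sub>F s in at_right t. ?x s = ?x t"
      unfolding eventually_at_right_field
      by (rule exI[of _ "if a \<le> t then t + 1 else a"]) auto
  qed
  show "\<exists>l. (?x \<longlongrightarrow> l) (at_left t)"
  proof (rule exI, rule tendsto_eventually)
    show "\<forall>\<^sub>F s in at_left t. ?x s = (if a < t then c else 0)"
      unfolding eventually_at_left_field
      by (rule exI[of _ "if a < t then a else t - 1"]) auto
  qed
qed

context filtered_prob_space begin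

lemma step_adapted:
  assumes \<sigma>: "\<sigma> \<in> times D" and z: "z \<in> borel_measurable (pre_sigma \<sigma>)" and \<delta>: "0 \<le> \<delta>"
  shows "adapted F T (\<lambda>t \<omega>. if \<sigma> \<omega> + \<delta> \<le> t then z \<omega> else 0)"
  unfolding adapted_def
proof
  fix t
  have "(\<lambda>\<omega>. if \<sigma> \<omega> \<le> t - \<delta> then z \<omega> else 0) \<in> borel_measurable (F (t - \<delta>))"
  proof (rule measurableI)
    fix B :: "real set" assume B: "B \<in> sets borel"
    have "z -` B \<inter> space (pre_sigma \<sigma>) \<in> sets (pre_sigma \<sigma>)" using z B by (rule measurable_sets)
    then have 1: "{\<omega> \<in> z -` B \<inter> space M. \<sigma> \<omega> \<le> t - \<delta>} \<in> sets (F (t - \<delta>))"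
      using sets_pre_sigmaD[OF timesD(1)[OF \<sigma>], of "z -` B \<inter> space M"] by (simp add: space_pre_sigma)
    have 2: "{\<omega> \<in> space M. \<sigma> \<omega> \<le> t - \<delta>} \<in> sets (F (t - \<delta>))"
      using stopping_timeD[OF timesD(1)[OF \<sigma>]] by (simp add: pred_def space_F)
    have 3: "space M \<in> sets (F (t - \<delta>))" using sets.top[of "F (t - \<delta>)"] by (simp add: space_F)
    have "(\<lambda>\<omega>. if \<sigma> \<omega> \<le> t - \<delta> then z \<omega> else 0) -` B \<inter> space (F (t - \<delta>))
      = {\<omega> \<in> z -` B \<inter> space M. \<sigma> \<omega> \<le> t - \<delta>} \<union>
        (if 0 \<in> B then space M - {\<omega> \<in> space M. \<sigma> \<omega> \<le> t - \<delta>} else {})"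
      by (auto simp: space_F split: if_splits)
    also have "\<dots> \<in> sets (F (t - \<delta>))" using 1 2 3 by auto
    finally show "(\<lambda>\<omega>. if \<sigma> \<omega> \<le> t - \<delta> then z \<omega> else 0) -` B \<inter> space (F (t - \<delta>)) \<in> sets (F (t - \<delta>))" .
  qed auto
  then have "(\<lambda>\<omega>. if \<sigma> \<omega> \<le> t - \<delta> then z \<omega> else 0) \<in> borel_measurable (F t)"
    using sets_F_mono[of "t - \<delta>" t] \<delta> by (auto simp: measurable_def space_F)
  then show "(\<lambda>\<omega>. if \<sigma> \<omega> + \<delta> \<le> t then z \<omega> else 0) \<in> borel_measurable (F t)"
    by (simp add: le_diff_eq)
qed

text \<open>
  A process that lives on the graph of \<open>\<sigma>\<close> is the difference of the cadlag step at \<open>\<sigma>\<close> and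
  the left-continuous step after \<open>\<sigma>\<close>, the limit of the cadlag steps at \<open>\<sigma> + 1 / (k + 1)\<close>.
\<close>

lemma peak_optional:
  assumes \<sigma>: "\<sigma> \<in> times D" and z: "z \<in> borel_measurable (pre_sigma \<sigma>)"
  shows "optional_process F T (\<lambda>t \<omega>. if t = \<sigma> \<omega> then z \<omega> else 0)"
proof -
  let ?X = "\<lambda>\<delta> t \<omega>. if \<sigma> \<omega> + \<delta> \<le> t then z \<omega> else 0"
  have opt: "optional_process F T (?X \<delta>)" if "0 \<le> \<delta>" for \<delta>
    by (intro cadlag_adapted_optional step_adapted[OF \<sigma> z that] cadlag_step)
  have strict: "optional_process F T (\<lambda>t \<omega>. if \<sigma> \<omega> < t then z \<omega> else 0)"
  proof (rule optional_process_LIMSEQ)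
    show "optional_process F T (?X (1 / real (Suc k)))" for k by (rule opt) simp
    fix t \<omega>
    show "(\<lambda>k. ?X (1 / real (Suc k)) t \<omega>) \<longlonglongrightarrow> (if \<sigma> \<omega> < t then z \<omega> else 0)"
    proof (rule tendsto_eventually)
      show "\<forall>\<^sub>F k in sequentially. ?X (1 / real (Suc k)) t \<omega> = (if \<sigma> \<omega> < t then z \<omega> else 0)"
      proof (cases "\<sigma> \<omega> < t")
        case True
        have "(\<lambda>k. 1 / real (Suc k)) \<longlonglongrightarrow> 0"
          using LIMSEQ_inverse_real_of_nat by (simp add: inverse_eq_divide)
        then have "\<forall>\<^sub>F k in sequentially. 1 / real (Suc k) < t - \<sigma> \<omega>"
          using True by (intro order_tendstoD(2)) auto
        then show ?thesis by (rule eventually_mono) (use True in auto)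
      next
        case False
        then have "\<not> \<sigma> \<omega> + 1 / real (Suc k) \<le> t" for k
          by (smt (verit) divide_pos_pos of_nat_0_less_iff zero_less_Suc)
        then show ?thesis using False by auto
      qed
    qed
  qed
  have eq: "(\<lambda>t \<omega>. if t = \<sigma> \<omega> then z \<omega> else 0) =
      (\<lambda>t \<omega>. (if \<sigma> \<omega> + 0 \<le> t then z \<omega> else 0) - (if \<sigma> \<omega> < t then z \<omega> else 0))"
    by (auto simp: fun_eq_iff)
  show ?thesis unfolding eq by (rule optional_process_diff[OF opt strict]) simp
qed

lemma dominated_class_D:
  assumes m: "\<And>\<sigma>. \<sigma> \<in> times {0..T} \<Longrightarrow> (\<lambda>\<omega>. Y (\<sigma> \<omega>) \<omega>) \<in> borel_measurable M"
    and Z: "integrable M Z" and le: "\<And>t \<omega>. \<omega> \<in> space M \<Longrightarrow> \<bar>Y t \<omega>\<bar> \<le> Z \<omega>"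
  shows "class_D M F T Y"
proof -
  have Z0: "0 \<le> Z \<omega>" if "\<omega> \<in> space M" for \<omega> using le[OF that, of 0] by auto
  have [measurable]: "Z \<in> borel_measurable M" using Z by auto
  let ?h = "\<lambda>c \<omega>. if c < Z \<omega> then Z \<omega> else 0"
  have hint: "integrable M (?h c)" for c
    by (rule Bochner_Integration.integrable_bound[OF Z]) (use Z0 in auto)
  have "((\<lambda>c. \<integral>\<omega>. ?h c \<omega> \<partial>M) \<longlongrightarrow> (\<integral>\<omega>. 0 \<partial>M)) at_top"
  proof (rule integral_dominated_convergence_at_top[where w=Z])
    show "AE \<omega> in M. ((\<lambda>c. ?h c \<omega>) \<longlongrightarrow> 0) at_top"
    proof (rule AE_I2, rule tendsto_eventually)
      fix \<omega> show "\<forall>\<^sub>F c in at_top. ?h c \<omega> = 0"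
        using eventually_ge_at_top[of "Z \<omega>"] by eventually_elim auto
    qed
    show "\<forall>\<^sub>F c in at_top. AE \<omega> in M. norm (?h c \<omega>) \<le> Z \<omega>"
      using Z0 by (intro always_eventually allI AE_I2) auto
  qed (use Z in auto)
  then have "((\<lambda>c. ennreal (\<integral>\<omega>. ?h c \<omega> \<partial>M)) \<longlongrightarrow> ennreal 0) at_top"
    by (intro tendsto_ennrealI) simp
  then have lim: "((\<lambda>c. ennreal (\<integral>\<omega>. ?h c \<omega> \<partial>M)) \<longlongrightarrow> 0) at_top" by simp
  have le': "(SUP X\<in>(\<lambda>\<tau> \<omega>. Y (\<tau> \<omega>) \<omega>) ` stopping_times F T.
      \<integral>\<^sup>+\<omega>\<in>{\<omega>. c < \<bar>X \<omega>\<bar>}. ennreal \<bar>X \<omega>\<bar> \<partial>M) \<le> ennreal (\<integral>\<omega>. ?h c \<omega> \<partial>M)" for c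
  proof (rule SUP_least)
    fix X assume "X \<in> (\<lambda>\<tau> \<omega>. Y (\<tau> \<omega>) \<omega>) ` stopping_times F T"
    then have X: "\<bar>X \<omega>\<bar> \<le> Z \<omega>" if "\<omega> \<in> space M" for \<omega> using le that by auto
    have "(\<integral>\<^sup>+\<omega>\<in>{\<omega>. c < \<bar>X \<omega>\<bar>}. ennreal \<bar>X \<omega>\<bar> \<partial>M) \<le> (\<integral>\<^sup>+\<omega>. ennreal (?h c \<omega>) \<partial>M)"
    proof (rule nn_integral_mono)
      fix \<omega> assume "\<omega> \<in> space M"
      from X[OF this] show "ennreal \<bar>X \<omega>\<bar> * indicator {\<omega>. c < \<bar>X \<omega>\<bar>} \<omega> \<le> ennreal (?h c \<omega>)"
        by (cases "c < \<bar>X \<omega>\<bar>") (auto intro: ennreal_leI)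
    qed
    also have "\<dots> = ennreal (\<integral>\<omega>. ?h c \<omega> \<partial>M)"
      by (rule nn_integral_eq_integral[OF hint]) (use Z0 in auto)
    finally show "(\<integral>\<^sup>+\<omega>\<in>{\<omega>. c < \<bar>X \<omega>\<bar>}. ennreal \<bar>X \<omega>\<bar> \<partial>M) \<le> ennreal (\<integral>\<omega>. ?h c \<omega> \<partial>M)" .
  qed
  have "((\<lambda>c. SUP X\<in>(\<lambda>\<tau> \<omega>. Y (\<tau> \<omega>) \<omega>) ` stopping_times F T.
      \<integral>\<^sup>+\<omega>\<in>{\<omega>. c < \<bar>X \<omega>\<bar>}. ennreal \<bar>X \<omega>\<bar> \<partial>M) \<longlongrightarrow> 0) (at_top :: real filter)"
    by (rule tendsto_sandwich[OF _ _ tendsto_const lim]; rule always_eventually; intro allI zero_le le')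
  then show ?thesis
    unfolding class_D_def uniformly_integrable_def using m stopping_times_eq_times by auto
qed

text \<open>
  Under an integrable bound, Fatou's lemma turns upper semicontinuity of the paths into upper
  semicontinuity in expectation. The paths with finitely many peaks used below satisfy the strong
  form \<open>usc\<close>.
\<close>

lemma dominated_USCE:
  assumes m: "\<And>\<sigma>. \<sigma> \<in> times {0..T} \<Longrightarrow> (\<lambda>\<omega>. Y (\<sigma> \<omega>) \<omega>) \<in> borel_measurable M"
    and Z: "integrable M Z" and le: "\<And>t \<omega>. \<omega> \<in> space M \<Longrightarrow> \<bar>Y t \<omega>\<bar> \<le> Z \<omega>"
    and usc: "\<And>t ts \<omega>. \<omega> \<in> space M \<Longrightarrow> ts \<longlonglongrightarrow> t \<Longrightarrow> \<forall>\<^sub>F k in sequentially. Y (ts k) \<omega> \<le> Y t \<omega>"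
  shows "USCE M F T Y"
  unfolding USCE_def
proof (intro allI impI, elim conjE)
  fix \<tau> and \<tau>s :: "nat \<Rightarrow> 'a \<Rightarrow> real"
  assume \<tau>: "\<tau> \<in> stopping_times F T" and "\<forall>k. \<tau>s k \<in> stopping_times F T"
    and lim: "AE \<omega> in M. (\<lambda>k. \<tau>s k \<omega>) \<longlonglongrightarrow> \<tau> \<omega>"
  then have m1: "(\<lambda>\<omega>. Y (\<tau> \<omega>) \<omega>) \<in> borel_measurable M"
    and m2: "(\<lambda>\<omega>. Y (\<tau>s k \<omega>) \<omega>) \<in> borel_measurable M" for k
    using m stopping_times_eq_times by auto
  let ?m = "\<lambda>k \<omega>. max (Y (\<tau>s k \<omega>) \<omega>) (Y (\<tau> \<omega>) \<omega>)"
  have bnd: "\<bar>?m k \<omega>\<bar> \<le> Z \<omega>" if "\<omega> \<in> space M" for k \<omega>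
    using le[OF that, of "\<tau>s k \<omega>"] le[OF that, of "\<tau> \<omega>"] by (auto simp: max_def)
  have int1: "integrable M (?m k)" for k
    by (rule Bochner_Integration.integrable_bound[OF Z]) (use m1 m2 bnd in \<open>auto intro!: AE_I2 intro: order_trans[OF _ abs_ge_self]\<close>)
  have int2: "integrable M (\<lambda>\<omega>. Y (\<tau>s k \<omega>) \<omega>)" for k
    by (rule Bochner_Integration.integrable_bound[OF Z]) (use m2 le in \<open>auto intro!: AE_I2 intro: order_trans[OF _ abs_ge_self]\<close>)
  have "(\<lambda>k. \<integral>\<omega>. ?m k \<omega> \<partial>M) \<longlonglongrightarrow> (\<integral>\<omega>. Y (\<tau> \<omega>) \<omega> \<partial>M)"
  proof (rule integral_dominated_convergence[where w=Z])
    show "AE \<omega> in M. (\<lambda>k. ?m k \<omega>) \<longlonglongrightarrow> Y (\<tau> \<omega>) \<omega>"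
      using lim AE_space
    proof eventually_elim
      case (elim \<omega>)
      show ?case
        by (rule tendsto_eventually) (use usc[OF elim(2,1)] in \<open>auto elim!: eventually_mono\<close>)
    qed
  qed (use m1 m2 Z bnd in \<open>auto intro!: AE_I2\<close>)
  then have "(\<lambda>k. ereal (\<integral>\<omega>. ?m k \<omega> \<partial>M)) \<longlonglongrightarrow> ereal (\<integral>\<omega>. Y (\<tau> \<omega>) \<omega> \<partial>M)" by simp
  then have "limsup (\<lambda>k. ereal (\<integral>\<omega>. ?m k \<omega> \<partial>M)) = ereal (\<integral>\<omega>. Y (\<tau> \<omega>) \<omega> \<partial>M)"
    by (rule lim_imp_Limsup[OF sequentially_bot])
  moreover have "limsup (\<lambda>k. ereal (\<integral>\<omega>. Y (\<tau>s k \<omega>) \<omega> \<partial>M)) \<le> limsup (\<lambda>k. ereal (\<integral>\<omega>. ?m k \<omega> \<partial>M))"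
    using int1 int2 by (intro Limsup_mono always_eventually allI) (auto intro!: integral_mono)
  ultimately show "limsup (\<lambda>k. ereal (\<integral>\<omega>. Y (\<tau>s k \<omega>) \<omega> \<partial>M)) \<le> ereal (\<integral>\<omega>. Y (\<tau> \<omega>) \<omega> \<partial>M)"
    by simp
qed

text \<open>
  Finitely many nonnegative peaks over a constant: a sequence of dates that converges to a date off the
  peaks leaves them eventually, and at a peak the path can only jump up.
\<close>

lemma peaks_contract:
  fixes \<sigma> :: "nat \<Rightarrow> 'a \<Rightarrow> real" and K :: "nat set" and L :: real
  assumes K: "finite K" and \<sigma>: "\<And>k. k \<in> K \<Longrightarrow> \<sigma> k \<in> times {0..T}"
    and z: "\<And>k. k \<in> K \<Longrightarrow> z k \<in> borel_measurable (pre_sigma (\<sigma> k))"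
    and z_int: "\<And>k. k \<in> K \<Longrightarrow> integrable M (z k)" and z_nonneg: "\<And>k \<omega>. k \<in> K \<Longrightarrow> 0 \<le> z k \<omega>"
  defines "Y \<equiv> \<lambda>t \<omega>. L + (\<Sum>k\<in>K. if t = \<sigma> k \<omega> then z k \<omega> else 0)"
  shows "optional_process F T Y" "USCE M F T Y" "class_D M F T Y"
    "\<And>\<tau>. \<tau> \<in> times {0..T} \<Longrightarrow> integrable M (\<lambda>\<omega>. Y (\<tau> \<omega>) \<omega>)"
proof -
  show "optional_process F T Y"
    unfolding Y_def
    by (intro optional_process_add optional_process_const optional_process_sum
        peak_optional[where D="{0..T}"] \<sigma> z)
  have m: "(\<lambda>\<omega>. Y (\<tau> \<omega>) \<omega>) \<in> borel_measurable M" if \<tau>: "\<tau> \<in> times {0..T}" for \<tau>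
    unfolding Y_def
  proof (intro borel_measurable_add borel_measurable_sum measurable_If)
    fix k assume k: "k \<in> K"
    show "z k \<in> borel_measurable M" using z_int[OF k] by auto
    show "{x \<in> space M. \<tau> x = \<sigma> k x} \<in> sets M"
      using timesD(2)[OF \<tau>] timesD(2)[OF \<sigma>[OF k]] by auto
  qed auto
  let ?Z = "\<lambda>\<omega>. \<bar>L\<bar> + (\<Sum>k\<in>K. z k \<omega>)"
  have Z: "integrable M ?Z" using z_int by auto
  have le: "\<bar>Y t \<omega>\<bar> \<le> ?Z \<omega>" for t \<omega>
  proof -
    have "0 \<le> (\<Sum>k\<in>K. if t = \<sigma> k \<omega> then z k \<omega> else 0)" using z_nonneg by (intro sum_nonneg) auto
    moreover have "(\<Sum>k\<in>K. if t = \<sigma> k \<omega> then z k \<omega> else 0) \<le> (\<Sum>k\<in>K. z k \<omega>)"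
      using z_nonneg by (intro sum_mono) auto
    ultimately show ?thesis unfolding Y_def by linarith
  qed
  show "class_D M F T Y" by (rule dominated_class_D[OF m Z le])
  show "integrable M (\<lambda>\<omega>. Y (\<tau> \<omega>) \<omega>)" if "\<tau> \<in> times {0..T}" for \<tau>
    by (rule Bochner_Integration.integrable_bound[OF Z m[OF that]])
      (use le in \<open>auto intro!: AE_I2 intro: order_trans[OF _ abs_ge_self]\<close>)
  show "USCE M F T Y"
  proof (rule dominated_USCE[OF m Z le])
    fix t :: real and ts \<omega> assume ts: "ts \<longlonglongrightarrow> t"
    have "\<forall>\<^sub>F j in sequentially. \<forall>k\<in>K. (if ts j = \<sigma> k \<omega> then z k \<omega> else 0) \<le> (if t = \<sigma> k \<omega> then z k \<omega> else 0)"
    proof (intro eventually_ball_finite[OF K] ballI)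
      fix k assume k: "k \<in> K"
      show "\<forall>\<^sub>F j in sequentially. (if ts j = \<sigma> k \<omega> then z k \<omega> else 0) \<le> (if t = \<sigma> k \<omega> then z k \<omega> else 0)"
      proof (cases "t = \<sigma> k \<omega>")
        case False
        have "\<forall>\<^sub>F j in sequentially. ts j \<noteq> \<sigma> k \<omega>" by (rule tendsto_imp_eventually_ne[OF ts False])
        then show ?thesis by eventually_elim (use z_nonneg[OF k] in auto)
      qed (use z_nonneg[OF k] in auto)
    qed
    then show "\<forall>\<^sub>F j in sequentially. Y (ts j) \<omega> \<le> Y t \<omega>"
      unfolding Y_def by eventually_elim (auto intro!: add_left_mono sum_mono)
  qed
qed

end

section \<open>Atomless clocks\<close>

locale atomless_clock = clock +
  assumes atomless: "atomless \<mu>"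
begin

lemma singleton_null: "AE s in \<mu>. s \<noteq> t"
proof (cases "t \<in> {0..T}")
  case True
  then have m: "{t} \<in> sets \<mu>" by (auto simp: sets_clock sets_restrict_space_iff)
  have "emeasure \<mu> {t} = 0"
  proof (rule ccontr)
    assume "emeasure \<mu> {t} \<noteq> 0"
    then obtain B where "B \<subseteq> {t}" "0 < emeasure \<mu> B" "emeasure \<mu> B < emeasure \<mu> {t}"
      using atomless m unfolding atomless_def by (metis zero_less_iff_neq_zero)
    then show False by (cases "B = {}") (auto dest: subset_singletonD)
  qed
  then show ?thesis using m by (intro AE_I[of _ _ "{t}"]) auto
next
  case False
  then show ?thesis by (intro AE_I2) (auto simp: space_clock)
qed

lemma
  fixes v :: "real \<Rightarrow> real"
  assumes v: "integrable \<mu> v" and ts: "ts \<longlonglongrightarrow> t"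
  shows upto_tendsto: "(\<lambda>k. \<integral>s. of_bool (s \<le> ts k) * v s \<partial>\<mu>) \<longlonglongrightarrow> (\<integral>s. of_bool (s \<le> t) * v s \<partial>\<mu>)"
proof (rule integral_dominated_convergence[where w="\<lambda>s. \<bar>v s\<bar>"])
  show "AE s in \<mu>. (\<lambda>k. of_bool (s \<le> ts k) * v s) \<longlonglongrightarrow> of_bool (s \<le> t) * v s"
    using singleton_null[of t]
  proof eventually_elim
    case (elim s)
    have "\<forall>\<^sub>F k in sequentially. (s \<le> ts k) = (s \<le> t)"
    proof (cases "s < t")
      case True
      show ?thesis using order_tendstoD(1)[OF ts True] by (rule eventually_mono) (use True in auto)
    next
      case False
      then have "t < s" using elim by auto
      show ?thesis using order_tendstoD(2)[OF ts \<open>t < s\<close>] by (rule eventually_mono) (use \<open>t < s\<close> in auto)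
    qed
    then show ?case by (intro tendsto_eventually) (auto elim!: eventually_mono)
  qed
qed (use v integrable_cut(1)[OF v] in \<open>auto intro: borel_measurable_integrable\<close>)

text \<open>
  The first time at which a nonnegative rate has spent the budget \<open>c\<close>. It is a stopping time
  because the amount spent is adapted and continuous.
\<close>

lemma budget_time:
  assumes u: "rate u" and prog: "progressively_measurable F T u"
    and u0: "\<And>s \<omega>. 0 \<le> u s \<omega>" and c: "0 < c"
  obtains \<rho> where "\<rho> \<in> times {0..T}"
    "AE \<omega> in M. (\<forall>t<\<rho> \<omega>. (\<integral>s. of_bool (s \<le> t) * u s \<omega> \<partial>\<mu>) < c) \<and>
       (\<integral>s. of_bool (s \<le> \<rho> \<omega>) * u s \<omega> \<partial>\<mu>) \<le> c \<and>
       (\<rho> \<omega> < T \<longrightarrow> (\<integral>s. of_bool (s \<le> \<rho> \<omega>) * u s \<omega> \<partial>\<mu>) = c)"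
proof -
  define a where "a \<omega> t = (\<integral>s. of_bool (s \<le> t) * u s \<omega> \<partial>\<mu>)" for \<omega> t
  \<comment> \<open>On the null set \<open>N\<close>, which the filtration knows from the start, there is no budget constraint.\<close>
  obtain N where N: "N \<in> null_sets M" "{\<omega>\<in>space M. \<not> integrable \<mu> (\<lambda>s. u s \<omega>)} \<subseteq> N"
    using rate_AE[OF u] by (auto elim: AE_E3 simp: eventually_ae_filter)
  have good: "integrable \<mu> (\<lambda>s. u s \<omega>)" if "\<omega> \<in> space M" "\<omega> \<notin> N" for \<omega> using N that by auto
  have cont: "continuous_on UNIV (a \<omega>)" if "\<omega> \<in> space M" "\<omega> \<notin> N" for \<omega>
    unfolding continuous_on_sequentially o_def a_def using upto_tendsto[OF good[OF that]] by auto
  have mono: "a \<omega> s \<le> a \<omega> t" if "\<omega> \<in> space M" "\<omega> \<notin> N" "s \<le> t" for \<omega> s t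
    unfolding a_def using that u0 by (intro integral_mono integrable_cut good) auto
  define A where "A \<omega> = {t\<in>{0..T}. c \<le> a \<omega> t}" for \<omega>
  define \<rho> where "\<rho> \<omega> = (if \<omega> \<in> N \<or> A \<omega> = {} then T else Inf (A \<omega>))" for \<omega>
  have A: "Inf (A \<omega>) \<in> A \<omega>" "\<And>t. t \<in> A \<omega> \<Longrightarrow> Inf (A \<omega>) \<le> t"
    if "\<omega> \<in> space M" "\<omega> \<notin> N" "A \<omega> \<noteq> {}" for \<omega>
  proof -
    have bdd: "bdd_below (A \<omega>)" by (rule bdd_belowI[of _ 0]) (auto simp: A_def)
    have "A \<omega> = {0..T} \<inter> {t. c \<le> a \<omega> t}" by (auto simp: A_def)
    also have "closed \<dots>"
      using cont[OF that(1,2)] by (intro closed_Int closed_Collect_le continuous_on_const) auto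
    finally have "closed (A \<omega>)" .
    then show "Inf (A \<omega>) \<in> A \<omega>" using bdd that(3) by (intro closed_contains_Inf)
    show "Inf (A \<omega>) \<le> t" if "t \<in> A \<omega>" for t using that bdd by (rule cInf_lower)
  qed
  have range: "0 \<le> \<rho> \<omega>" "\<rho> \<omega> \<le> T" if "\<omega> \<in> space M" for \<omega>
    using A[OF that] T_pos by (auto simp: \<rho>_def A_def)
  have iff: "\<rho> \<omega> \<le> t \<longleftrightarrow> \<omega> \<notin> N \<and> c \<le> a \<omega> t" if \<omega>: "\<omega> \<in> space M" and t: "0 \<le> t" "t < T" for \<omega> t
  proof (cases "\<omega> \<in> N \<or> A \<omega> = {}")
    case True
    then show ?thesis using t by (auto simp: \<rho>_def A_def)
  next
    case False
    then have F: "\<omega> \<notin> N" "A \<omega> \<noteq> {}" "\<rho> \<omega> = Inf (A \<omega>)" by (auto simp: \<rho>_def)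
    have "c \<le> a \<omega> (\<rho> \<omega>)" using A(1)[OF \<omega> F(1,2)] F(3) by (simp add: A_def)
    then show ?thesis
      using mono[OF \<omega> F(1), of "\<rho> \<omega>" t] A(2)[OF \<omega> F(1,2), of t] F t by (auto simp: A_def)
  qed
  have adapted: "(\<lambda>\<omega>. a \<omega> t) \<in> borel_measurable (F t)" if t: "0 \<le> t" "t < T" for t
  proof -
    let ?R = "restrict_space \<mu> {0..t}"
    have m: "{0..t} \<in> sets \<mu>" using t by auto
    interpret R: finite_measure ?R
      by (rule finite_measure_restrict_space[OF clock.finite_measure_axioms m])
    have "{0..T} \<inter> {0..t} = {0..t}" using t by auto
    then have sets_R: "sets ?R = sets (restrict_space borel {0..t})"
      using sets_restrict_restrict_space[of borel "{0..T}" "{0..t}"] sets_clock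
      by (metis sets_restrict_space_cong)
    have "(\<lambda>(s, \<omega>). u s \<omega>) \<in> borel_measurable (restrict_space borel {0..t} \<Otimes>\<^sub>M F t)"
      using prog t by (auto simp: progressively_measurable_def)
    then have "(\<lambda>(s, \<omega>). u s \<omega>) \<in> borel_measurable (?R \<Otimes>\<^sub>M F t)"
      using measurable_cong_sets[OF sets_pair_measure_cong[OF sets_R refl] refl] by blast
    then have "(\<lambda>(\<omega>, s). u s \<omega>) \<in> borel_measurable (F t \<Otimes>\<^sub>M ?R)"
      by (subst measurable_pair_swap_iff) simp
    then have "(\<lambda>\<omega>. \<integral>s. u s \<omega> \<partial>?R) \<in> borel_measurable (F t)"
      by (rule R.borel_measurable_lebesgue_integral)
    moreover have "(\<integral>s. u s \<omega> \<partial>?R) = a \<omega> t" for \<omega>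
    proof -
      have "(\<integral>s. u s \<omega> \<partial>?R) = (\<integral>s. indicator {0..t} s *\<^sub>R u s \<omega> \<partial>\<mu>)"
        using m by (intro integral_restrict_space) (simp add: sets.Int_space_eq2)
      also have "\<dots> = a \<omega> t"
        unfolding a_def by (rule Bochner_Integration.integral_cong) (auto simp: space_clock indicator_def)
      finally show ?thesis .
    qed
    ultimately show ?thesis by simp
  qed
  have "\<rho> \<in> times {0..T}"
  proof (rule timesI)
    show "stopping_time F \<rho>"
      unfolding stopping_time_def pred_def space_F
    proof
      fix t
      consider "t < 0" | "0 \<le> t" "t < T" | "T \<le> t" by linarith
      then show "{\<omega>\<in>space M. \<rho> \<omega> \<le> t} \<in> sets (F t)"
      proof cases
        case 1
        then have "{\<omega>\<in>space M. \<rho> \<omega> \<le> t} = {}" using range(1) by fastforce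
        then show ?thesis by (simp only: sets.empty_sets)
      next
        case 2
        have "N \<in> sets (F t)"
          using usual N(1) sets_F_mono[of 0 t] 2 by (auto simp: usual_conditions_def)
        moreover have "{\<omega>\<in>space M. c \<le> a \<omega> t} \<in> sets (F t)"
          using borel_measurable_le[OF measurable_const adapted[OF 2]] by (auto simp: space_F)
        moreover have "{\<omega>\<in>space M. \<rho> \<omega> \<le> t} = {\<omega>\<in>space M. c \<le> a \<omega> t} - N"
          using iff[OF _ 2] by auto
        ultimately show ?thesis by auto
      next
        case 3
        then have "{\<omega>\<in>space M. \<rho> \<omega> \<le> t} = space (F t)" using range(2) by (force simp: space_F)
        then show ?thesis by (simp only: sets.top)
      qed
    qed
  qed (use range in auto)
  moreover have "AE \<omega> in M. (\<forall>t<\<rho> \<omega>. a \<omega> t < c) \<and> a \<omega> (\<rho> \<omega>) \<le> c \<and> (\<rho> \<omega> < T \<longrightarrow> a \<omega> (\<rho> \<omega>) = c)"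
    using AE_not_in[OF N(1)] AE_space
  proof eventually_elim
    case (elim \<omega>)
    have neg: "a \<omega> t = 0" if "t < 0" for t
      unfolding a_def using that by (subst Bochner_Integration.integral_cong[where g="\<lambda>_. 0"]) (auto simp: space_clock)
    have lt: "a \<omega> t < c" if "t < \<rho> \<omega>" for t
    proof (cases "t < 0")
      case True
      then show ?thesis using neg c by simp
    next
      case False
      then show ?thesis using iff[of \<omega> t] range(2)[of \<omega>] elim that by auto
    qed
    have "(\<lambda>k. a \<omega> (\<rho> \<omega> - inverse (real (Suc k)))) \<longlonglongrightarrow> a \<omega> (\<rho> \<omega>)"
    proof -
      have "(\<lambda>k. \<rho> \<omega> - inverse (real (Suc k))) \<longlonglongrightarrow> \<rho> \<omega> - 0"
        by (intro tendsto_intros LIMSEQ_inverse_real_of_nat)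
      then show ?thesis
        unfolding a_def using upto_tendsto[OF good[OF elim(2,1)]] by simp
    qed
    then have le: "a \<omega> (\<rho> \<omega>) \<le> c"
      by (rule LIMSEQ_le_const2) (auto intro!: exI[of _ 0] less_imp_le lt simp del: of_nat_Suc)
    moreover have "a \<omega> (\<rho> \<omega>) = c" if "\<rho> \<omega> < T"
      using iff[of \<omega> "\<rho> \<omega>"] range(1)[of \<omega>] elim that le by auto
    ultimately show ?case using lt by auto
  qed
  ultimately show ?thesis using that unfolding a_def by blast
qed

end

section \<open>Implementation in continuous time\<close>

text \<open>
  Truncation at \<open>\<rho>\<close> preserves separation if the clock is running just before \<open>\<rho>\<close>, since then
  truncating at \<open>\<rho>\<close> never ends an interval in which the clock stands still.
\<close>

lemma (in clock) separated_min:
  assumes \<tau>: "\<And>i. i \<in> {1..n} \<Longrightarrow> \<tau> i \<in> times {0..T}" and sep: "separated n \<tau>"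
    and \<rho>: "\<rho> \<in> times {0..T}"
    and active: "AE \<omega> in M. \<rho> \<omega> < T \<longrightarrow> (\<forall>t\<in>{0..<\<rho> \<omega>}. emeasure \<mu> {t<..\<rho> \<omega>} \<noteq> 0)"
  shows "separated n (\<lambda>i \<omega>. min (\<tau> i \<omega>) (\<rho> \<omega>))"
  unfolding separated_def
proof (intro ballI impI)
  let ?t = "\<lambda>i \<omega>. min (\<tau> i \<omega>) (\<rho> \<omega>)"
  fix k B assume k: "k \<in> {1..<n}" and B: "B \<in> sets (pre_sigma (?t k))"
    and AEB: "AE \<omega> in M. \<omega> \<in> B \<longrightarrow> ?t k \<omega> < ?t (Suc k) \<omega> \<and> emeasure \<mu> {?t k \<omega><..?t (Suc k) \<omega>} = 0"
  have S: "\<tau> k \<in> times {0..T}" "\<tau> (Suc k) \<in> times {0..T}" using \<tau> k by auto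
  have S': "?t k \<in> times {0..T}" "?t (Suc k) \<in> times {0..T}" using times_min S \<rho> by auto
  \<comment> \<open>Where the truncated times differ, \<open>\<tau> k\<close> precedes \<open>\<rho>\<close>, and the event is known at \<open>\<tau> k\<close>.\<close>
  let ?B = "B \<inter> {\<omega>\<in>space M. ?t k \<omega> < ?t (Suc k) \<omega>}"
  have B': "?B \<in> sets (pre_sigma (?t k))" using B less_pre_sigma[OF S'] by auto
  have B\<tau>: "?B \<in> sets (pre_sigma (\<tau> k))"
    by (rule pre_sigma_local[OF S'(1) S(1) B']) auto
  have "AE \<omega> in M. \<omega> \<in> ?B \<longrightarrow> \<tau> k \<omega> < \<tau> (Suc k) \<omega> \<and> emeasure \<mu> {\<tau> k \<omega><..\<tau> (Suc k) \<omega>} = 0"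
    using AEB active AE_space
  proof eventually_elim
    case (elim \<omega>)
    show ?case
    proof
      assume "\<omega> \<in> ?B"
      then have b: "\<tau> k \<omega> < \<rho> \<omega>" "\<tau> k \<omega> < \<tau> (Suc k) \<omega>" "emeasure \<mu> {\<tau> k \<omega><..?t (Suc k) \<omega>} = 0"
        using elim(1) by (auto simp: min_def split: if_splits)
      have "0 \<le> \<tau> k \<omega>" "\<tau> (Suc k) \<omega> \<le> T"
        using timesD(3)[OF S(1)] timesD(4)[OF S(2)] elim(3) by auto
      have "\<tau> (Suc k) \<omega> \<le> \<rho> \<omega>"
      proof (rule ccontr)
        assume "\<not> \<tau> (Suc k) \<omega> \<le> \<rho> \<omega>"
        with b \<open>\<tau> (Suc k) \<omega> \<le> T\<close> have "\<rho> \<omega> < T" "emeasure \<mu> {\<tau> k \<omega><..\<rho> \<omega>} = 0" by (auto simp: min_def)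
        with elim(2) b \<open>0 \<le> \<tau> k \<omega>\<close> show False by auto
      qed
      with b show "\<tau> k \<omega> < \<tau> (Suc k) \<omega> \<and> emeasure \<mu> {\<tau> k \<omega><..\<tau> (Suc k) \<omega>} = 0"
        by (simp add: min_def)
    qed
  qed
  then have "emeasure M ?B = 0" using sep k B\<tau> unfolding separated_def by blast
  then have "AE \<omega> in M. \<omega> \<notin> ?B"
    using pre_sigma_into_M[OF S(1) B\<tau>] by (intro AE_I[of _ _ ?B]) auto
  with AEB AE_space have "AE \<omega> in M. \<omega> \<notin> B" by eventually_elim auto
  then show "emeasure M B = 0"
    using pre_sigma_into_M[OF S'(1) B] by (subst (asm) AE_iff_measurable[of B]) (auto dest: sets.sets_into_space)
qed

text \<open>
  After \<open>\<rho>\<close>, when all agents have stopped, the wage must be at least \<open>f n\<close> to keep them from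
  working; taking the positive part bounds the value of the contract from below.
\<close>

definition capped_wage ::
    "nat \<Rightarrow> (nat \<Rightarrow> real \<Rightarrow> 'a \<Rightarrow> real) \<Rightarrow> (nat \<Rightarrow> 'a \<Rightarrow> real) \<Rightarrow> ('a \<Rightarrow> real) \<Rightarrow> real \<Rightarrow> 'a \<Rightarrow> real" where
  "capped_wage n f \<tau> \<rho> s \<omega> = of_bool (s \<le> \<rho> \<omega>) * marginal_wage n f (\<lambda>i \<omega>. min (\<tau> i \<omega>) (\<rho> \<omega>)) s \<omega>
     + of_bool (\<rho> \<omega> < s) * max 0 (f n s \<omega>)"

lemma marginal_wage_abs_le:
  "\<bar>marginal_wage n f \<tau> s \<omega>\<bar> \<le> \<bar>f 1 s \<omega>\<bar> + (\<Sum>k\<in>{1..<n}. \<bar>f (Suc k) s \<omega>\<bar> + \<bar>f k s \<omega>\<bar>)"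
proof -
  have "\<bar>\<Sum>k\<in>{1..<n}. of_bool (\<tau> (Suc k) \<omega> < s) * (f (Suc k) s \<omega> - f k s \<omega>)\<bar>
      \<le> (\<Sum>k\<in>{1..<n}. \<bar>f (Suc k) s \<omega>\<bar> + \<bar>f k s \<omega>\<bar>)"
    by (rule order_trans[OF sum_abs]) (auto intro!: sum_mono)
  then show ?thesis unfolding marginal_wage_def by linarith
qed

context principal_agent begin

lemma capped_wage_rate:
  assumes "\<And>i. i \<in> {1..n} \<Longrightarrow> \<tau> i \<in> times {0..T}" "\<rho> \<in> times {0..T}"
  shows "A.rate (capped_wage n f \<tau> \<rho>)"
proof -
  have w: "A.rate (marginal_wage n f (\<lambda>i \<omega>. min (\<tau> i \<omega>) (\<rho> \<omega>)))"
    using assms times_min by (intro marginal_wage_rate) blast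
  have fn: "A.rate (f n)" using n_pos by (intro f_rate) auto
  have "A.rate (\<lambda>s \<omega>. max 0 (f n s \<omega>))"
    by (rule A.rate_bound[OF fn]) (use A.rate_measurable[OF fn] in \<open>auto simp: case_prod_beta'\<close>)
  then show ?thesis
    unfolding capped_wage_def using assms(2)
    by (intro A.rate_add A.rate_cut w timesD(2))
qed

text \<open>
  Off the prescribed times this contract pays a constant so low that nobody stops there: up to
  \<open>\<rho>\<close> the agents lose at most \<open>c\<close> by continuing, and after \<open>\<rho>\<close> the capped wage compensates
  them for losses. At the prescribed times it pays the conditional expectation of what is to come.
\<close>

lemma capped_implementation:
  assumes D: "D = {0..T}" and \<xi>T: "\<xi> \<in> borel_measurable (F T)"
    and \<tau>: "\<tau> \<in> A.chains D n" and c: "0 < c" and \<rho>: "\<rho> \<in> times {0..T}"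
    and budget: "AE \<omega> in M. (\<integral>s. of_bool (s \<le> \<rho> \<omega>) * (\<Sum>i=1..n. \<bar>f i s \<omega>\<bar>) \<partial>\<mu>A) \<le> c"
    and active: "AE \<omega> in M. \<rho> \<omega> < T \<longrightarrow> (\<forall>t\<in>{0..<\<rho> \<omega>}. emeasure \<mu>A {t<..\<rho> \<omega>} \<noteq> 0)"
  defines "\<tau>' \<equiv> \<lambda>i \<omega>. min (\<tau> i \<omega>) (\<rho> \<omega>)"
  shows "\<exists>Y \<in> contracts M F T \<xi>.
    (\<forall>i\<in>{1..n}. smallest_optimal M (times D) (agent_payoff M \<mu>A (f i) Y) (\<tau>' i)) \<and>
    principal_payoff M n \<mu>P g Y \<tau>' = (\<Sum>i=1..n. (\<integral>\<omega>. (LINT s:{0..\<tau>' i \<omega>}|\<mu>P. g i s \<omega>) \<partial>M)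
      - (\<integral>\<omega>. (LINT s:{\<tau>' i \<omega><..T}|\<mu>A. capped_wage n f \<tau> \<rho> s \<omega>) + max (\<xi> \<omega>) (- c) \<partial>M))"
proof -
  let ?w = "marginal_wage n f \<tau>'"
  let ?\<psi> = "capped_wage n f \<tau> \<rho>"
  define \<zeta> where "\<zeta> \<omega> = max (\<xi> \<omega>) (- c)" for \<omega>
  \<comment> \<open>The terminal payment and the wage up to \<open>\<rho>\<close> are worth at least \<open>- c\<close> each; one unit is the penalty.\<close>
  define L where "L = 2 * c + 1"
  have S: "\<tau> i \<in> times {0..T}" if "i \<in> {1..n}" for i using chainsD(1)[OF \<tau> that] D by simp
  have S': "\<tau>' i \<in> times {0..T}" if "i \<in> {1..n}" for i
    unfolding \<tau>'_def by (rule times_min[OF S[OF that] \<rho>])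
  have ord: "A.ordered n \<tau>'"
    unfolding \<tau>'_def A.ordered_def
    by (intro allI impI ballI min.mono A.orderedD[OF chainsD(2)[OF \<tau>]] order_refl)
  have chain: "\<tau>' \<in> A.chains D n"
    using S' ord A.separated_min[OF S chainsD(3)[OF \<tau>] \<rho> active] D
    unfolding A.chains_def \<tau>'_def by auto
  have \<psi>: "A.rate ?\<psi>" by (rule capped_wage_rate[OF S \<rho>])
  have \<psi>_before: "?\<psi> s \<omega> = ?w s \<omega>" if "s \<le> \<rho> \<omega>" for s \<omega>
    using that by (simp add: capped_wage_def \<tau>'_def)
  have \<psi>_after: "?\<psi> s \<omega> = max 0 (f n s \<omega>)" if "\<rho> \<omega> < s" for s \<omega>
    using that by (simp add: capped_wage_def)
  have \<zeta>_int: "integrable M \<zeta>" unfolding \<zeta>_def using \<xi>_integrable by auto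
  define U where "U t \<omega> = (LINT s:{t<..T}|\<mu>A. ?\<psi> s \<omega>) + \<zeta> \<omega>" for t \<omega>
  have U_int: "integrable M (\<lambda>\<omega>. U (\<sigma> \<omega>) \<omega>)" if "\<sigma> \<in> times {0..T}" for \<sigma>
    unfolding U_def using A.after_integrable[OF \<psi> that] \<zeta>_int by auto
  have f_abs: "A.rate (\<lambda>s \<omega>. \<Sum>i=1..n. \<bar>f i s \<omega>\<bar>)" by (intro A.rate_sum A.rate_abs f_rate)
  have U_low: "AE \<omega> in M. \<forall>t\<in>{0..T}. - 2 * c \<le> U t \<omega>"
    using budget A.rate_AE[OF f_abs] A.rate_AE[OF \<psi>] AE_space
  proof eventually_elim
    case (elim \<omega>)
    show ?case
    proof
      fix t assume t: "t \<in> {0..T}"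
      have "- of_bool (s \<le> \<rho> \<omega>) * (\<Sum>i=1..n. \<bar>f i s \<omega>\<bar>) \<le> of_bool (t < s) * ?\<psi> s \<omega>"
        if s: "s \<in> {0..T}" for s
      proof (cases "s \<le> \<rho> \<omega>")
        case True
        have "f 1 s \<omega> \<le> ?w s \<omega>"
          unfolding marginal_wage_def using f_le[OF _ _ _ s elim(4)] by (auto intro!: sum_nonneg)
        moreover have "\<bar>f 1 s \<omega>\<bar> \<le> (\<Sum>i=1..n. \<bar>f i s \<omega>\<bar>)"
          using n_pos by (intro member_le_sum) auto
        ultimately show ?thesis using True \<psi>_before[of s \<omega>] by (auto simp: of_bool_def)
      next
        case False
        then show ?thesis using \<psi>_after[of \<omega> s] by (auto simp: of_bool_def)
      qed
      then have "(\<integral>s. - of_bool (s \<le> \<rho> \<omega>) * (\<Sum>i=1..n. \<bar>f i s \<omega>\<bar>) \<partial>\<mu>A) \<le> (\<integral>s. of_bool (t < s) * ?\<psi> s \<omega> \<partial>\<mu>A)"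
        using A.integrable_cut(1)[OF elim(2), of "\<rho> \<omega>"] A.integrable_cut(2)[OF elim(3), of t]
        by (intro integral_mono) (auto simp: A.space_clock)
      then have "- c \<le> (\<integral>s. of_bool (t < s) * ?\<psi> s \<omega> \<partial>\<mu>A)" using elim(1) by simp
      then show "- 2 * c \<le> U t \<omega>"
        using t A.set_integral_after[of t "\<lambda>s. ?\<psi> s \<omega>"] by (simp add: U_def \<zeta>_def)
    qed
  qed
  \<comment> \<open>The terminal date is treated as the time \<open>\<theta> (n + 1)\<close> of the chain.\<close>
  define K where "K = {1..Suc n}"
  define \<theta> where "\<theta> k \<omega> = (if k \<le> n then \<tau>' k \<omega> else T)" for k \<omega>
  have \<theta>: "\<theta> k \<in> times {0..T}" if "k \<in> K" for k
    using S'[of k] times_T[of "{0..T}"] T_pos that by (cases "k \<le> n") (auto simp: \<theta>_def[abs_def] K_def)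
  have \<theta>_mono: "\<theta> j \<omega> \<le> \<theta> k \<omega>" if "j \<in> K" "j \<le> k" "k \<in> K" "\<omega> \<in> space M" for j k \<omega>
    using that A.orderedD[OF ord, of j k \<omega>] timesD(4)[OF \<theta>[OF that(1)] that(4)]
    by (auto simp: \<theta>_def K_def)
  have \<theta>_stops: "stops \<tau>' \<omega> = (\<lambda>k. \<theta> k \<omega>) ` K" for \<omega>
  proof -
    have "K = insert (Suc n) {1..n}" by (auto simp: K_def)
    moreover have "(\<lambda>k. \<theta> k \<omega>) ` {1..n} = (\<lambda>k. \<tau>' k \<omega>) ` {1..n}"
      by (rule image_cong) (auto simp: \<theta>_def)
    moreover have "\<theta> (Suc n) \<omega> = T" by (simp add: \<theta>_def)
    ultimately show ?thesis by (simp add: stops_def)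
  qed
  define last where "last k \<omega> \<longleftrightarrow> (k \<le> n \<longrightarrow> \<theta> k \<omega> < \<theta> (Suc k) \<omega>)" for k \<omega>
  \<comment> \<open>The maximum changes a null set only and makes the peaks \<open>z\<close> nonnegative everywhere.\<close>
  define y where "y k \<omega> = max (- 2 * c) (real_cond_exp M (pre_sigma (\<theta> k)) (\<lambda>\<omega>. U (\<theta> k \<omega>) \<omega>) \<omega>)" for k \<omega>
  define z where "z k \<omega> = of_bool (last k \<omega>) * (y k \<omega> + L)" for k \<omega>
  define Y where "Y t \<omega> = - L + (\<Sum>k\<in>K. if t = \<theta> k \<omega> then z k \<omega> else 0)" for t \<omega>
  have last_sets: "{\<omega>\<in>space M. last k \<omega>} \<in> sets (pre_sigma (\<theta> k))" if k: "k \<in> K" for k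
  proof (cases "k \<le> n")
    case True
    then show ?thesis using less_pre_sigma[OF \<theta>[OF k] \<theta>[of "Suc k"]] by (simp add: last_def K_def)
  next
    case False
    then show ?thesis using sets.top[of "pre_sigma (\<theta> k)"] by (simp add: last_def space_pre_sigma)
  qed
  have y_meas: "y k \<in> borel_measurable (pre_sigma (\<theta> k))" for k
    unfolding y_def[abs_def] by (intro borel_measurable_max borel_measurable_const borel_measurable_cond_exp)
  have z_meas: "z k \<in> borel_measurable (pre_sigma (\<theta> k))" if "k \<in> K" for k
  proof -
    have "Measurable.pred (pre_sigma (\<theta> k)) (last k)"
      using last_sets[OF that] by (simp add: pred_def space_pre_sigma)
    then show ?thesis unfolding z_def[abs_def] using y_meas[of k] by measurable
  qed
  have y_int: "integrable M (y k)" if "k \<in> K" for k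
    unfolding y_def[abs_def]
    using real_cond_exp_integrable[OF subalgebra_pre_sigma[OF \<theta>[OF that]] U_int[OF \<theta>[OF that]]] by auto
  have y_AE: "AE \<omega> in M. y k \<omega> = real_cond_exp M (pre_sigma (\<theta> k)) (\<lambda>\<omega>. U (\<theta> k \<omega>) \<omega>) \<omega>"
    if k: "k \<in> K" for k
  proof -
    interpret sub: finite_measure_subalgebra M "pre_sigma (\<theta> k)"
      by unfold_locales (rule subalgebra_pre_sigma[OF \<theta>[OF k]])
    have "AE \<omega> in M. - 2 * c \<le> U (\<theta> k \<omega>) \<omega>"
      using U_low AE_space by eventually_elim (use timesD(3,4)[OF \<theta>[OF k]] in auto)
    from sub.real_cond_exp_ge_c[OF U_int[OF \<theta>[OF k]] this]
    show ?thesis by eventually_elim (simp add: y_def)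
  qed
  have y_low: "- 2 * c \<le> y k \<omega>" for k \<omega> by (simp add: y_def)
  have z_int: "integrable M (z k)" if k: "k \<in> K" for k
  proof (rule Bochner_Integration.integrable_bound)
    show "integrable M (\<lambda>\<omega>. y k \<omega> + L)" using y_int[OF k] by auto
    show "z k \<in> borel_measurable M"
      using measurable_from_subalg[OF subalgebra_pre_sigma[OF \<theta>[OF k]] z_meas[OF k]] .
  qed (auto simp: z_def)
  have z_nonneg: "0 \<le> z k \<omega>" for k \<omega> using y_low[of k \<omega>] c by (auto simp: z_def L_def)
  have Y_eq: "Y = (\<lambda>t \<omega>. - L + (\<Sum>k\<in>K. if t = \<theta> k \<omega> then z k \<omega> else 0))" by (simp add: Y_def fun_eq_iff)
  have finK: "finite K" by (simp add: K_def)
  note peaks = peaks_contract[where K=K and \<sigma>=\<theta> and z=z and L="- L", OF finK \<theta> z_meas z_int z_nonneg, folded Y_eq]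
  have Y_int: "integrable M (\<lambda>\<omega>. Y (\<sigma> \<omega>) \<omega>)" if "\<sigma> \<in> times {0..T}" for \<sigma>
    unfolding Y_def by (rule peaks(4)) (use that in auto)
  \<comment> \<open>Every prescribed time is \<open>\<theta> k\<close> for exactly one \<open>k\<close> that is last.\<close>
  have only: "(if \<theta> k \<omega> = \<theta> j \<omega> then of_bool (last j \<omega>) * x else 0) = (if j = k then x else 0)"
    if k: "k \<in> K" "last k \<omega>" and j: "j \<in> K" and \<omega>: "\<omega> \<in> space M" for j k \<omega> and x :: real
  proof -
    have "\<not> (\<theta> k \<omega> = \<theta> j \<omega> \<and> last j \<omega>)" if "j \<noteq> k"
    proof (cases "j < k")
      case True
      then have "\<theta> (Suc j) \<omega> \<le> \<theta> k \<omega>" "j \<le> n" using \<theta>_mono[of "Suc j" k \<omega>] j k \<omega> by (auto simp: K_def)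
      then show ?thesis by (auto simp: last_def)
    next
      case False
      then have "\<theta> (Suc k) \<omega> \<le> \<theta> j \<omega>" "k \<le> n" using that \<theta>_mono[of "Suc k" j \<omega>] j k \<omega> by (auto simp: K_def)
      then show ?thesis using k(2) by (auto simp: last_def)
    qed
    then show ?thesis using k(2) by auto
  qed
  have ex_last: "\<exists>k\<in>K. t = \<theta> k \<omega> \<and> last k \<omega>" if t: "t \<in> stops \<tau>' \<omega>" and \<omega>: "\<omega> \<in> space M" for t \<omega>
  proof -
    let ?I = "{k\<in>K. \<theta> k \<omega> = t}"
    have I: "finite ?I" "?I \<noteq> {}" using t finK by (auto simp: \<theta>_stops)
    define k where "k = Max ?I"
    have k: "k \<in> K" "\<theta> k \<omega> = t" using Max_in[OF I] by (auto simp: k_def)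
    have "last k \<omega>"
      unfolding last_def
    proof
      assume "k \<le> n"
      then have K': "Suc k \<in> K" by (simp add: K_def)
      then have "\<theta> (Suc k) \<omega> \<noteq> t" using Max_ge[OF I(1), of "Suc k"] by (auto simp: k_def)
      then show "\<theta> k \<omega> < \<theta> (Suc k) \<omega>" using \<theta>_mono[OF k(1) _ K' \<omega>] k(2) by auto
    qed
    with k show ?thesis by auto
  qed
  have Y_exp: "(\<integral>\<omega>. Y (\<sigma> \<omega>) \<omega> \<partial>M) = (\<integral>\<omega>. (if \<sigma> \<omega> \<in> stops \<tau>' \<omega> then U (\<sigma> \<omega>) \<omega> else - L) \<partial>M)"
    if \<sigma>: "\<sigma> \<in> times {0..T}" for \<sigma>
  proof -
    define B where "B k = {\<omega>\<in>space M. \<theta> k \<omega> = \<sigma> \<omega>} \<inter> {\<omega>\<in>space M. last k \<omega>}" for k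
    have B: "B k \<in> sets (pre_sigma (\<theta> k))" if "k \<in> K" for k
      unfolding B_def by (intro sets.Int coincidence_pre_sigma[OF \<theta>[OF that] \<sigma>] last_sets[OF that])
    have BM: "B k \<in> sets M" if "k \<in> K" for k by (rule pre_sigma_into_M[OF \<theta>[OF that] B[OF that]])
    have ind_int: "integrable M (\<lambda>\<omega>. indicator (B k) \<omega> * X \<omega>)" if "k \<in> K" "integrable M X"
      for k and X :: "'a \<Rightarrow> real"
      using integrable_mult_indicator[OF BM[OF that(1)] that(2)] by simp
    have "(\<integral>\<omega>. Y (\<sigma> \<omega>) \<omega> \<partial>M) = (\<integral>\<omega>. - L + (\<Sum>k\<in>K. indicator (B k) \<omega> * (y k \<omega> + L)) \<partial>M)"
      unfolding Y_def z_def by (intro Bochner_Integration.integral_cong refl arg_cong2[where f="(+)"] sum.cong)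
        (auto simp: B_def indicator_def)
    also have "\<dots> = - L + (\<Sum>k\<in>K. \<integral>\<omega>. indicator (B k) \<omega> * (y k \<omega> + L) \<partial>M)"
      using ind_int y_int by (simp add: prob_space)
    also have "\<dots> = - L + (\<Sum>k\<in>K. \<integral>\<omega>. indicator (B k) \<omega> * (U (\<theta> k \<omega>) \<omega> + L) \<partial>M)"
    proof (intro arg_cong2[where f="(+)"] refl sum.cong)
      fix k assume k: "k \<in> K"
      note sub = subalgebra_pre_sigma[OF \<theta>[OF k]]
      let ?E = "real_cond_exp M (pre_sigma (\<theta> k)) (\<lambda>\<omega>. U (\<theta> k \<omega>) \<omega>)"
      have E: "integrable M ?E" by (rule real_cond_exp_integrable[OF sub U_int[OF \<theta>[OF k]]])
      have "(\<integral>\<omega>. indicator (B k) \<omega> * (y k \<omega> + L) \<partial>M) = (\<integral>\<omega>. indicator (B k) \<omega> * (?E \<omega> + L) \<partial>M)"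
        using ind_int[OF k, of "\<lambda>\<omega>. y k \<omega> + L"] ind_int[OF k, of "\<lambda>\<omega>. ?E \<omega> + L"] y_int[OF k] E y_AE[OF k]
        by (intro integral_cong_AE) (auto intro: borel_measurable_integrable elim!: eventually_mono)
      also have "\<dots> = (\<integral>\<omega>. indicator (B k) \<omega> * (U (\<theta> k \<omega>) \<omega> + L) \<partial>M)"
        using real_cond_exp_expectation[OF sub U_int[OF \<theta>[OF k]] B[OF k]]
          ind_int[OF k E] ind_int[OF k U_int[OF \<theta>[OF k]]] ind_int[OF k, of "\<lambda>_. L"]
        by (simp add: ring_distribs)
      finally show "(\<integral>\<omega>. indicator (B k) \<omega> * (y k \<omega> + L) \<partial>M) = (\<integral>\<omega>. indicator (B k) \<omega> * (U (\<theta> k \<omega>) \<omega> + L) \<partial>M)" .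
    qed
    also have "\<dots> = (\<integral>\<omega>. - L + (\<Sum>k\<in>K. indicator (B k) \<omega> * (U (\<theta> k \<omega>) \<omega> + L)) \<partial>M)"
      using ind_int U_int[OF \<theta>] by (simp add: prob_space)
    also have "\<dots> = (\<integral>\<omega>. (if \<sigma> \<omega> \<in> stops \<tau>' \<omega> then U (\<sigma> \<omega>) \<omega> else - L) \<partial>M)"
    proof (rule Bochner_Integration.integral_cong[OF refl])
      fix \<omega> assume \<omega>: "\<omega> \<in> space M"
      show "- L + (\<Sum>k\<in>K. indicator (B k) \<omega> * (U (\<theta> k \<omega>) \<omega> + L)) = (if \<sigma> \<omega> \<in> stops \<tau>' \<omega> then U (\<sigma> \<omega>) \<omega> else - L)"
      proof (cases "\<sigma> \<omega> \<in> stops \<tau>' \<omega>")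
        case True
        from ex_last[OF this \<omega>] obtain k where k: "k \<in> K" "\<sigma> \<omega> = \<theta> k \<omega>" "last k \<omega>" by auto
        have "(\<Sum>j\<in>K. indicator (B j) \<omega> * (U (\<theta> j \<omega>) \<omega> + L)) = (\<Sum>j\<in>K. if j = k then U (\<theta> j \<omega>) \<omega> + L else 0)"
          using only[OF k(1,3) _ \<omega>] k \<omega> by (intro sum.cong refl) (force simp: B_def indicator_def)
        then show ?thesis using True k finK by simp
      next
        case False
        then have "\<omega> \<notin> B k" if "k \<in> K" for k using that by (auto simp: B_def \<theta>_stops image_iff)
        then show ?thesis using False by simp
      qed
    qed
    finally show ?thesis .
  qed
  have Y_le: "(\<integral>\<omega>. Y (\<sigma> \<omega>) \<omega> \<partial>M) \<le> (\<integral>\<omega>. (LINT s:{\<sigma> \<omega><..T}|\<mu>A. ?\<psi> s \<omega>) + \<zeta> \<omega> \<partial>M)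
      - prob {\<omega>\<in>space M. \<sigma> \<omega> \<notin> stops \<tau>' \<omega>}" if \<sigma>: "\<sigma> \<in> times {0..T}" for \<sigma>
  proof -
    have off: "integrable M (\<lambda>\<omega>. of_bool (\<sigma> \<omega> \<notin> stops \<tau>' \<omega>) :: real)"
      "(\<integral>\<omega>. of_bool (\<sigma> \<omega> \<notin> stops \<tau>' \<omega>) \<partial>M) = prob {\<omega>\<in>space M. \<sigma> \<omega> \<notin> stops \<tau>' \<omega>}"
      using S' timesD(2)[OF \<sigma>] by (rule off_stops_integral, simp)+
    let ?H = "\<lambda>\<omega>. if \<sigma> \<omega> \<in> stops \<tau>' \<omega> then U (\<sigma> \<omega>) \<omega> else - L"
    have "?H = (\<lambda>\<omega>. U (\<sigma> \<omega>) \<omega> - of_bool (\<sigma> \<omega> \<notin> stops \<tau>' \<omega>) * (U (\<sigma> \<omega>) \<omega> + L))" by auto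
    moreover have "integrable M (\<lambda>\<omega>. of_bool (\<sigma> \<omega> \<notin> stops \<tau>' \<omega>) * (U (\<sigma> \<omega>) \<omega> + L))"
    proof (rule Bochner_Integration.integrable_bound)
      show "integrable M (\<lambda>\<omega>. U (\<sigma> \<omega>) \<omega> + L)" using U_int[OF \<sigma>] by auto
      show "(\<lambda>\<omega>. of_bool (\<sigma> \<omega> \<notin> stops \<tau>' \<omega>) * (U (\<sigma> \<omega>) \<omega> + L)) \<in> borel_measurable M"
        using off(1) U_int[OF \<sigma>] by (intro borel_measurable_times borel_measurable_add) auto
    qed auto
    ultimately have H_int: "integrable M ?H" using U_int[OF \<sigma>] by auto
    have "(\<integral>\<omega>. ?H \<omega> \<partial>M) \<le> (\<integral>\<omega>. U (\<sigma> \<omega>) \<omega> - of_bool (\<sigma> \<omega> \<notin> stops \<tau>' \<omega>) \<partial>M)"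
    proof (rule integral_mono_AE)
      show "AE \<omega> in M. ?H \<omega> \<le> U (\<sigma> \<omega>) \<omega> - of_bool (\<sigma> \<omega> \<notin> stops \<tau>' \<omega>)"
        using U_low AE_space
      proof eventually_elim
        case (elim \<omega>)
        then have "- 2 * c \<le> U (\<sigma> \<omega>) \<omega>" using timesD(3,4)[OF \<sigma>] by auto
        then show ?case by (simp add: L_def)
      qed
    qed (use H_int U_int[OF \<sigma>] off in auto)
    then show ?thesis using Y_exp[OF \<sigma>] U_int[OF \<sigma>] off by (simp add: U_def)
  qed
  have Y_eq': "(\<integral>\<omega>. Y (\<tau>' i \<omega>) \<omega> \<partial>M) = (\<integral>\<omega>. (LINT s:{\<tau>' i \<omega><..T}|\<mu>A. ?\<psi> s \<omega>) + \<zeta> \<omega> \<partial>M)"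
    if i: "i \<in> {1..n}" for i
    using Y_exp[OF S'[OF i]] i by (simp add: stops_def U_def)
  have contract: "Y \<in> contracts M F T \<xi>"
  proof -
    have "AE \<omega> in M. \<xi> \<omega> \<le> Y T \<omega>"
    proof -
      have K': "Suc n \<in> K" "\<theta> (Suc n) = (\<lambda>_. T)" by (auto simp: K_def \<theta>_def)
      note t = \<theta>[OF K'(1)]
      interpret sub: finite_measure_subalgebra M "pre_sigma (\<theta> (Suc n))"
        by unfold_locales (rule subalgebra_pre_sigma[OF t])
      have UT: "U T = \<zeta>" by (simp add: U_def fun_eq_iff set_lebesgue_integral_def)
      have "\<zeta> \<in> borel_measurable (pre_sigma (\<lambda>_. T))"
      proof (rule measurableI)
        fix X :: "real set" assume X: "X \<in> sets borel"
        have "\<zeta> \<in> borel_measurable (F T)" unfolding \<zeta>_def[abs_def] using \<xi>T by auto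
        then have *: "\<zeta> -` X \<inter> space M \<in> sets (F T)" using measurable_sets[OF _ X] space_F by metis
        show "\<zeta> -` X \<inter> space (pre_sigma (\<lambda>_. T)) \<in> sets (pre_sigma (\<lambda>_. T))"
        proof (rule sets_pre_sigmaI[OF stopping_time_const])
          fix t
          show "{\<omega> \<in> \<zeta> -` X \<inter> space (pre_sigma (\<lambda>_. T)). T \<le> t} \<in> sets (F t)"
          proof (cases "T \<le> t")
            case True
            then have "{\<omega> \<in> \<zeta> -` X \<inter> space (pre_sigma (\<lambda>_. T)). T \<le> t} = \<zeta> -` X \<inter> space M"
              by (auto simp: space_pre_sigma)
            then show ?thesis using * sets_F_mono[OF True] by (simp only: subset_iff)
          qed simp
        qed
      qed auto
      then have cond: "AE \<omega> in M. real_cond_exp M (pre_sigma (\<theta> (Suc n))) \<zeta> \<omega> = \<zeta> \<omega>"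
        using \<zeta>_int by (intro sub.real_cond_exp_F_meas) (auto simp: K')
      have YT: "Y T \<omega> = y (Suc n) \<omega>" if \<omega>: "\<omega> \<in> space M" for \<omega>
      proof -
        have l: "last (Suc n) \<omega>" by (simp add: last_def)
        have "(\<Sum>k\<in>K. if T = \<theta> k \<omega> then z k \<omega> else 0) = (\<Sum>k\<in>K. if k = Suc n then y k \<omega> + L else 0)"
        proof (rule sum.cong[OF refl])
          fix k assume "k \<in> K"
          from only[OF K'(1) l this \<omega>, unfolded K'(2)]
          show "(if T = \<theta> k \<omega> then z k \<omega> else 0) = (if k = Suc n then y k \<omega> + L else 0)"
            unfolding z_def .
        qed
        then show ?thesis using K' finK by (simp add: Y_def)
      qed
      show ?thesis
        using cond y_AE[OF K'(1)] AE_space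
      proof eventually_elim
        case (elim \<omega>)
        then have "Y T \<omega> = \<zeta> \<omega>" using UT K'(2) YT[of \<omega>] by simp
        then show ?case by (simp add: \<zeta>_def)
      qed
    qed
    then show ?thesis using peaks(1-3) by (simp add: contracts_def)
  qed
  have low: "?\<psi> s \<omega> \<le> f i s \<omega>" if "i \<in> {1..n}" "\<omega> \<in> space M" "s \<in> {0..T}" "s \<le> \<tau>' i \<omega>" for i s \<omega>
    using marginal_wage_low[OF ord that] \<psi>_before[of s \<omega>] that(4) by (simp add: \<tau>'_def)
  have high: "f i s \<omega> \<le> ?\<psi> s \<omega>" if "i \<in> {1..n}" "\<omega> \<in> space M" "s \<in> {0..T}" "\<tau>' i \<omega> < s" for i s \<omega>
    using marginal_wage_high[OF ord that] \<psi>_before[of s \<omega>] \<psi>_after[of \<omega> s] f_le[of i n s \<omega>] that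
    by (cases "s \<le> \<rho> \<omega>") auto
  have strict: "?\<psi> s \<omega> < f i s \<omega>" if "k \<in> {1..<n}" "k < i" "i \<le> n" "\<omega> \<in> space M" "s \<in> {0..T}"
      "\<tau>' k \<omega> < s" "s \<le> \<tau>' (Suc k) \<omega>" for i k s \<omega>
    using marginal_wage_less[OF ord that] \<psi>_before[of s \<omega>] that(7) by (simp add: \<tau>'_def)
  have opt: "smallest_optimal M (times D) (agent_payoff M \<mu>A (f i) Y) (\<tau>' i)" if "i \<in> {1..n}" for i
    using Y_int Y_le Y_eq'
    by (intro chain_implemented[OF chain _ \<psi> \<zeta>_int low high strict _ _ that]) (auto simp: D)
  have pay: "principal_payoff M n \<mu>P g Y \<tau>' = (\<Sum>i=1..n. (\<integral>\<omega>. (LINT s:{0..\<tau>' i \<omega>}|\<mu>P. g i s \<omega>) \<partial>M)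
      - (\<integral>\<omega>. (LINT s:{\<tau>' i \<omega><..T}|\<mu>A. ?\<psi> s \<omega>) + \<zeta> \<omega> \<partial>M))"
    using S' Y_int D by (subst principal_payoff_split) (auto simp: Y_eq')
  show ?thesis
    by (intro bexI[OF _ contract] conjI ballI opt) (auto simp: pay \<zeta>_def)
qed

end

lemma (in clock) cut_integral_abs_le:
  fixes v V :: "real \<Rightarrow> real"
  assumes v: "integrable \<mu> v" and V: "integrable \<mu> V" and le: "\<And>s. s \<in> {0..T} \<Longrightarrow> \<bar>v s\<bar> \<le> V s"
  shows "t \<le> T \<Longrightarrow> \<bar>LINT s:{0..t}|\<mu>. v s\<bar> \<le> (\<integral>s. V s \<partial>\<mu>)"
    "0 \<le> t \<Longrightarrow> \<bar>LINT s:{t<..T}|\<mu>. v s\<bar> \<le> (\<integral>s. V s \<partial>\<mu>)"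
proof -
  have *: "\<bar>\<integral>s. of_bool (P s) * v s \<partial>\<mu>\<bar> \<le> (\<integral>s. V s \<partial>\<mu>)"
    if "integrable \<mu> (\<lambda>s. of_bool (P s) * v s)" for P
  proof -
    have "\<bar>\<integral>s. of_bool (P s) * v s \<partial>\<mu>\<bar> \<le> (\<integral>s. \<bar>of_bool (P s) * v s\<bar> \<partial>\<mu>)"
      by (rule integral_abs_bound)
    also have "\<dots> \<le> (\<integral>s. V s \<partial>\<mu>)"
    proof (rule integral_mono)
      fix s assume "s \<in> space \<mu>"
      then have "\<bar>v s\<bar> \<le> V s" using le by (simp add: space_clock)
      then show "\<bar>of_bool (P s) * v s\<bar> \<le> V s" by (cases "P s") auto
    qed (use that V in auto)
    finally show ?thesis .
  qed
  show "t \<le> T \<Longrightarrow> \<bar>LINT s:{0..t}|\<mu>. v s\<bar> \<le> (\<integral>s. V s \<partial>\<mu>)"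
    using *[OF integrable_cut(1)[OF v]] by (simp add: set_integral_upto)
  show "0 \<le> t \<Longrightarrow> \<bar>LINT s:{t<..T}|\<mu>. v s\<bar> \<le> (\<integral>s. V s \<partial>\<mu>)"
    using *[OF integrable_cut(2)[OF v]] by (simp add: set_integral_after)
qed

lemma (in filtered_prob_space) expectation_tendsto_eventually:
  fixes X :: "nat \<Rightarrow> 'a \<Rightarrow> real"
  assumes "\<And>m. X m \<in> borel_measurable M" "Z \<in> borel_measurable M" "integrable M V"
    and "\<And>m. AE \<omega> in M. \<bar>X m \<omega>\<bar> \<le> V \<omega>"
    and "AE \<omega> in M. \<forall>\<^sub>F m in sequentially. X m \<omega> = Z \<omega>"
  shows "(\<lambda>m. \<integral>\<omega>. X m \<omega> \<partial>M) \<longlonglongrightarrow> (\<integral>\<omega>. Z \<omega> \<partial>M)"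
proof (rule integral_dominated_convergence[where w=V])
  show "AE \<omega> in M. (\<lambda>m. X m \<omega>) \<longlonglongrightarrow> Z \<omega>"
    using assms(5) by eventually_elim (rule tendsto_eventually)
qed (use assms in auto)

definition wage_bound :: "nat \<Rightarrow> (nat \<Rightarrow> real \<Rightarrow> 'a \<Rightarrow> real) \<Rightarrow> real \<Rightarrow> 'a \<Rightarrow> real" where
  "wage_bound n f s \<omega> = \<bar>f 1 s \<omega>\<bar> + (\<Sum>k\<in>{1..<n}. \<bar>f (Suc k) s \<omega>\<bar> + \<bar>f k s \<omega>\<bar>) + \<bar>f n s \<omega>\<bar>"

lemma (in principal_agent) wage_bound_rate: "A.rate (wage_bound n f)"
  unfolding wage_bound_def using n_pos by (intro A.rate_add A.rate_sum A.rate_abs f_rate) auto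

lemma marginal_wage_bound: "\<bar>marginal_wage n f \<tau> s \<omega>\<bar> \<le> wage_bound n f s \<omega>"
  using marginal_wage_abs_le[of n f \<tau> s \<omega>] unfolding wage_bound_def by linarith

lemma capped_wage_bound: "\<bar>capped_wage n f \<tau> \<rho> s \<omega>\<bar> \<le> wage_bound n f s \<omega>"
proof (cases "s \<le> \<rho> \<omega>")
  case True
  then show ?thesis using marginal_wage_bound by (simp add: capped_wage_def)
next
  case False
  have "0 \<le> (\<Sum>k\<in>{1..<n}. \<bar>f (Suc k) s \<omega>\<bar> + \<bar>f k s \<omega>\<bar>)" by (intro sum_nonneg) auto
  then show ?thesis using False by (simp add: capped_wage_def wage_bound_def)
qed

text \<open>
  As the budget grows, \<open>\<rho> = T\<close> from some point on for almost every \<open>\<omega>\<close>, so that truncating the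
  chain and the terminal payment costs nothing in the limit.
\<close>

lemma (in principal_agent) chain_value_le_continuous:
  assumes D: "D = {0..T}" and atomless: "atomless \<mu>A" and \<xi>T: "\<xi> \<in> borel_measurable (F T)"
    and prog: "\<And>i. i \<in> {1..n} \<Longrightarrow> progressively_measurable F T (f i)"
    and \<tau>: "\<tau> \<in> A.chains D n"
  shows "ereal (W \<tau>) \<le> V_P M F T n \<mu>A \<mu>P f g \<xi>"
proof -
  interpret AA: atomless_clock M F T \<mu>A by unfold_locales (rule atomless)
  have S: "\<tau> i \<in> times {0..T}" if "i \<in> {1..n}" for i using chainsD(1)[OF \<tau> that] D by simp
  let ?u = "\<lambda>s \<omega>. \<Sum>i=1..n. \<bar>f i s \<omega>\<bar>"
  let ?a = "\<lambda>\<omega> t. \<integral>s. of_bool (s \<le> t) * ?u s \<omega> \<partial>\<mu>A"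
  have u: "A.rate ?u" by (intro A.rate_sum A.rate_abs f_rate)
  have u_prog: "progressively_measurable F T ?u"
    unfolding progressively_measurable_def case_prod_beta'
  proof (intro ballI borel_measurable_sum borel_measurable_abs)
    fix t i assume "t \<in> {0..T}" "i \<in> {1..n}"
    then show "(\<lambda>z. f i (fst z) (snd z)) \<in> borel_measurable (restrict_space borel {0..t} \<Otimes>\<^sub>M F t)"
      using prog unfolding progressively_measurable_def case_prod_beta' by blast
  qed
  define spent where "spent m \<rho> \<longleftrightarrow> \<rho> \<in> times {0..T} \<and> (AE \<omega> in M. (\<forall>t<\<rho> \<omega>. ?a \<omega> t < real (Suc m)) \<and>
    ?a \<omega> (\<rho> \<omega>) \<le> real (Suc m) \<and> (\<rho> \<omega> < T \<longrightarrow> ?a \<omega> (\<rho> \<omega>) = real (Suc m)))" for m \<rho>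
  have "\<exists>\<rho>. spent m \<rho>" for m
    unfolding spent_def
  proof (rule AA.budget_time[OF u u_prog, of "real (Suc m)"])
    show "0 \<le> ?u s \<omega>" for s \<omega> by (intro sum_nonneg) simp
    show "0 < real (Suc m)" by simp
  qed (intro exI conjI)
  then obtain \<rho> where "\<And>m. spent m (\<rho> m)" by metis
  then have \<rho>: "\<And>m. \<rho> m \<in> times {0..T}"
    and \<rho>': "\<And>m. AE \<omega> in M. (\<forall>t<\<rho> m \<omega>. ?a \<omega> t < real (Suc m)) \<and>
       ?a \<omega> (\<rho> m \<omega>) \<le> real (Suc m) \<and> (\<rho> m \<omega> < T \<longrightarrow> ?a \<omega> (\<rho> m \<omega>) = real (Suc m))"
    unfolding spent_def by simp_all
  let ?\<tau> = "\<lambda>m i \<omega>. min (\<tau> i \<omega>) (\<rho> m \<omega>)"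
  let ?P = "\<lambda>m. \<Sum>i=1..n. (\<integral>\<omega>. (LINT s:{0..?\<tau> m i \<omega>}|\<mu>P. g i s \<omega>) \<partial>M)
      - (\<integral>\<omega>. (LINT s:{?\<tau> m i \<omega><..T}|\<mu>A. capped_wage n f \<tau> (\<rho> m) s \<omega>) + max (\<xi> \<omega>) (- real (Suc m)) \<partial>M)"
  have S': "?\<tau> m i \<in> times {0..T}" if "i \<in> {1..n}" for m i
    by (rule times_min[OF S[OF that] \<rho>])
  have below: "ereal (?P m) \<le> V_P M F T n \<mu>A \<mu>P f g \<xi>" for m
  proof -
    have "AE \<omega> in M. \<rho> m \<omega> < T \<longrightarrow> (\<forall>t\<in>{0..<\<rho> m \<omega>}. emeasure \<mu>A {t<..\<rho> m \<omega>} \<noteq> 0)"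
      using \<rho>'[of m] A.rate_AE[OF u] AE_space
    proof eventually_elim
      case (elim \<omega>)
      show ?case
      proof (intro impI ballI notI)
        fix t assume lt: "\<rho> m \<omega> < T" and t: "t \<in> {0..<\<rho> m \<omega>}" and null: "emeasure \<mu>A {t<..\<rho> m \<omega>} = 0"
        have "(LINT s:{0..\<rho> m \<omega>}|\<mu>A. ?u s \<omega>) = (LINT s:{0..t}|\<mu>A. ?u s \<omega>) + (LINT s:{t<..\<rho> m \<omega>}|\<mu>A. ?u s \<omega>)"
          using A.set_integral_split(1)[OF elim(2), of t "\<rho> m \<omega>"] t lt by auto
        moreover have "(LINT s:{t<..\<rho> m \<omega>}|\<mu>A. ?u s \<omega>) = 0"
          using t lt null by (intro A.set_integral_null) auto
        ultimately have "?a \<omega> (\<rho> m \<omega>) = ?a \<omega> t"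
          using t lt by (simp add: A.set_integral_upto)
        moreover have "?a \<omega> t < real (Suc m)" "?a \<omega> (\<rho> m \<omega>) = real (Suc m)" using elim(1) t lt by auto
        ultimately show False by simp
      qed
    qed
    moreover have "AE \<omega> in M. ?a \<omega> (\<rho> m \<omega>) \<le> real (Suc m)" using \<rho>'[of m] by eventually_elim auto
    ultimately obtain Y where Y: "Y \<in> contracts M F T \<xi>"
      "\<forall>i\<in>{1..n}. smallest_optimal M (times D) (agent_payoff M \<mu>A (f i) Y) (?\<tau> m i)"
      "principal_payoff M n \<mu>P g Y (?\<tau> m) = ?P m"
      using capped_implementation[OF D \<xi>T \<tau> _ \<rho>[of m], of "real (Suc m)"] by auto
    show ?thesis
      unfolding V_P_def principal_value_def stopping_times_eq_times D[symmetric]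
      by (rule Sup_upper) (use Y in \<open>auto intro!: exI[of _ Y] exI[of _ "?\<tau> m"]\<close>)
  qed
  have full: "AE \<omega> in M. \<forall>\<^sub>F m in sequentially. \<rho> m \<omega> = T \<and> max (\<xi> \<omega>) (- real (Suc m)) = \<xi> \<omega>"
  proof -
    have "AE \<omega> in M. \<forall>m. \<rho> m \<omega> < T \<longrightarrow> ?a \<omega> (\<rho> m \<omega>) = real (Suc m)"
      unfolding AE_all_countable using \<rho>' by (auto elim!: eventually_mono)
    then show ?thesis
      using A.rate_AE[OF u] AE_space
    proof eventually_elim
      case (elim \<omega>)
      obtain N :: nat where N: "max (\<integral>s. ?u s \<omega> \<partial>\<mu>A) (- \<xi> \<omega>) \<le> real N" using real_arch_simple by blast
      have "\<rho> m \<omega> = T \<and> max (\<xi> \<omega>) (- real (Suc m)) = \<xi> \<omega>" if m: "N \<le> m" for m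
      proof
        have "real N \<le> real m" using m by simp
        have "?a \<omega> (\<rho> m \<omega>) \<le> (\<integral>s. ?u s \<omega> \<partial>\<mu>A)"
        proof (intro integral_mono A.integrable_cut elim(2))
          fix s have "0 \<le> ?u s \<omega>" by (intro sum_nonneg) auto
          then show "of_bool (s \<le> \<rho> m \<omega>) * ?u s \<omega> \<le> ?u s \<omega>" by (auto simp: of_bool_def)
        qed
        moreover note \<open>real N \<le> real m\<close>
        ultimately have "?a \<omega> (\<rho> m \<omega>) < real (Suc m)" using N by simp
        then have "\<not> \<rho> m \<omega> < T" using elim(1) by auto
        then show "\<rho> m \<omega> = T" using timesD(4)[OF \<rho>[of m] elim(3)] by simp
        have "- \<xi> \<omega> \<le> real N" using N by (simp only: max.bounded_iff)
        then show "max (\<xi> \<omega>) (- real (Suc m)) = \<xi> \<omega>" using \<open>real N \<le> real m\<close> by (simp add: max_def)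
      qed
      then show ?case unfolding eventually_sequentially by blast
    qed
  qed
  have "?P \<longlonglongrightarrow> (\<Sum>i=1..n. (\<integral>\<omega>. (LINT s:{0..\<tau> i \<omega>}|\<mu>P. g i s \<omega>) \<partial>M)
    - (\<integral>\<omega>. (LINT s:{\<tau> i \<omega><..T}|\<mu>A. marginal_wage n f \<tau> s \<omega>) + \<xi> \<omega> \<partial>M))"
  proof (intro tendsto_sum tendsto_diff)
    fix i assume i: "i \<in> {1..n}"
    show "(\<lambda>m. \<integral>\<omega>. (LINT s:{0..?\<tau> m i \<omega>}|\<mu>P. g i s \<omega>) \<partial>M) \<longlonglongrightarrow> (\<integral>\<omega>. (LINT s:{0..\<tau> i \<omega>}|\<mu>P. g i s \<omega>) \<partial>M)"
    proof (rule expectation_tendsto_eventually)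
      show "integrable M (\<lambda>\<omega>. \<integral>s. \<bar>g i s \<omega>\<bar> \<partial>\<mu>P)" by (rule P.rate_integrable[OF P.rate_abs[OF g_rate[OF i]]])
      show "AE \<omega> in M. \<bar>LINT s:{0..?\<tau> m i \<omega>}|\<mu>P. g i s \<omega>\<bar> \<le> (\<integral>s. \<bar>g i s \<omega>\<bar> \<partial>\<mu>P)" for m
        using P.rate_AE[OF g_rate[OF i]] AE_space
        by eventually_elim (intro P.cut_integral_abs_le(1), use timesD(4)[OF S'[OF i]] in auto)
      show "AE \<omega> in M. \<forall>\<^sub>F m in sequentially. (LINT s:{0..?\<tau> m i \<omega>}|\<mu>P. g i s \<omega>) = (LINT s:{0..\<tau> i \<omega>}|\<mu>P. g i s \<omega>)"
        using full AE_space
      proof eventually_elim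
        case (elim \<omega>)
        have "\<tau> i \<omega> \<le> T" by (rule timesD(4)[OF S[OF i] elim(2)])
        with elim(1) show ?case by (auto elim!: eventually_mono simp: min_def)
      qed
    qed (use P.upto_integrable[OF g_rate[OF i] S[OF i]] P.upto_integrable[OF g_rate[OF i] S'[OF i]] in auto)
    have cw: "A.rate (capped_wage n f \<tau> (\<rho> m))" for m by (rule capped_wage_rate[OF S \<rho>])
    have mw: "A.rate (marginal_wage n f \<tau>)" by (rule marginal_wage_rate[OF S])
    show "(\<lambda>m. \<integral>\<omega>. (LINT s:{?\<tau> m i \<omega><..T}|\<mu>A. capped_wage n f \<tau> (\<rho> m) s \<omega>) + max (\<xi> \<omega>) (- real (Suc m)) \<partial>M)
      \<longlonglongrightarrow> (\<integral>\<omega>. (LINT s:{\<tau> i \<omega><..T}|\<mu>A. marginal_wage n f \<tau> s \<omega>) + \<xi> \<omega> \<partial>M)"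
    proof (rule expectation_tendsto_eventually)
      show "integrable M (\<lambda>\<omega>. (\<integral>s. wage_bound n f s \<omega> \<partial>\<mu>A) + \<bar>\<xi> \<omega>\<bar>)"
        using A.rate_integrable[OF wage_bound_rate] \<xi>_integrable by auto
      show "AE \<omega> in M. \<bar>(LINT s:{?\<tau> m i \<omega><..T}|\<mu>A. capped_wage n f \<tau> (\<rho> m) s \<omega>) + max (\<xi> \<omega>) (- real (Suc m))\<bar>
        \<le> (\<integral>s. wage_bound n f s \<omega> \<partial>\<mu>A) + \<bar>\<xi> \<omega>\<bar>" for m
        using A.rate_AE[OF cw[of m]] A.rate_AE[OF wage_bound_rate] AE_space
      proof eventually_elim
        case (elim \<omega>)
        have "0 \<le> ?\<tau> m i \<omega>" using timesD(3)[OF S'[OF i] elim(3)] .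
        from A.cut_integral_abs_le(2)[OF elim(1,2) capped_wage_bound this]
        have "\<bar>LINT s:{?\<tau> m i \<omega><..T}|\<mu>A. capped_wage n f \<tau> (\<rho> m) s \<omega>\<bar> \<le> (\<integral>s. wage_bound n f s \<omega> \<partial>\<mu>A)" .
        moreover have "\<bar>max (\<xi> \<omega>) (- real (Suc m))\<bar> \<le> \<bar>\<xi> \<omega>\<bar>"
          by (auto simp: max_def)
        ultimately show ?case by auto
      qed
      show "AE \<omega> in M. \<forall>\<^sub>F m in sequentially.
        (LINT s:{?\<tau> m i \<omega><..T}|\<mu>A. capped_wage n f \<tau> (\<rho> m) s \<omega>) + max (\<xi> \<omega>) (- real (Suc m))
        = (LINT s:{\<tau> i \<omega><..T}|\<mu>A. marginal_wage n f \<tau> s \<omega>) + \<xi> \<omega>"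
        using full AE_space
      proof eventually_elim
        case (elim \<omega>)
        have "\<tau> j \<omega> \<le> T" if "j \<in> {1..n}" for j by (rule timesD(4)[OF S[OF that] elim(2)])
        then have le: "min (\<tau> j \<omega>) T = \<tau> j \<omega>" if "j \<in> {1..n}" for j using that by (simp add: min_def)
        from elim(1) show ?case
        proof (rule eventually_mono)
          fix m assume m: "\<rho> m \<omega> = T \<and> max (\<xi> \<omega>) (- real (Suc m)) = \<xi> \<omega>"
          have "capped_wage n f \<tau> (\<rho> m) s \<omega> = marginal_wage n f \<tau> s \<omega>" if "s \<le> T" for s
            using that m le by (auto simp: capped_wage_def marginal_wage_def intro!: sum.cong)
          then have "(LINT s:{\<tau> i \<omega><..T}|\<mu>A. capped_wage n f \<tau> (\<rho> m) s \<omega>) = (LINT s:{\<tau> i \<omega><..T}|\<mu>A. marginal_wage n f \<tau> s \<omega>)"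
            unfolding set_lebesgue_integral_def
            by (intro Bochner_Integration.integral_cong refl) (auto simp: indicator_def)
          then show "(LINT s:{?\<tau> m i \<omega><..T}|\<mu>A. capped_wage n f \<tau> (\<rho> m) s \<omega>) + max (\<xi> \<omega>) (- real (Suc m))
            = (LINT s:{\<tau> i \<omega><..T}|\<mu>A. marginal_wage n f \<tau> s \<omega>) + \<xi> \<omega>"
            using m le[OF i] by simp
        qed
      qed
    qed (use A.after_integrable[OF cw S'[OF i]] A.after_integrable[OF mw S[OF i]] \<xi>_integrable in auto)
  qed
  then have "?P \<longlonglongrightarrow> W \<tau>" using S D by (subst chain_value_split) auto
  then have "(\<lambda>m. ereal (?P m)) \<longlonglongrightarrow> ereal (W \<tau>)" by simp
  then show ?thesis by (rule LIMSEQ_le_const2) (use below in auto)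
qed

section \<open>Rounding up to a partition\<close>

definition roundup :: "nat \<Rightarrow> (nat \<Rightarrow> real) \<Rightarrow> real \<Rightarrow> real" where
  "roundup m p s = Min {p j | j. j \<le> m \<and> s \<le> p j}"

lemma is_partition_le: "is_partition T m p \<Longrightarrow> i \<le> j \<Longrightarrow> j \<le> m \<Longrightarrow> p i \<le> p j"
  using is_partition_mono[of T m p i j] by (cases "i = j") auto

context
  fixes T m p
  assumes p: "is_partition T m p"
begin

lemma roundup:
  assumes "s \<le> T"
  shows "roundup m p s \<in> p ` {0..m}" "s \<le> roundup m p s" "\<And>d. d \<in> p ` {0..m} \<Longrightarrow> roundup m p s \<le> d \<longleftrightarrow> s \<le> d"
proof -
  let ?S = "{p j | j. j \<le> m \<and> s \<le> p j}"
  have fin: "finite ?S" by auto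
  have "p m \<in> ?S" using p assms by (auto simp: is_partition_def)
  then have "roundup m p s \<in> ?S" unfolding roundup_def by (intro Min_in fin) auto
  then show 1: "roundup m p s \<in> p ` {0..m}" "s \<le> roundup m p s" by auto
  fix d assume "d \<in> p ` {0..m}"
  then have "s \<le> d \<Longrightarrow> d \<in> ?S" by auto
  then have "s \<le> d \<Longrightarrow> roundup m p s \<le> d" unfolding roundup_def by (intro Min_le fin)
  then show "roundup m p s \<le> d \<longleftrightarrow> s \<le> d" using 1(2) by auto
qed

lemma less_roundup: "s \<le> T \<Longrightarrow> d \<in> p ` {0..m} \<Longrightarrow> d < roundup m p s \<longleftrightarrow> d < s"
  using roundup(3)[of s d] by (simp add: not_le[symmetric])

lemma roundup_mono:
  assumes "s \<le> t" "t \<le> T"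
  shows "roundup m p s \<le> roundup m p t"
  using assms roundup(2)[OF assms(2)] roundup(3)[OF _ roundup(1)[OF assms(2)], of s] by auto

lemma roundup_cell:
  assumes j: "j \<in> {1..m}" and s: "s \<in> {p (j - 1)<..p j}"
  shows "roundup m p s = p j"
  unfolding roundup_def
proof (rule Min_eqI)
  fix y assume "y \<in> {p j | j. j \<le> m \<and> s \<le> p j}"
  then obtain i where i: "y = p i" "i \<le> m" "s \<le> p i" by auto
  have "j \<le> i"
  proof (rule ccontr)
    assume "\<not> j \<le> i"
    then have "p i \<le> p (j - 1)" using is_partition_le[OF p, of i "j - 1"] j by auto
    with i s show False by auto
  qed
  then show "p j \<le> y" using is_partition_le[OF p, of j i] i by auto
qed (use j s in auto)

lemma roundup_0: "roundup m p 0 = 0"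
proof (rule antisym)
  have 0: "(0::real) \<in> p ` {0..m}" "0 \<le> T"
    using p is_partition_range[OF p, of 0] by (auto simp: is_partition_def image_iff intro!: bexI[of _ 0])
  show "roundup m p 0 \<le> 0" using roundup(3)[OF 0(2,1)] by simp
  show "0 \<le> roundup m p 0" by (rule roundup(2)[OF 0(2)])
qed

lemma in_cell:
  assumes s: "0 < s" "s \<le> T"
  obtains j where "j \<in> {1..m}" "s \<in> {p (j - 1)<..p j}"
proof -
  define j where "j = (LEAST j. s \<le> p j)"
  have "s \<le> p m" using p s by (simp add: is_partition_def)
  then have j: "s \<le> p j" "j \<le> m" unfolding j_def by (rule LeastI, rule Least_le)
  have "j \<noteq> 0" using j(1) s p by (cases "j = 0") (auto simp: is_partition_def)
  moreover have "\<not> s \<le> p (j - 1)"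
    using not_less_Least[of "j - 1" "\<lambda>j. s \<le> p j"] \<open>j \<noteq> 0\<close> unfolding j_def[symmetric] by auto
  ultimately show ?thesis using that[of j] j by auto
qed

lemma roundup_mesh:
  assumes s: "0 \<le> s" "s \<le> T" and m: "1 \<le> m"
  shows "roundup m p s - s \<le> mesh m p"
proof -
  have le: "p (Suc j) - p j \<le> mesh m p" if "j < m" for j
    unfolding mesh_def using that by (intro Max_ge) auto
  show ?thesis
  proof (cases "s = 0")
    case True
    have "p 0 < p (Suc 0)" using p m by (auto simp: is_partition_def)
    then show ?thesis using le[of 0] m True roundup_0 by simp
  next
    case False
    then obtain j where j: "j \<in> {1..m}" "s \<in> {p (j - 1)<..p j}" using in_cell[of s] s by auto
    then obtain k where k: "j = Suc k" "k < m" by (cases j) auto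
    then show ?thesis using roundup_cell[OF j] le[OF k(2)] j(2) by simp
  qed
qed

end

context filtered_prob_space begin

lemma roundup_times:
  assumes p: "is_partition T m p" and \<tau>: "\<tau> \<in> times {0..T}"
  shows "(\<lambda>\<omega>. roundup m p (\<tau> \<omega>)) \<in> times (p ` {0..m})"
proof (rule timesI)
  note r = roundup[OF p timesD(4)[OF \<tau>]]
  have D: "0 \<le> d \<and> d \<le> T" if "d \<in> p ` {0..m}" for d
    using that is_partition_range[OF p] by auto
  show "stopping_time F (\<lambda>\<omega>. roundup m p (\<tau> \<omega>))"
    unfolding stopping_time_def pred_def space_F
  proof
    fix t
    show "{\<omega> \<in> space M. roundup m p (\<tau> \<omega>) \<le> t} \<in> sets (F t)"
    proof (cases "t < 0")
      case True
      have "t < roundup m p (\<tau> \<omega>)" if "\<omega> \<in> space M" for \<omega>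
        using D[OF r(1)[OF that]] True by linarith
      then have "{\<omega> \<in> space M. roundup m p (\<tau> \<omega>) \<le> t} = {}" by (simp add: not_le)
      then show ?thesis by (simp only: sets.empty_sets)
    next
      case False
      then have t: "0 \<le> t" by simp
      let ?q = "Max (insert (p 0) {p j | j. j \<le> m \<and> p j \<le> t})"
      have q: "?q \<in> p ` {0..m}" "?q \<le> t" "\<And>d. d \<in> p ` {0..m} \<Longrightarrow> d \<le> t \<Longrightarrow> d \<le> ?q"
        using grid_last[OF p t] by auto
      have "roundup m p (\<tau> \<omega>) \<le> t \<longleftrightarrow> \<tau> \<omega> \<le> ?q" if "\<omega> \<in> space M" for \<omega>
        using r(3)[OF that q(1)] q(2) q(3)[OF r(1)[OF that]] by linarith
      then have "{\<omega> \<in> space M. roundup m p (\<tau> \<omega>) \<le> t} = {\<omega> \<in> space M. \<tau> \<omega> \<le> ?q}" by blast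
      moreover have "{\<omega> \<in> space M. \<tau> \<omega> \<le> ?q} \<in> sets (F ?q)"
        using stopping_timeD[OF timesD(1)[OF \<tau>], of ?q] unfolding pred_def space_F .
      ultimately show ?thesis using sets_F_mono[OF q(2)] by auto
    qed
  qed
  fix \<omega> assume "\<omega> \<in> space M"
  then show "0 \<le> roundup m p (\<tau> \<omega>) \<and> roundup m p (\<tau> \<omega>) \<le> T \<and> roundup m p (\<tau> \<omega>) \<in> p ` {0..m}"
    using r(1) D by auto
qed

end

context atomless_clock begin

context
  fixes m :: nat and p :: "nat \<Rightarrow> real"
  assumes p: "is_partition T m p"
begin

lemma cells_disjoint: "disjoint_family_on (\<lambda>j. {p (j - 1)<..p j}) {1..m}"
  unfolding disjoint_family_on_def
proof (intro ballI impI)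
  fix i j assume ij: "i \<in> {1..m}" "j \<in> {1..m}" "i \<noteq> j"
  have "p i \<le> p (j - 1) \<or> p j \<le> p (i - 1)"
    using ij is_partition_le[OF p, of i "j - 1"] is_partition_le[OF p, of j "i - 1"] by (cases "i < j") auto
  then show "{p (i - 1)<..p i} \<inter> {p (j - 1)<..p j} = {}" by auto
qed

lemma cell_sets: "j \<in> {1..m} \<Longrightarrow> {p (j - 1)<..p j} \<in> sets \<mu>"
  using is_partition_range[OF p, of j] is_partition_range[OF p, of "j - 1"] by (intro interval_clock) auto

lemma zero_null: "{0} \<in> null_sets \<mu>"
proof -
  have m: "{0} \<in> sets \<mu>" using T_pos by (auto simp: sets_clock sets_restrict_space_iff)
  have "{s \<in> space \<mu>. \<not> s \<noteq> 0} = {0}" using T_pos by (auto simp: space_clock)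
  from AE_iff_measurable[OF m this] singleton_null[of 0] show ?thesis
    by (intro null_setsI m) simp
qed

lemma roundup_vimage:
  "roundup m p -` B \<inter> space \<mu> = (\<Union>j\<in>{j\<in>{1..m}. p j \<in> B}. {p (j - 1)<..p j}) \<union> (if 0 \<in> B then {0} else {})"
proof (intro set_eqI iffI)
  fix s assume s: "s \<in> roundup m p -` B \<inter> space \<mu>"
  show "s \<in> (\<Union>j\<in>{j\<in>{1..m}. p j \<in> B}. {p (j - 1)<..p j}) \<union> (if 0 \<in> B then {0} else {})"
  proof (cases "s = 0")
    case True
    then show ?thesis using s roundup_0[OF p] by auto
  next
    case False
    then obtain j where j: "j \<in> {1..m}" "s \<in> {p (j - 1)<..p j}"
      using in_cell[OF p, of s] s by (auto simp: space_clock)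
    then show ?thesis using s roundup_cell[OF p j] by auto
  qed
next
  fix s assume s: "s \<in> (\<Union>j\<in>{j\<in>{1..m}. p j \<in> B}. {p (j - 1)<..p j}) \<union> (if 0 \<in> B then {0} else {})"
  have "s \<in> roundup m p -` B \<inter> space \<mu>" if j: "j \<in> {1..m}" "p j \<in> B" "s \<in> {p (j - 1)<..p j}" for j
    using that roundup_cell[OF p j(1,3)] sets.sets_into_space[OF cell_sets[OF j(1)]] by auto
  then show "s \<in> roundup m p -` B \<inter> space \<mu>"
    using s roundup_0[OF p] T_pos by (auto simp: space_clock split: if_splits)
qed

lemma roundup_measurable: "roundup m p \<in> measurable \<mu> \<mu>"
proof (rule measurableI)
  fix s assume "s \<in> space \<mu>"
  then show "roundup m p s \<in> space \<mu>"
    using roundup(1)[OF p, of s] is_partition_range[OF p] by (auto simp: space_clock)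
next
  fix B assume "B \<in> sets \<mu>"
  show "roundup m p -` B \<inter> space \<mu> \<in> sets \<mu>"
    unfolding roundup_vimage using zero_null cell_sets by (intro sets.Un sets.finite_UN) auto
qed

text \<open>The discretized clock is the image of the clock under rounding up, because \<open>0\<close> carries no mass.\<close>

lemma grid_measure_eq_distr: "grid_measure \<mu> m p = distr \<mu> \<mu> (roundup m p)"
proof (rule measure_eqI)
  show "sets (grid_measure \<mu> m p) = sets (distr \<mu> \<mu> (roundup m p))" by (simp add: grid_measure_def)
  fix B assume "B \<in> sets (grid_measure \<mu> m p)"
  then have B: "B \<in> sets \<mu>" by (simp add: grid_measure_def)
  let ?J = "{j\<in>{1..m}. p j \<in> B}" and ?c = "\<lambda>j. {p (j - 1)<..p j}"
  have "emeasure (distr \<mu> \<mu> (roundup m p)) B = emeasure \<mu> (roundup m p -` B \<inter> space \<mu>)"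
    by (rule emeasure_distr[OF roundup_measurable B])
  also have "\<dots> = emeasure \<mu> (\<Union>j\<in>?J. ?c j)"
  proof -
    have "(\<Union>j\<in>?J. ?c j) \<in> sets \<mu>" using cell_sets by (intro sets.finite_UN) auto
    from emeasure_Un_null_set[OF this zero_null] show ?thesis
      unfolding roundup_vimage by (cases "0 \<in> B") simp_all
  qed
  also have "\<dots> = (\<Sum>j\<in>?J. emeasure \<mu> (?c j))"
  proof (rule sum_emeasure[symmetric])
    show "disjoint_family_on ?c ?J" by (rule disjoint_family_on_mono[OF _ cells_disjoint]) auto
  qed (use cell_sets in auto)
  also have "\<dots> = (\<Sum>j=1..m. emeasure \<mu> (?c j) * indicator B (p j))"
    by (rule sum.mono_neutral_cong_left) (auto simp: indicator_def)
  finally show "emeasure (grid_measure \<mu> m p) B = emeasure (distr \<mu> \<mu> (roundup m p)) B"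
    using emeasure_grid_measure[OF p sets_clock B] by simp
qed

lemma grid_clock: "clock M F T (grid_measure \<mu> m p)"
proof (intro clock.intro filtered_prob_space_axioms clock_axioms.intro finite_measureI)
  have "emeasure (grid_measure \<mu> m p) (space (grid_measure \<mu> m p)) = emeasure \<mu> (space \<mu>)"
  proof -
    have "roundup m p -` space \<mu> \<inter> space \<mu> = space \<mu>"
      using measurable_space[OF roundup_measurable] by auto
    then show ?thesis
      unfolding grid_measure_eq_distr by (simp add: emeasure_distr[OF roundup_measurable])
  qed
  then show "emeasure (grid_measure \<mu> m p) (space (grid_measure \<mu> m p)) \<noteq> \<infinity>" by simp
  show "sets (grid_measure \<mu> m p) = sets (restrict_space borel {0..T})"
    by (simp add: grid_measure_def sets_clock)
qed

lemma grid_interval_mass: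
  assumes "a \<in> p ` {0..m}" "b \<in> p ` {0..m}"
  shows "emeasure (grid_measure \<mu> m p) {a<..b} = emeasure \<mu> {a<..b}"
proof -
  have ab: "0 \<le> a" "b \<le> T" using assms is_partition_range[OF p] by auto
  have "roundup m p -` {a<..b} \<inter> space \<mu> = {a<..b}"
    using less_roundup[OF p _ assms(1)] roundup(3)[OF p _ assms(2)] ab by (auto simp: space_clock)
  then show ?thesis
    unfolding grid_measure_eq_distr using ab by (simp add: emeasure_distr[OF roundup_measurable])
qed

lemma grid_integral:
  fixes v :: "real \<Rightarrow> real"
  assumes "v \<in> borel_measurable \<mu>"
  shows "(\<integral>s. v s \<partial>grid_measure \<mu> m p) = (\<integral>s. v (roundup m p s) \<partial>\<mu>)"
  unfolding grid_measure_eq_distr by (rule integral_distr[OF roundup_measurable assms])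

lemma deviation_eq_cells:
  fixes u :: "real \<Rightarrow> real"
  assumes u: "u \<in> borel_measurable \<mu>"
  shows "(\<integral>\<^sup>+s. ennreal \<bar>u s - u (roundup m p s)\<bar> \<partial>\<mu>)
    = (\<Sum>j=1..m. \<integral>\<^sup>+s\<in>{p (j - 1)<..p j}. ennreal \<bar>u s - u (p j)\<bar> \<partial>\<mu>)"
proof -
  let ?h = "\<lambda>s. ennreal \<bar>u s - u (roundup m p s)\<bar>"
  have [measurable]: "u \<in> borel_measurable \<mu>" "(\<lambda>s. u (roundup m p s)) \<in> borel_measurable \<mu>"
    using u measurable_compose[OF roundup_measurable u] by auto
  have "(\<integral>\<^sup>+s. ?h s \<partial>\<mu>) = (\<integral>\<^sup>+s. (\<Sum>j=1..m. ?h s * indicator {p (j - 1)<..p j} s) \<partial>\<mu>)"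
  proof (rule nn_integral_cong_AE)
    show "AE s in \<mu>. ?h s = (\<Sum>j=1..m. ?h s * indicator {p (j - 1)<..p j} s)"
      using singleton_null[of 0] AE_space
    proof eventually_elim
      case (elim s)
      then obtain j where j: "j \<in> {1..m}" "s \<in> {p (j - 1)<..p j}"
        using in_cell[OF p, of s] by (auto simp: space_clock)
      have "s \<notin> {p (i - 1)<..p i}" if "i \<in> {1..m}" "i \<noteq> j" for i
        using disjoint_family_onD[OF cells_disjoint that(1) j(1) that(2)] j(2) by auto
      then have "(\<Sum>i=1..m. ?h s * indicator {p (i - 1)<..p i} s) = (\<Sum>i=1..m. if i = j then ?h s else 0)"
        using j by (intro sum.cong refl) (auto simp: indicator_def)
      then show ?case using j by simp
    qed
  qed
  also have "\<dots> = (\<Sum>j=1..m. \<integral>\<^sup>+s\<in>{p (j - 1)<..p j}. ?h s \<partial>\<mu>)"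
    using cell_sets by (intro nn_integral_sum) auto
  also have "\<dots> = (\<Sum>j=1..m. \<integral>\<^sup>+s\<in>{p (j - 1)<..p j}. ennreal \<bar>u s - u (p j)\<bar> \<partial>\<mu>)"
    using roundup_cell[OF p] by (intro sum.cong refl nn_integral_cong) (auto simp: indicator_def)
  finally show ?thesis .
qed

end

end

section \<open>Separated chains on a partition\<close>

context filtered_prob_space begin

text \<open>
  An event that recurs along stopping times converging to \<open>\<tau>\<close> is known immediately after \<open>\<tau>\<close>,
  hence at \<open>\<tau>\<close> by right-continuity of the filtration.
\<close>

lemma limsup_pre_sigma:
  fixes \<sigma> :: "nat \<Rightarrow> 'a \<Rightarrow> real"
  assumes \<sigma>: "\<And>m. \<sigma> m \<in> times {0..T}" and \<tau>: "\<tau> \<in> times {0..T}"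
    and lim: "\<And>\<omega>. \<omega> \<in> space M \<Longrightarrow> (\<lambda>m. \<sigma> m \<omega>) \<longlonglongrightarrow> \<tau> \<omega>"
    and B: "\<And>m. B m \<in> sets (pre_sigma (\<sigma> m))"
  shows "{\<omega>\<in>space M. \<forall>N. \<exists>m\<ge>N. \<omega> \<in> B m} \<in> sets (pre_sigma \<tau>)"
proof -
  define A where "A = {\<omega>\<in>space M. \<forall>N. \<exists>m\<ge>N. \<omega> \<in> B m}"
  have AD: "\<omega> \<in> space M" "\<exists>m\<ge>N. \<omega> \<in> B m" if "\<omega> \<in> A" for \<omega> N using that unfolding A_def by blast+
  have AI: "\<omega> \<in> A" if "\<omega> \<in> space M" "\<And>N. \<exists>m\<ge>N. \<omega> \<in> B m" for \<omega> using that unfolding A_def by blast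
  have "A \<in> sets (pre_sigma \<tau>)"
  proof (rule sets_pre_sigmaI[OF timesD(1)[OF \<tau>]])
    fix t
    have Bs: "{\<omega>\<in>B m. \<sigma> m \<omega> \<le> s} \<in> sets (F s)" for m s
      by (rule sets_pre_sigmaD[OF timesD(1)[OF \<sigma>] B])
    have sub: "B m \<subseteq> space M" for m
      using sets.sets_into_space[OF B[of m]] by (simp add: space_pre_sigma)
    have Ls: "(\<Inter>N. \<Union>m\<in>{N..}. {\<omega>\<in>B m. \<sigma> m \<omega> \<le> s}) \<in> sets (F s)" (is "?L s \<in> _") for s
      using Bs by (intro sets.countable_INT sets.countable_UN') auto
    have L_D: "\<exists>m\<ge>N. \<omega> \<in> B m" if "\<omega> \<in> ?L s" for s N \<omega>
    proof -
      have "\<omega> \<in> (\<Union>m\<in>{N..}. {\<omega>\<in>B m. \<sigma> m \<omega> \<le> s})" by (rule INT_D[OF that UNIV_I])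
      then obtain m where "m \<in> {N..}" "\<omega> \<in> B m" by auto
      then show ?thesis by auto
    qed
    have later: "{\<omega>\<in>A. \<tau> \<omega> \<le> t} \<in> sets (F s)" if s: "t < s" for s
    proof -
      have "{\<omega>\<in>A. \<tau> \<omega> \<le> t} = {\<omega>\<in>space (F s). \<tau> \<omega> \<le> t} \<inter> ?L s"
      proof (intro set_eqI iffI)
        fix \<omega> assume \<omega>: "\<omega> \<in> {\<omega>\<in>A. \<tau> \<omega> \<le> t}"
        then have "\<forall>\<^sub>F m in sequentially. \<sigma> m \<omega> < s"
          using s lim[OF AD(1)] by (intro order_tendstoD(2)[of _ "\<tau> \<omega>"]) auto
        then obtain N where N: "\<And>m. N \<le> m \<Longrightarrow> \<sigma> m \<omega> < s" by (auto simp: eventually_sequentially)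
        have "\<omega> \<in> ?L s"
        proof
          fix k
          obtain m where "max k N \<le> m" "\<omega> \<in> B m" using AD(2)[of \<omega> "max k N"] \<omega> by blast
          then show "\<omega> \<in> (\<Union>m\<in>{k..}. {\<omega>\<in>B m. \<sigma> m \<omega> \<le> s})" using N[of m] by auto
        qed
        then show "\<omega> \<in> {\<omega>\<in>space (F s). \<tau> \<omega> \<le> t} \<inter> ?L s" using \<omega> AD(1) by (simp add: space_F)
      next
        fix \<omega> assume \<omega>: "\<omega> \<in> {\<omega>\<in>space (F s). \<tau> \<omega> \<le> t} \<inter> ?L s"
        have "\<exists>m\<ge>N. \<omega> \<in> B m" for N by (rule L_D[OF IntD2[OF \<omega>]])
        then show "\<omega> \<in> {\<omega>\<in>A. \<tau> \<omega> \<le> t}" using \<omega> AI[of \<omega>] by (simp add: space_F)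
      qed
      moreover have "{\<omega>\<in>space (F s). \<tau> \<omega> \<le> t} \<in> sets (F s)"
        using stopping_time_le_const[OF timesD(1)[OF \<tau>], of t s] s by (simp add: pred_def)
      ultimately show ?thesis using Ls[of s] by (simp only: sets.Int)
    qed
    consider "t < 0" | "0 \<le> t" "t < T" | "T \<le> t" by linarith
    then show "{\<omega>\<in>A. \<tau> \<omega> \<le> t} \<in> sets (F t)"
    proof cases
      case 1
      have "{\<omega>\<in>A. \<tau> \<omega> \<le> t} = {}"
      proof (rule equals0I)
        fix \<omega> assume "\<omega> \<in> {\<omega>\<in>A. \<tau> \<omega> \<le> t}"
        then have "\<omega> \<in> A" "\<tau> \<omega> \<le> t" by simp_all
        with timesD(3)[OF \<tau> AD(1)[of \<omega>]] 1 show False by simp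
      qed
      then show ?thesis by (simp only: sets.empty_sets)
    next
      case 2
      then have "sets (F t) = (\<Inter>s\<in>{t<..T}. sets (F s))" using usual by (simp add: usual_conditions_def)
      then show ?thesis using later by auto
    next
      case 3
      have le: "\<sigma> m \<omega> \<le> T" "\<tau> \<omega> \<le> t" if "\<omega> \<in> space M" for m \<omega>
        using timesD(4)[OF \<sigma> that] timesD(4)[OF \<tau> that] 3 by auto
      have "{\<omega>\<in>A. \<tau> \<omega> \<le> t} = ?L T"
      proof (intro set_eqI iffI)
        fix \<omega> assume "\<omega> \<in> {\<omega>\<in>A. \<tau> \<omega> \<le> t}"
        then have \<omega>: "\<omega> \<in> A" by simp
        show "\<omega> \<in> ?L T" 
        proof
          fix N
          obtain m where "N \<le> m" "\<omega> \<in> B m" using AD(2)[OF \<omega>, of N] by blast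
          then show "\<omega> \<in> (\<Union>m\<in>{N..}. {\<omega>\<in>B m. \<sigma> m \<omega> \<le> T})" using le(1)[OF AD(1)[OF \<omega>]] by auto
        qed
      next
        fix \<omega> assume L: "\<omega> \<in> ?L T"
        have ex: "\<exists>m\<ge>N. \<omega> \<in> B m" for N by (rule L_D[OF L])
        obtain m where "\<omega> \<in> B m" using ex[of 0] by blast
        then have "\<omega> \<in> space M" using sub[of m] by (rule subsetD[rotated])
        then show "\<omega> \<in> {\<omega>\<in>A. \<tau> \<omega> \<le> t}" using AI[OF _ ex] le(2) by simp
      qed
      then show ?thesis using Ls[of T] sets_F_mono[OF 3] by auto
    qed
  qed
  then show ?thesis by (simp only: A_def)
qed

text \<open>
  On finitely many dates the infimum is attained, whence it is a stopping time and inherits pathwise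
  properties of the sequence.
\<close>

lemma times_Inf:
  assumes D: "finite D" and s: "\<And>k::nat. s k \<in> times D"
  shows "(\<lambda>\<omega>. INF k. s k \<omega>) \<in> times D"
    and "\<And>\<omega>. \<omega> \<in> space M \<Longrightarrow> \<exists>k. (INF k. s k \<omega>) = s k \<omega>"
    and "\<And>\<omega> k. \<omega> \<in> space M \<Longrightarrow> (INF k. s k \<omega>) \<le> s k \<omega>"
proof -
  have fin: "finite (range (\<lambda>k. s k \<omega>))" if "\<omega> \<in> space M" for \<omega>
    using timesD(5)[OF s that] by (intro finite_subset[OF _ D]) auto
  have Min: "(INF k. s k \<omega>) = Min (range (\<lambda>k. s k \<omega>))" if "\<omega> \<in> space M" for \<omega>
    using fin[OF that] by (intro cInf_eq_Min) auto
  show att: "\<exists>k. (INF k. s k \<omega>) = s k \<omega>" if "\<omega> \<in> space M" for \<omega>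
    using Min_in[OF fin[OF that]] Min[OF that] by auto
  show le: "(INF k. s k \<omega>) \<le> s k \<omega>" if "\<omega> \<in> space M" for \<omega> k
    unfolding Min[OF that] by (intro Min_le fin[OF that]) auto
  show "(\<lambda>\<omega>. INF k. s k \<omega>) \<in> times D"
  proof (rule timesI)
    show "stopping_time F (\<lambda>\<omega>. INF k. s k \<omega>)"
      unfolding stopping_time_def pred_def space_F
    proof
      fix t
      have "{\<omega>\<in>space M. (INF k. s k \<omega>) \<le> t} = (\<Union>k. {\<omega>\<in>space M. s k \<omega> \<le> t})"
      proof (intro set_eqI iffI)
        fix \<omega> assume \<omega>: "\<omega> \<in> {\<omega>\<in>space M. (INF k. s k \<omega>) \<le> t}"
        then obtain k where "(INF k. s k \<omega>) = s k \<omega>" using att[of \<omega>] by auto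
        then show "\<omega> \<in> (\<Union>k. {\<omega>\<in>space M. s k \<omega> \<le> t})" using \<omega> by auto
      next
        fix \<omega> assume "\<omega> \<in> (\<Union>k. {\<omega>\<in>space M. s k \<omega> \<le> t})"
        then obtain k where "\<omega> \<in> space M" "s k \<omega> \<le> t" by auto
        then show "\<omega> \<in> {\<omega>\<in>space M. (INF k. s k \<omega>) \<le> t}" using le[of \<omega> k] by auto
      qed
      also have "\<dots> \<in> sets (F t)"
        using stopping_timeD[OF timesD(1)[OF s]] by (intro sets.countable_UN) (auto simp: pred_def space_F)
      finally show "{\<omega>\<in>space M. (INF k. s k \<omega>) \<le> t} \<in> sets (F t)" .
    qed
  next
    fix \<omega> assume \<omega>: "\<omega> \<in> space M"
    then obtain k where "(INF k. s k \<omega>) = s k \<omega>" using att by auto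
    then show "0 \<le> (INF k. s k \<omega>) \<and> (INF k. s k \<omega>) \<le> T \<and> (INF k. s k \<omega>) \<in> D"
      using timesD(3-5)[OF s \<omega>] by simp
  qed
qed

lemma times_integrable: "\<sigma> \<in> times D \<Longrightarrow> integrable M \<sigma>"
  using timesD(2-4)[of \<sigma> D] by (intro integrable_const_bound[of _ T] AE_I2) auto

text \<open>
  The infimum of a sequence of almost minimal expectation minimizes the expectation, and a minimizer
  is least, since its minimum with any other element belongs to \<open>G\<close> too.
\<close>

lemma least_time_exists:
  assumes D: "finite D" and G: "G \<subseteq> times D" "G \<noteq> {}"
    and Inf: "\<And>s. (\<And>k::nat. s k \<in> G) \<Longrightarrow> (\<lambda>\<omega>. INF k. s k \<omega>) \<in> G"
  shows "\<exists>\<tau>\<in>G. \<forall>\<sigma>\<in>G. AE \<omega> in M. \<tau> \<omega> \<le> \<sigma> \<omega>"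
proof -
  let ?E = "\<lambda>\<sigma>. \<integral>\<omega>. \<sigma> \<omega> \<partial>M"
  have times: "\<sigma> \<in> times D" if "\<sigma> \<in> G" for \<sigma> using that G by auto
  have "bdd_below (?E ` G)"
    using timesD(3)[OF times] by (intro bdd_belowI2[of _ 0] Bochner_Integration.integral_nonneg) auto
  then have bdd: "(INF \<sigma>\<in>G. ?E \<sigma>) \<le> ?E \<sigma>" if "\<sigma> \<in> G" for \<sigma> using that by (rule cINF_lower)
  have "\<exists>\<sigma>\<in>G. ?E \<sigma> < (INF \<sigma>\<in>G. ?E \<sigma>) + inverse (real (Suc k))" for k
  proof -
    have "(INF \<sigma>\<in>G. ?E \<sigma>) < (INF \<sigma>\<in>G. ?E \<sigma>) + inverse (real (Suc k))" by simp
    from cInf_lessD[OF _ this] show ?thesis using G(2) by auto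
  qed
  then obtain s where s: "\<And>k. s k \<in> G" "\<And>k. ?E (s k) < (INF \<sigma>\<in>G. ?E \<sigma>) + inverse (real (Suc k))"
    by metis
  let ?\<tau> = "\<lambda>\<omega>. INF k. s k \<omega>"
  have \<tau>: "?\<tau> \<in> G" by (rule Inf[OF s(1)])
  have min: "?E ?\<tau> \<le> (INF \<sigma>\<in>G. ?E \<sigma>)"
  proof (rule LIMSEQ_le_const)
    have "(\<lambda>k. (INF \<sigma>\<in>G. ?E \<sigma>) + inverse (real (Suc k))) \<longlonglongrightarrow> (INF \<sigma>\<in>G. ?E \<sigma>) + 0"
      by (intro tendsto_intros LIMSEQ_inverse_real_of_nat)
    then show "(\<lambda>k. (INF \<sigma>\<in>G. ?E \<sigma>) + inverse (real (Suc k))) \<longlonglongrightarrow> (INF \<sigma>\<in>G. ?E \<sigma>)" by simp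
    have "?E ?\<tau> \<le> ?E (s k)" for k
      using times_Inf(3)[where s=s, OF D times[OF s(1)]]
      by (intro integral_mono times_integrable[OF times] \<tau> s(1))
    then show "\<exists>N. \<forall>k\<ge>N. ?E ?\<tau> \<le> (INF \<sigma>\<in>G. ?E \<sigma>) + inverse (real (Suc k))"
      using s(2) by (meson less_imp_le order_trans)
  qed
  have "AE \<omega> in M. ?\<tau> \<omega> \<le> \<sigma> \<omega>" if \<sigma>: "\<sigma> \<in> G" for \<sigma>
  proof -
    let ?s = "\<lambda>k::nat. if k = 0 then ?\<tau> else \<sigma>"
    have m: "(\<lambda>\<omega>. INF k. ?s k \<omega>) \<in> G" by (rule Inf) (use \<sigma> \<tau> in auto)
    let ?m = "\<lambda>\<omega>. INF k. ?s k \<omega>"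
    have st: "?s k \<in> times D" for k using times \<sigma> \<tau> by auto
    have le: "?m \<omega> \<le> ?\<tau> \<omega>" "?m \<omega> \<le> \<sigma> \<omega>" if "\<omega> \<in> space M" for \<omega>
      using times_Inf(3)[where s="?s", OF D st that, where k=0] times_Inf(3)[where s="?s", OF D st that, where k=1] by auto
    have "(\<integral>\<omega>. ?\<tau> \<omega> - ?m \<omega> \<partial>M) = ?E ?\<tau> - ?E ?m"
      by (intro Bochner_Integration.integral_diff times_integrable[OF times] \<tau> m)
    moreover have "0 \<le> (\<integral>\<omega>. ?\<tau> \<omega> - ?m \<omega> \<partial>M)"
      using le(1) by (intro Bochner_Integration.integral_nonneg) auto
    ultimately have "(\<integral>\<omega>. ?\<tau> \<omega> - ?m \<omega> \<partial>M) = 0" using min bdd[OF m] by linarith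
    moreover have "integrable M (\<lambda>\<omega>. ?\<tau> \<omega> - ?m \<omega>)"
      by (intro Bochner_Integration.integrable_diff times_integrable[OF times] \<tau> m)
    ultimately have "AE \<omega> in M. ?\<tau> \<omega> - ?m \<omega> = 0"
      using le(1) by (subst (asm) integral_nonneg_eq_0_iff_AE) auto
    then show ?thesis
      using AE_space
    proof eventually_elim
      case (elim \<omega>)
      show ?case using elim(1) le(2)[OF elim(2)] by linarith
    qed
  qed
  then show ?thesis by (intro bexI[OF _ \<tau>] ballI)
qed

end

context clock begin

lemma interval_null_trans:
  assumes "0 \<le> a" "c \<le> T" "emeasure \<mu> {a<..b} = 0" "emeasure \<mu> {b<..c} = 0" "a \<le> b" "b \<le> c"
  shows "emeasure \<mu> {a<..c} = 0"
proof -
  have n: "{a<..b} \<in> null_sets \<mu>" "{b<..c} \<in> null_sets \<mu>" using assms by (auto intro!: null_setsI)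
  have "{a<..c} = {a<..b} \<union> {b<..c}" using assms by auto
  then show ?thesis using null_sets.Un[OF n] by auto
qed

lemma interval_null_mono:
  assumes "emeasure \<mu> {a<..b} = 0" "0 \<le> a" "b \<le> T" "a \<le> a'" "b' \<le> b"
  shows "emeasure \<mu> {a'<..b'} = 0"
proof -
  have "emeasure \<mu> {a'<..b'} \<le> emeasure \<mu> {a<..b}" using assms by (intro emeasure_mono) auto
  then show ?thesis using assms(1) by simp
qed

text \<open>
  Any ordered family on a finite set of dates becomes a separated chain when each of its members
  is moved down, within the family, to the least time that the clock does not tell apart from it.
\<close>

lemma separated_chain_below:
  assumes D: "finite D" and \<sigma>: "\<And>i. i \<in> {1..n} \<Longrightarrow> \<sigma> i \<in> times D" and ord: "ordered n \<sigma>"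
  shows "\<exists>\<tau>\<in>chains D n. \<forall>i\<in>{1..n}. (\<forall>\<omega>\<in>space M. \<exists>j\<in>{1..i}. \<tau> i \<omega> = \<sigma> j \<omega>) \<and>
    (AE \<omega> in M. emeasure \<mu> {\<tau> i \<omega><..\<sigma> i \<omega>} = 0)"
proof -
  define G where "G i = {\<tau>\<in>times D. (\<forall>\<omega>\<in>space M. \<exists>j\<in>{1..i}. \<tau> \<omega> = \<sigma> j \<omega>) \<and>
    (AE \<omega> in M. emeasure \<mu> {\<tau> \<omega><..\<sigma> i \<omega>} = 0)}" for i
  have G_le: "\<tau> \<omega> \<le> \<sigma> i \<omega>" if \<tau>: "\<tau> \<in> G i" and i: "i \<in> {1..n}" and \<omega>: "\<omega> \<in> space M" for \<tau> i \<omega>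
  proof -
    obtain j where "j \<in> {1..i}" "\<tau> \<omega> = \<sigma> j \<omega>" using \<tau> \<omega> unfolding G_def by blast
    then show ?thesis using orderedD[OF ord, of j i \<omega>] i \<omega> by auto
  qed
  have "\<exists>\<tau>. \<tau> \<in> G i \<and> (\<forall>\<rho>\<in>G i. AE \<omega> in M. \<tau> \<omega> \<le> \<rho> \<omega>)" if i: "i \<in> {1..n}" for i
    unfolding Bex_def[symmetric]
  proof (rule least_time_exists[OF D])
    show "G i \<subseteq> times D" by (auto simp: G_def)
    have "\<sigma> i \<in> G i" using \<sigma>[OF i] i by (auto simp: G_def)
    then show "G i \<noteq> {}" by auto
    fix s :: "nat \<Rightarrow> 'a \<Rightarrow> real" assume s: "\<And>k. s k \<in> G i"
    then have st: "\<And>k. s k \<in> times D" by (auto simp: G_def)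
    have "AE \<omega> in M. \<forall>k. emeasure \<mu> {s k \<omega><..\<sigma> i \<omega>} = 0"
      using s by (simp add: G_def AE_all_countable)
    then have "AE \<omega> in M. emeasure \<mu> {(INF k. s k \<omega>)<..\<sigma> i \<omega>} = 0"
      using AE_space
    proof eventually_elim
      case (elim \<omega>)
      then show ?case using times_Inf(2)[where s=s, OF D st elim(2)] by auto
    qed
    moreover have "\<exists>j\<in>{1..i}. (INF k. s k \<omega>) = \<sigma> j \<omega>" if \<omega>: "\<omega> \<in> space M" for \<omega>
    proof -
      obtain k where "(INF k. s k \<omega>) = s k \<omega>" using times_Inf(2)[where s=s, OF D st \<omega>] by auto
      then show ?thesis using s[of k] \<omega> unfolding G_def by auto
    qed
    ultimately show "(\<lambda>\<omega>. INF k. s k \<omega>) \<in> G i" using times_Inf(1)[where s=s, OF D st] by (simp add: G_def)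
  qed
  then obtain \<tau>0 where \<tau>0: "\<And>i. i \<in> {1..n} \<Longrightarrow> \<tau>0 i \<in> G i"
    "\<And>i \<rho>. i \<in> {1..n} \<Longrightarrow> \<rho> \<in> G i \<Longrightarrow> AE \<omega> in M. \<tau>0 i \<omega> \<le> \<rho> \<omega>" by metis
  have "AE \<omega> in M. \<forall>i\<in>{1..n}. \<forall>j\<in>{1..n}. i \<le> j \<longrightarrow> \<tau>0 i \<omega> \<le> \<tau>0 j \<omega>"
  proof (intro AE_finite_allI finite_atLeastAtMost)
    fix i j assume ij: "i \<in> {1..n}" "j \<in> {1..n}"
    show "AE \<omega> in M. i \<le> j \<longrightarrow> \<tau>0 i \<omega> \<le> \<tau>0 j \<omega>"
    proof (cases "i \<le> j")
      case True
      \<comment> \<open>What the clock does not tell apart from \<open>\<sigma> j\<close> it does not tell apart from \<open>\<sigma> i\<close> when cut off there.\<close>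
      let ?m = "\<lambda>\<omega>. min (\<tau>0 j \<omega>) (\<sigma> i \<omega>)"
      have t: "\<tau>0 j \<in> times D" using \<tau>0(1)[OF ij(2)] by (auto simp: G_def)
      have "?m \<in> G i"
        unfolding G_def
      proof (intro CollectI conjI ballI)
        show "?m \<in> times D" by (rule times_min[OF t \<sigma>[OF ij(1)]])
        show "\<exists>l\<in>{1..i}. ?m \<omega> = \<sigma> l \<omega>" if \<omega>: "\<omega> \<in> space M" for \<omega>
        proof -
          obtain l where l: "l \<in> {1..j}" "\<tau>0 j \<omega> = \<sigma> l \<omega>" using \<tau>0(1)[OF ij(2)] \<omega> unfolding G_def by auto
          show ?thesis
          proof (cases "l \<le> i")
            case True
            then have "\<sigma> l \<omega> \<le> \<sigma> i \<omega>" using orderedD[OF ord, of l i \<omega>] l ij \<omega> by auto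
            then show ?thesis using l True by (auto simp: min_def)
          next
            case False
            then have "\<sigma> i \<omega> \<le> \<sigma> l \<omega>" using orderedD[OF ord, of i l \<omega>] l ij \<omega> by auto
            then show ?thesis using l ij by (auto simp: min_def)
          qed
        qed
        have "AE \<omega> in M. emeasure \<mu> {\<tau>0 j \<omega><..\<sigma> j \<omega>} = 0" using \<tau>0(1)[OF ij(2)] by (simp add: G_def)
        then show "AE \<omega> in M. emeasure \<mu> {?m \<omega><..\<sigma> i \<omega>} = 0"
          using AE_space
        proof eventually_elim
          case (elim \<omega>)
          have "\<sigma> i \<omega> \<le> \<sigma> j \<omega>" using orderedD[OF ord, of i j \<omega>] True ij elim by auto
          then show ?case
            using elim timesD(3)[OF t] timesD(4)[OF \<sigma>[OF ij(2)]]
            by (cases "\<tau>0 j \<omega> \<le> \<sigma> i \<omega>") (auto simp: min_def intro!: interval_null_mono[of "\<tau>0 j \<omega>" "\<sigma> j \<omega>"])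
        qed
      qed
      from \<tau>0(2)[OF ij(1) this] show ?thesis by eventually_elim auto
    qed auto
  qed
  then obtain \<tau> where \<tau>: "\<And>i. i \<in> {1..n} \<Longrightarrow> \<tau> i \<in> times D" "ordered n \<tau>"
    and eq: "AE \<omega> in M. \<forall>i\<in>{1..n}. \<tau>0 i \<omega> = \<tau> i \<omega>"
    and graph: "\<And>i \<omega>. i \<in> {1..n} \<Longrightarrow> \<exists>j\<in>{1..i}. \<tau> i \<omega> = \<tau>0 j \<omega>"
    using ordered_version[of n \<tau>0 D] \<tau>0(1) by (auto simp: G_def)
  have \<tau>G: "\<tau> i \<in> G i" if i: "i \<in> {1..n}" for i
    unfolding G_def
  proof (intro CollectI conjI ballI \<tau>(1) i)
    fix \<omega> assume \<omega>: "\<omega> \<in> space M"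
    obtain j where j: "j \<in> {1..i}" "\<tau> i \<omega> = \<tau>0 j \<omega>" using graph[OF i, of \<omega>] by auto
    then have "\<tau>0 j \<in> G j" using i by (intro \<tau>0(1)) auto
    then obtain l where "l \<in> {1..j}" "\<tau>0 j \<omega> = \<sigma> l \<omega>" using \<omega> unfolding G_def by auto
    then show "\<exists>j\<in>{1..i}. \<tau> i \<omega> = \<sigma> j \<omega>" using j by (intro bexI[of _ l]) auto
  next
    have "AE \<omega> in M. emeasure \<mu> {\<tau>0 i \<omega><..\<sigma> i \<omega>} = 0" using \<tau>0(1)[OF i] by (simp add: G_def)
    then show "AE \<omega> in M. emeasure \<mu> {\<tau> i \<omega><..\<sigma> i \<omega>} = 0"
      using eq by eventually_elim (use i in auto)
  qed
  have least: "AE \<omega> in M. \<tau> i \<omega> \<le> \<rho> \<omega>" if "i \<in> {1..n}" "\<rho> \<in> G i" for i \<rho>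
    using \<tau>0(2)[OF that] eq by eventually_elim (use that in auto)
  have "separated n \<tau>"
    unfolding separated_def
  proof (intro ballI impI)
    fix k B assume k: "k \<in> {1..<n}" and B: "B \<in> sets (pre_sigma (\<tau> k))"
      and AEB: "AE \<omega> in M. \<omega> \<in> B \<longrightarrow> \<tau> k \<omega> < \<tau> (Suc k) \<omega> \<and> emeasure \<mu> {\<tau> k \<omega><..\<tau> (Suc k) \<omega>} = 0"
    have k': "k \<in> {1..n}" "Suc k \<in> {1..n}" using k by auto
    have S: "\<tau> k \<in> times D" "\<tau> (Suc k) \<in> times D" using \<tau>(1) k' by auto
    have le: "\<tau> k \<omega> \<le> \<tau> (Suc k) \<omega>" if "\<omega> \<in> space M" for \<omega>
      using orderedD[OF \<tau>(2), of k "Suc k" \<omega>] k that by auto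
    let ?s = "\<lambda>\<omega>. if \<omega> \<in> B then \<tau> k \<omega> else \<tau> (Suc k) \<omega>"
    have "?s \<in> G (Suc k)"
      unfolding G_def
    proof (intro CollectI conjI ballI)
      show "?s \<in> times D" by (rule switch_times[OF S le B])
      show "\<exists>j\<in>{1..Suc k}. ?s \<omega> = \<sigma> j \<omega>" if \<omega>: "\<omega> \<in> space M" for \<omega>
      proof -
        obtain j1 j2 where "j1 \<in> {1..k}" "\<tau> k \<omega> = \<sigma> j1 \<omega>" "j2 \<in> {1..Suc k}" "\<tau> (Suc k) \<omega> = \<sigma> j2 \<omega>"
          using \<tau>G[OF k'(1)] \<tau>G[OF k'(2)] \<omega> unfolding G_def by blast
        then show ?thesis by (intro bexI[of _ "if \<omega> \<in> B then j1 else j2"]) auto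
      qed
      have "AE \<omega> in M. emeasure \<mu> {\<tau> (Suc k) \<omega><..\<sigma> (Suc k) \<omega>} = 0"
        using \<tau>G[OF k'(2)] by (simp add: G_def)
      then show "AE \<omega> in M. emeasure \<mu> {?s \<omega><..\<sigma> (Suc k) \<omega>} = 0"
        using AEB AE_space
      proof eventually_elim
        case (elim \<omega>)
        have "0 \<le> \<tau> k \<omega>" "\<sigma> (Suc k) \<omega> \<le> T" using timesD(3)[OF S(1)] timesD(4)[OF \<sigma>[OF k'(2)]] elim by auto
        then show ?case
          using interval_null_trans[of "\<tau> k \<omega>" "\<sigma> (Suc k) \<omega>" "\<tau> (Suc k) \<omega>"] elim le[of \<omega>]
            G_le[OF \<tau>G[OF k'(2)] k'(2), of \<omega>] by (cases "\<omega> \<in> B") auto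
      qed
    qed
    from least[OF k'(2) this] AEB have "AE \<omega> in M. \<omega> \<notin> B"
      by eventually_elim (auto split: if_splits)
    then show "emeasure M B = 0"
      using pre_sigma_into_M[OF S(1) B]
      by (subst (asm) AE_iff_measurable[of B]) (auto dest: sets.sets_into_space)
  qed
  with \<tau> have "\<tau> \<in> chains D n" by (simp add: chains_def)
  moreover have "(\<forall>\<omega>\<in>space M. \<exists>j\<in>{1..i}. \<tau> i \<omega> = \<sigma> j \<omega>) \<and> (AE \<omega> in M. emeasure \<mu> {\<tau> i \<omega><..\<sigma> i \<omega>} = 0)"
    if "i \<in> {1..n}" for i
    using \<tau>G[OF that] by (simp add: G_def)
  ultimately show ?thesis by blast
qed

text \<open>
  Moving down costs nothing in the limit: if it happened infinitely often at \<open>\<sigma> m j\<close> with positive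
  probability, the clock would stand still between the limits \<open>\<tau> j\<close> and \<open>\<tau> (j + 1)\<close> on an event that is
  known at \<open>\<tau> j\<close>.
\<close>

lemma separated_approximation:
  assumes \<tau>: "\<tau> \<in> chains {0..T} n"
    and \<sigma>: "\<And>m i. i \<in> {1..n} \<Longrightarrow> \<sigma> m i \<in> times {0..T}" and ord: "\<And>m. ordered n (\<sigma> m)"
    and lim: "\<And>i \<omega>. i \<in> {1..n} \<Longrightarrow> \<omega> \<in> space M \<Longrightarrow> (\<lambda>m. \<sigma> m i \<omega>) \<longlonglongrightarrow> \<tau> i \<omega>"
    and above: "\<And>m i \<omega>. i \<in> {1..n} \<Longrightarrow> \<omega> \<in> space M \<Longrightarrow> \<tau> i \<omega> \<le> \<sigma> m i \<omega>"
    and mono: "\<And>m i j \<omega>. i \<in> {1..n} \<Longrightarrow> j \<in> {1..n} \<Longrightarrow> \<omega> \<in> space M \<Longrightarrow> \<tau> j \<omega> \<le> \<tau> i \<omega> \<Longrightarrow> \<sigma> m j \<omega> \<le> \<sigma> m i \<omega>"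
    and \<tau>': "\<And>m i. i \<in> {1..n} \<Longrightarrow> \<tau>' m i \<in> times {0..T}"
    and graph: "\<And>m i \<omega>. i \<in> {1..n} \<Longrightarrow> \<omega> \<in> space M \<Longrightarrow> \<exists>j\<in>{1..i}. \<tau>' m i \<omega> = \<sigma> m j \<omega>"
    and null: "\<And>m i. i \<in> {1..n} \<Longrightarrow> AE \<omega> in M. emeasure \<mu> {\<tau>' m i \<omega><..\<sigma> m i \<omega>} = 0"
  shows "AE \<omega> in M. \<forall>i\<in>{1..n}. \<forall>\<^sub>F m in sequentially. \<tau>' m i \<omega> = \<sigma> m i \<omega>"
proof (intro AE_finite_allI finite_atLeastAtMost)
  fix i assume i: "i \<in> {1..n}"
  have sep: "\<forall>k\<in>{1..<n}. \<forall>B\<in>sets (pre_sigma (\<tau> k)).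
     (AE \<omega> in M. \<omega> \<in> B \<longrightarrow> \<tau> k \<omega> < \<tau> (Suc k) \<omega> \<and> emeasure \<mu> {\<tau> k \<omega><..\<tau> (Suc k) \<omega>} = 0) \<longrightarrow>
     emeasure M B = 0"
    using \<tau> by (simp add: chains_def separated_def)
  have S: "\<tau> j \<in> times {0..T}" if "j \<in> {1..n}" for j using \<tau> that by (auto simp: chains_def)
  define B where "B j m = {\<omega>\<in>space M. \<sigma> m j \<omega> = \<tau>' m i \<omega>} \<inter> {\<omega>\<in>space M. \<sigma> m j \<omega> < \<sigma> m (Suc j) \<omega>}" for j m
  have "AE \<omega> in M. \<forall>j\<in>{1..<i}. \<forall>\<^sub>F m in sequentially. \<omega> \<notin> B j m"
  proof (intro AE_finite_allI finite_atLeastLessThan)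
    fix j assume j: "j \<in> {1..<i}"
    then have j': "j \<in> {1..n}" "Suc j \<in> {1..n}" "j \<in> {1..<n}" using i by auto
    define A where "A = {\<omega>\<in>space M. \<forall>N. \<exists>m\<ge>N. \<omega> \<in> B j m}"
    have A: "A \<in> sets (pre_sigma (\<tau> j))"
      unfolding A_def
    proof (rule limsup_pre_sigma[OF \<sigma>[OF j'(1)] S[OF j'(1)] lim[OF j'(1)]])
      show "B j m \<in> sets (pre_sigma (\<sigma> m j))" for m
        unfolding B_def
        by (intro sets.Int coincidence_pre_sigma[OF \<sigma>[OF j'(1)] \<tau>'[OF i]] less_pre_sigma[OF \<sigma>[OF j'(1)] \<sigma>[OF j'(2)]])
    qed
    have "AE \<omega> in M. \<forall>m. emeasure \<mu> {\<tau>' m i \<omega><..\<sigma> m i \<omega>} = 0"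
      using null[OF i] by (simp add: AE_all_countable)
    then have "AE \<omega> in M. \<omega> \<in> A \<longrightarrow> \<tau> j \<omega> < \<tau> (Suc j) \<omega> \<and> emeasure \<mu> {\<tau> j \<omega><..\<tau> (Suc j) \<omega>} = 0"
      using AE_space
    proof eventually_elim
      case (elim \<omega>)
      show ?case
      proof (intro impI conjI)
        assume inA: "\<omega> \<in> A"
        note \<omega> = elim(2)
        obtain m where "\<omega> \<in> B j m" using inA unfolding A_def by auto
        then show "\<tau> j \<omega> < \<tau> (Suc j) \<omega>"
          using mono[OF j'(1,2) \<omega>, of m] by (cases "\<tau> (Suc j) \<omega> \<le> \<tau> j \<omega>") (auto simp: B_def)
        let ?I = "{m. \<omega> \<in> B j m}"
        have nul: "{\<sigma> m j \<omega><..\<tau> (Suc j) \<omega>} \<in> null_sets \<mu>" if "m \<in> ?I" for m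
        proof -
          have "\<sigma> m j \<omega> = \<tau>' m i \<omega>" using that by (auto simp: B_def)
          moreover have "\<tau> (Suc j) \<omega> \<le> \<sigma> m i \<omega>"
            using above[OF j'(2) \<omega>, of m] orderedD[OF ord[of m], of "Suc j" i \<omega>] j i \<omega> by auto
          moreover have "0 \<le> \<sigma> m j \<omega>" "\<sigma> m i \<omega> \<le> T" "\<tau> (Suc j) \<omega> \<le> T"
            using timesD(3)[OF \<sigma>[OF j'(1)] \<omega>] timesD(4)[OF \<sigma>[OF i] \<omega>] timesD(4)[OF S[OF j'(2)] \<omega>] by auto
          moreover have z: "emeasure \<mu> {\<tau>' m i \<omega><..\<sigma> m i \<omega>} = 0" using elim(1) by blast
          ultimately have "emeasure \<mu> {\<sigma> m j \<omega><..\<tau> (Suc j) \<omega>} = 0"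
            by (intro interval_null_mono[OF z]) auto
          then show ?thesis using \<open>0 \<le> \<sigma> m j \<omega>\<close> \<open>\<tau> (Suc j) \<omega> \<le> T\<close> by (intro null_setsI) auto
        qed
        have "{\<tau> j \<omega><..\<tau> (Suc j) \<omega>} = (\<Union>m\<in>?I. {\<sigma> m j \<omega><..\<tau> (Suc j) \<omega>})"
        proof (intro set_eqI iffI)
          fix s assume s: "s \<in> {\<tau> j \<omega><..\<tau> (Suc j) \<omega>}"
          then have "\<forall>\<^sub>F m in sequentially. \<sigma> m j \<omega> < s" using order_tendstoD(2)[OF lim[OF j'(1) \<omega>]] by auto
          then obtain N where N: "\<And>m. N \<le> m \<Longrightarrow> \<sigma> m j \<omega> < s" by (auto simp: eventually_sequentially)
          obtain m where "N \<le> m" "\<omega> \<in> B j m" using inA unfolding A_def by auto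
          then show "s \<in> (\<Union>m\<in>?I. {\<sigma> m j \<omega><..\<tau> (Suc j) \<omega>})" using N[of m] s by auto
        next
          fix s assume "s \<in> (\<Union>m\<in>?I. {\<sigma> m j \<omega><..\<tau> (Suc j) \<omega>})"
          then obtain m where "\<sigma> m j \<omega> < s" "s \<le> \<tau> (Suc j) \<omega>" by auto
          then show "s \<in> {\<tau> j \<omega><..\<tau> (Suc j) \<omega>}" using above[OF j'(1) \<omega>, of m] by auto
        qed
        moreover have "(\<Union>m\<in>?I. {\<sigma> m j \<omega><..\<tau> (Suc j) \<omega>}) \<in> null_sets \<mu>"
          by (rule null_sets_UN'[OF countableI_type nul])
        ultimately show "emeasure \<mu> {\<tau> j \<omega><..\<tau> (Suc j) \<omega>} = 0" by (simp only: null_setsD1)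
      qed
    qed
    then have "emeasure M A = 0" by (rule sep[THEN bspec, OF j'(3), THEN bspec, OF A, THEN mp])
    then have "AE \<omega> in M. \<omega> \<notin> A"
      using pre_sigma_into_M[OF S[OF j'(1)] A] by (intro AE_I[of _ _ A]) auto
    then show "AE \<omega> in M. \<forall>\<^sub>F m in sequentially. \<omega> \<notin> B j m"
      using AE_space
    proof eventually_elim
      case (elim \<omega>)
      then obtain N where "\<forall>m\<ge>N. \<omega> \<notin> B j m" unfolding A_def by blast
      then show ?case unfolding eventually_sequentially by blast
    qed
  qed
  then show "AE \<omega> in M. \<forall>\<^sub>F m in sequentially. \<tau>' m i \<omega> = \<sigma> m i \<omega>"
    using AE_space
  proof eventually_elim
    case (elim \<omega>)
    have "\<forall>\<^sub>F m in sequentially. \<forall>j\<in>{1..<i}. \<omega> \<notin> B j m"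
      using elim(1) by (intro eventually_ball_finite) auto
    then show ?case
    proof (rule eventually_mono)
      fix m assume notB: "\<forall>j\<in>{1..<i}. \<omega> \<notin> B j m"
      obtain l where l: "l \<in> {1..i}" "\<tau>' m i \<omega> = \<sigma> m l \<omega>" using graph[OF i elim(2), of m] by auto
      then have "l \<le> i" by auto
      then have "\<sigma> m i \<omega> = \<tau>' m i \<omega>"
      proof (rule dec_induct[where P="\<lambda>j. \<sigma> m j \<omega> = \<tau>' m i \<omega>"])
        fix j assume j: "l \<le> j" "j < i" "\<sigma> m j \<omega> = \<tau>' m i \<omega>"
        then have "\<omega> \<notin> B j m" using notB l by auto
        moreover have "\<sigma> m j \<omega> \<le> \<sigma> m (Suc j) \<omega>"
          using orderedD[OF ord[of m], of j "Suc j" \<omega>] j l i elim(2) by auto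
        ultimately show "\<sigma> m (Suc j) \<omega> = \<tau>' m i \<omega>" using j(3) elim(2) by (auto simp: B_def)
      qed (use l in simp)
      then show "\<tau>' m i \<omega> = \<sigma> m i \<omega>" by simp
    qed
  qed
qed

end

section \<open>Convergence of the values of chains\<close>

text \<open>
  The bound \<open>S\<close> is not required to be measurable, as a supremum over uncountably many dates may fail
  to be; \<open>nn_integral\<close> is monotone nevertheless.
\<close>

lemma nn_integral_finite_bound:
  assumes X: "X \<in> borel_measurable M" and le: "\<And>\<omega>. \<omega> \<in> space M \<Longrightarrow> X \<omega> \<le> ennreal c * S \<omega>"
    and c: "0 \<le> c" and S: "(\<integral>\<^sup>+\<omega>. S \<omega> \<partial>M) < \<infinity>"
  shows "(\<integral>\<^sup>+\<omega>. X \<omega> \<partial>M) < \<infinity>"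
proof -
  have one: "ennreal (c + 1) * ennreal (1 / (c + 1)) = 1"
    using c by (subst ennreal_mult[symmetric]) auto
  have "(\<integral>\<^sup>+\<omega>. X \<omega> \<partial>M) = (\<integral>\<^sup>+\<omega>. ennreal (c + 1) * (ennreal (1 / (c + 1)) * X \<omega>) \<partial>M)"
    by (simp only: mult.assoc[symmetric] one mult_1)
  also have "\<dots> = ennreal (c + 1) * (\<integral>\<^sup>+\<omega>. ennreal (1 / (c + 1)) * X \<omega> \<partial>M)"
    using X by (intro nn_integral_cmult) auto
  also have "\<dots> \<le> ennreal (c + 1) * (\<integral>\<^sup>+\<omega>. S \<omega> \<partial>M)"
  proof (intro mult_left_mono nn_integral_mono)
    fix \<omega> assume "\<omega> \<in> space M"
    then have "ennreal (1 / (c + 1)) * X \<omega> \<le> ennreal (1 / (c + 1)) * (ennreal c * S \<omega>)"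
      using le by (intro mult_left_mono) auto
    also have "\<dots> = ennreal (c / (c + 1)) * S \<omega>"
      using c by (simp add: mult.assoc[symmetric] ennreal_mult[symmetric])
    also have "\<dots> \<le> 1 * S \<omega>" using c by (intro mult_right_mono) auto
    finally show "ennreal (1 / (c + 1)) * X \<omega> \<le> S \<omega>" by simp
  qed simp
  also have "\<dots> < \<infinity>" using S by (simp add: ennreal_mult_less_top)
  finally show ?thesis .
qed

context clock begin

lemma section_measurable:
  assumes "(\<lambda>(s, \<omega>). u s \<omega>) \<in> borel_measurable (\<mu> \<Otimes>\<^sub>M M)" "\<omega> \<in> space M"
  shows "(\<lambda>s. u s \<omega> :: real) \<in> borel_measurable \<mu>"
  using measurable_compose[OF measurable_Pair2'[OF assms(2), of \<mu>] assms(1)] by simp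

lemma nn_section_measurable:
  assumes "(\<lambda>(s, \<omega>). u s \<omega>) \<in> borel_measurable (\<mu> \<Otimes>\<^sub>M M)"
  shows "(\<lambda>\<omega>. \<integral>\<^sup>+s. ennreal \<bar>u s \<omega>\<bar> \<partial>\<mu>) \<in> borel_measurable M"
proof -
  have "(\<lambda>(\<omega>, s). u s \<omega>) \<in> borel_measurable (M \<Otimes>\<^sub>M \<mu>)"
    using assms by (subst measurable_pair_swap_iff) simp
  then have "(\<lambda>(\<omega>, s). ennreal \<bar>u s \<omega>\<bar>) \<in> borel_measurable (M \<Otimes>\<^sub>M \<mu>)"
    by (simp add: case_prod_beta')
  from clock.borel_measurable_nn_integral[OF this] show ?thesis by simp
qed

lemma nn_section_le:
  assumes S: "\<And>s. s \<in> {0..T} \<Longrightarrow> ennreal \<bar>v s\<bar> \<le> c"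
  shows "(\<integral>\<^sup>+s. ennreal \<bar>v s\<bar> \<partial>\<mu>) \<le> ennreal (measure \<mu> (space \<mu>)) * c"
proof -
  have "(\<integral>\<^sup>+s. ennreal \<bar>v s\<bar> \<partial>\<mu>) \<le> (\<integral>\<^sup>+s. c \<partial>\<mu>)"
    using S by (intro nn_integral_mono) (simp add: space_clock)
  also have "\<dots> = ennreal (measure \<mu> (space \<mu>)) * c"
    by (simp add: clock.emeasure_eq_measure mult.commute)
  finally show ?thesis .
qed

lemma rate_of_dominated:
  assumes u: "(\<lambda>(s, \<omega>). u s \<omega>) \<in> borel_measurable (\<mu> \<Otimes>\<^sub>M M)"
    and le: "\<And>s \<omega>. s \<in> {0..T} \<Longrightarrow> \<omega> \<in> space M \<Longrightarrow> ennreal \<bar>u s \<omega>\<bar> \<le> S \<omega>"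
    and S: "(\<integral>\<^sup>+\<omega>. S \<omega> \<partial>M) < \<infinity>"
  shows "rate u"
  by (rule rateI[OF u])
    (rule nn_integral_finite_bound[OF nn_section_measurable[OF u] nn_section_le _ S], use le in auto)

lemma rate_expectation:
  assumes u: "rate u"
  shows "ennreal (\<integral>\<omega>. (\<integral>s. \<bar>u s \<omega>\<bar> \<partial>\<mu>) \<partial>M) = (\<integral>\<^sup>+\<omega>. (\<integral>\<^sup>+s. ennreal \<bar>u s \<omega>\<bar> \<partial>\<mu>) \<partial>M)"
proof -
  have "(\<integral>\<^sup>+\<omega>. (\<integral>\<^sup>+s. ennreal \<bar>u s \<omega>\<bar> \<partial>\<mu>) \<partial>M) = (\<integral>\<^sup>+\<omega>. ennreal (\<integral>s. \<bar>u s \<omega>\<bar> \<partial>\<mu>) \<partial>M)"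
    using rate_AE[OF u] by (intro nn_integral_cong_AE) (auto intro!: nn_integral_eq_integral elim!: eventually_mono)
  also have "\<dots> = ennreal (\<integral>\<omega>. (\<integral>s. \<bar>u s \<omega>\<bar> \<partial>\<mu>) \<partial>M)"
    by (intro nn_integral_eq_integral rate_integrable rate_abs u) auto
  finally show ?thesis by simp
qed

end

context atomless_clock begin

lemma roundup_joint_measurable:
  assumes p: "is_partition T m p" and u: "(\<lambda>(s, \<omega>). u s \<omega>) \<in> borel_measurable (\<mu> \<Otimes>\<^sub>M M)"
  shows "(\<lambda>(s, \<omega>). u (roundup m p s) \<omega> :: real) \<in> borel_measurable (\<mu> \<Otimes>\<^sub>M M)"
proof -
  have "(\<lambda>z. (roundup m p (fst z), snd z)) \<in> measurable (\<mu> \<Otimes>\<^sub>M M) (\<mu> \<Otimes>\<^sub>M M)"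
    by (intro measurable_Pair measurable_compose[OF measurable_fst roundup_measurable[OF p]] measurable_snd)
  from measurable_compose[OF this u] show ?thesis by (simp add: case_prod_beta')
qed

lemma roundup_rate:
  assumes p: "is_partition T m p" and u: "(\<lambda>(s, \<omega>). u s \<omega>) \<in> borel_measurable (\<mu> \<Otimes>\<^sub>M M)"
    and le: "\<And>s \<omega>. s \<in> {0..T} \<Longrightarrow> \<omega> \<in> space M \<Longrightarrow> ennreal \<bar>u s \<omega>\<bar> \<le> S \<omega>"
    and S: "(\<integral>\<^sup>+\<omega>. S \<omega> \<partial>M) < \<infinity>"
  shows "rate (\<lambda>s \<omega>. u (roundup m p s) \<omega>)" "clock.rate M (grid_measure \<mu> m p) u"
proof -
  have r: "roundup m p s \<in> {0..T}" if "s \<in> {0..T}" for s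
    using measurable_space[OF roundup_measurable[OF p]] that by (simp add: space_clock)
  show "rate (\<lambda>s \<omega>. u (roundup m p s) \<omega>)"
    by (rule rate_of_dominated[OF roundup_joint_measurable[OF p u] _ S]) (use le r in auto)
  interpret G: clock M F T "grid_measure \<mu> m p" by (rule grid_clock[OF p])
  have "sets (grid_measure \<mu> m p) = sets \<mu>" by (simp add: grid_measure_def)
  from measurable_cong_sets[OF sets_pair_measure_cong[OF this refl] refl]
  have "(\<lambda>(s, \<omega>). u s \<omega>) \<in> borel_measurable (grid_measure \<mu> m p \<Otimes>\<^sub>M M)" using u by blast
  from G.rate_of_dominated[OF this le S] show "G.rate u" .
qed

text \<open>
  Dominated convergence. The bound \<open>S\<close> cannot serve as dominating function unless it is measurable,
  but the supremum of the countably many deviations can, and it inherits the bound.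
\<close>

lemma deviation_tendsto:
  assumes p: "\<And>m. is_partition T (N m) (p m)"
    and u: "(\<lambda>(s, \<omega>). u s \<omega>) \<in> borel_measurable (\<mu> \<Otimes>\<^sub>M M)" "rate u"
    and le: "\<And>s \<omega>. s \<in> {0..T} \<Longrightarrow> \<omega> \<in> space M \<Longrightarrow> ennreal \<bar>u s \<omega>\<bar> \<le> S \<omega>"
    and S: "(\<integral>\<^sup>+\<omega>. S \<omega> \<partial>M) < \<infinity>"
    and lim: "AE \<omega> in M. (\<lambda>m. \<Sum>j=1..N m. \<integral>\<^sup>+s\<in>{p m (j - 1)<..p m j}. ennreal \<bar>u s \<omega> - u (p m j) \<omega>\<bar> \<partial>\<mu>) \<longlonglongrightarrow> 0"
  shows "(\<lambda>m. \<integral>\<omega>. (\<integral>s. \<bar>u s \<omega> - u (roundup (N m) (p m) s) \<omega>\<bar> \<partial>\<mu>) \<partial>M) \<longlonglongrightarrow> 0"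
proof -
  let ?r = "\<lambda>m. roundup (N m) (p m)"
  have d: "rate (\<lambda>s \<omega>. u s \<omega> - u (?r m s) \<omega>)" for m
    by (intro rate_diff u(2) roundup_rate(1)[OF p u(1) le S])
  define X where "X m \<omega> = (\<integral>\<^sup>+s. ennreal \<bar>u s \<omega> - u (?r m s) \<omega>\<bar> \<partial>\<mu>)" for m \<omega>
  have X: "X m \<in> borel_measurable M" for m
    unfolding X_def[abs_def] by (rule nn_section_measurable[OF rate_measurable[OF d]])
  have X_le: "X m \<omega> \<le> ennreal (2 * measure \<mu> (space \<mu>)) * S \<omega>" if \<omega>: "\<omega> \<in> space M" for m \<omega>
  proof -
    have "ennreal \<bar>u s \<omega> - u (?r m s) \<omega>\<bar> \<le> 2 * S \<omega>" if s: "s \<in> {0..T}" for s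
    proof -
      have r: "?r m s \<in> {0..T}"
        using measurable_space[OF roundup_measurable[OF p[of m]]] s by (simp add: space_clock)
      have "ennreal \<bar>u s \<omega> - u (?r m s) \<omega>\<bar> \<le> ennreal (\<bar>u s \<omega>\<bar> + \<bar>u (?r m s) \<omega>\<bar>)" by (intro ennreal_leI) simp
      also have "\<dots> = ennreal \<bar>u s \<omega>\<bar> + ennreal \<bar>u (?r m s) \<omega>\<bar>" by (simp add: ennreal_plus)
      also have "\<dots> \<le> S \<omega> + S \<omega>" using le[OF s \<omega>] le[OF r \<omega>] by (rule add_mono)
      finally show ?thesis by (simp add: mult_2)
    qed
    then have "X m \<omega> \<le> ennreal (measure \<mu> (space \<mu>)) * (2 * S \<omega>)"
      unfolding X_def by (rule nn_section_le)
    then show ?thesis by (simp add: ennreal_mult mult.assoc mult.left_commute)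
  qed
  have "(\<lambda>m. \<integral>\<^sup>+\<omega>. X m \<omega> \<partial>M) \<longlonglongrightarrow> (\<integral>\<^sup>+\<omega>. 0 \<partial>M)"
  proof (rule nn_integral_dominated_convergence[where w="\<lambda>\<omega>. SUP m. X m \<omega>"])
    show w: "(\<lambda>\<omega>. SUP m. X m \<omega>) \<in> borel_measurable M" using X by (intro borel_measurable_SUP) auto
    show "AE \<omega> in M. X m \<omega> \<le> (SUP m. X m \<omega>)" for m by (intro AE_I2 SUP_upper) simp
    show "(\<integral>\<^sup>+\<omega>. (SUP m. X m \<omega>) \<partial>M) < \<infinity>"
      by (rule nn_integral_finite_bound[OF w SUP_least[OF X_le] _ S]) auto
    show "AE \<omega> in M. (\<lambda>m. X m \<omega>) \<longlonglongrightarrow> 0"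
      using lim AE_space
    proof eventually_elim
      case (elim \<omega>)
      have "X m \<omega> = (\<Sum>j=1..N m. \<integral>\<^sup>+s\<in>{p m (j - 1)<..p m j}. ennreal \<bar>u s \<omega> - u (p m j) \<omega>\<bar> \<partial>\<mu>)" for m
        unfolding X_def by (rule deviation_eq_cells[OF p section_measurable[OF u(1) elim(2)]])
      then show ?case using elim(1) by (simp only:)
    qed
  qed (use X in auto)
  then have "(\<lambda>m. ennreal (\<integral>\<omega>. (\<integral>s. \<bar>u s \<omega> - u (?r m s) \<omega>\<bar> \<partial>\<mu>) \<partial>M)) \<longlonglongrightarrow> 0"
    unfolding rate_expectation[OF d] X_def by simp
  then show ?thesis by (subst (asm) ennreal_tendsto_0_iff) auto
qed

end

lemma marginal_wage_diff:
  "marginal_wage n f \<tau> s \<omega> - marginal_wage n f' \<tau> s \<omega> = marginal_wage n (\<lambda>i s \<omega>. f i s \<omega> - f' i s \<omega>) \<tau> s \<omega>"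
  unfolding marginal_wage_def by (simp add: sum_subtractf[symmetric] algebra_simps)

lemma wage_bound_le_sum:
  assumes "1 \<le> n"
  shows "wage_bound n f s \<omega> \<le> 4 * (\<Sum>i=1..n. \<bar>f i s \<omega>\<bar>)"
proof -
  let ?S = "\<Sum>i=1..n. \<bar>f i s \<omega>\<bar>"
  have "\<bar>f 1 s \<omega>\<bar> \<le> ?S" "\<bar>f n s \<omega>\<bar> \<le> ?S" using assms by (intro member_le_sum; auto)+
  moreover have "(\<Sum>k\<in>{1..<n}. \<bar>f k s \<omega>\<bar>) \<le> ?S" by (intro sum_mono2) auto
  moreover have "(\<Sum>k\<in>{1..<n}. \<bar>f (Suc k) s \<omega>\<bar>) = (\<Sum>i\<in>Suc ` {1..<n}. \<bar>f i s \<omega>\<bar>)"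
    by (subst sum.reindex) auto
  moreover have "(\<Sum>i\<in>Suc ` {1..<n}. \<bar>f i s \<omega>\<bar>) \<le> ?S" by (intro sum_mono2) auto
  ultimately show ?thesis unfolding wage_bound_def by (simp add: sum.distrib)
qed

context principal_agent begin

text \<open>
  The marginal wage is linear in the rates, so the value of a fixed chain is Lipschitz continuous in
  them.
\<close>

lemma chain_value_lipschitz:
  assumes \<tau>: "\<And>i. i \<in> {1..n} \<Longrightarrow> \<tau> i \<in> times D"
    and f': "\<And>i. i \<in> {1..n} \<Longrightarrow> A.rate (f' i)" and g': "\<And>i. i \<in> {1..n} \<Longrightarrow> P.rate (g' i)"
  shows "\<bar>W \<tau> - chain_value M T n \<mu>A \<mu>P f' g' \<xi> \<tau>\<bar> \<le>
    (\<Sum>i=1..n. \<integral>\<omega>. (\<integral>s. \<bar>g i s \<omega> - g' i s \<omega>\<bar> \<partial>\<mu>P) \<partial>M)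
    + real n * (4 * (\<Sum>i=1..n. \<integral>\<omega>. (\<integral>s. \<bar>f i s \<omega> - f' i s \<omega>\<bar> \<partial>\<mu>A) \<partial>M))"
proof -
  let ?h = "\<lambda>i s \<omega>. f i s \<omega> - f' i s \<omega>" and ?k = "\<lambda>i s \<omega>. g i s \<omega> - g' i s \<omega>"
  let ?w = "marginal_wage n f \<tau>" and ?w' = "marginal_wage n f' \<tau>"
  have h: "A.rate (?h i)" and k: "P.rate (?k i)" if "i \<in> {1..n}" for i
    by (rule A.rate_diff[OF f_rate[OF that] f'[OF that]], rule P.rate_diff[OF g_rate[OF that] g'[OF that]])
  have w: "A.rate ?w" by (rule marginal_wage_rate[OF \<tau>])
  have w': "A.rate ?w'"
    unfolding marginal_wage_def using n_pos
    by (intro A.rate_add A.rate_sum A.rate_cut A.rate_diff f' timesD(2)[OF \<tau>]) auto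
  let ?X = "\<lambda>\<omega>. \<Sum>i=1..n. (LINT s:{0..\<tau> i \<omega>}|\<mu>P. g i s \<omega>) - (LINT s:{\<tau> i \<omega><..T}|\<mu>A. ?w s \<omega>) - \<xi> \<omega>"
  let ?X' = "\<lambda>\<omega>. \<Sum>i=1..n. (LINT s:{0..\<tau> i \<omega>}|\<mu>P. g' i s \<omega>) - (LINT s:{\<tau> i \<omega><..T}|\<mu>A. ?w' s \<omega>) - \<xi> \<omega>"
  let ?b = "\<lambda>\<omega>. 4 * (\<Sum>i=1..n. \<integral>s. \<bar>?h i s \<omega>\<bar> \<partial>\<mu>A)"
  let ?B = "\<lambda>\<omega>. (\<Sum>i=1..n. \<integral>s. \<bar>?k i s \<omega>\<bar> \<partial>\<mu>P) + real n * ?b \<omega>"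
  have X: "integrable M ?X"
    using P.upto_integrable[OF g_rate \<tau>] A.after_integrable[OF w \<tau>] \<xi>_integrable
    by (intro Bochner_Integration.integrable_sum Bochner_Integration.integrable_diff) auto
  have X': "integrable M ?X'"
    using P.upto_integrable[OF g' \<tau>] A.after_integrable[OF w' \<tau>] \<xi>_integrable
    by (intro Bochner_Integration.integrable_sum Bochner_Integration.integrable_diff) auto
  have hi: "integrable M (\<lambda>\<omega>. \<integral>s. \<bar>?h i s \<omega>\<bar> \<partial>\<mu>A)" and ki: "integrable M (\<lambda>\<omega>. \<integral>s. \<bar>?k i s \<omega>\<bar> \<partial>\<mu>P)"
    if "i \<in> {1..n}" for i
    using A.rate_integrable[OF A.rate_abs[OF h[OF that]]] P.rate_integrable[OF P.rate_abs[OF k[OF that]]] by auto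
  have b: "integrable M ?b" by (intro integrable_mult_right Bochner_Integration.integrable_sum hi)
  have ksum: "integrable M (\<lambda>\<omega>. \<Sum>i=1..n. \<integral>s. \<bar>?k i s \<omega>\<bar> \<partial>\<mu>P)"
    by (intro Bochner_Integration.integrable_sum ki)
  have B: "integrable M ?B"
    by (intro Bochner_Integration.integrable_add ksum integrable_mult_right b)
  have "AE \<omega> in M. \<forall>i\<in>{1..n}. integrable \<mu>A (\<lambda>s. ?h i s \<omega>) \<and> integrable \<mu>P (\<lambda>s. g i s \<omega>) \<and> integrable \<mu>P (\<lambda>s. g' i s \<omega>)"
  proof (intro AE_finite_allI finite_atLeastAtMost)
    fix i assume i: "i \<in> {1..n}"
    show "AE \<omega> in M. integrable \<mu>A (\<lambda>s. ?h i s \<omega>) \<and> integrable \<mu>P (\<lambda>s. g i s \<omega>) \<and> integrable \<mu>P (\<lambda>s. g' i s \<omega>)"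
      using A.rate_AE[OF h[OF i]] P.rate_AE[OF g_rate[OF i]] P.rate_AE[OF g'[OF i]] by eventually_elim auto
  qed
  then have "AE \<omega> in M. \<bar>?X \<omega> - ?X' \<omega>\<bar> \<le> ?B \<omega>"
    using A.rate_AE[OF w] A.rate_AE[OF w'] AE_space
  proof eventually_elim
    case (elim \<omega>)
    have "\<bar>((LINT s:{0..\<tau> i \<omega>}|\<mu>P. g i s \<omega>) - (LINT s:{\<tau> i \<omega><..T}|\<mu>A. ?w s \<omega>) - \<xi> \<omega>)
        - ((LINT s:{0..\<tau> i \<omega>}|\<mu>P. g' i s \<omega>) - (LINT s:{\<tau> i \<omega><..T}|\<mu>A. ?w' s \<omega>) - \<xi> \<omega>)\<bar>
      \<le> (\<integral>s. \<bar>?k i s \<omega>\<bar> \<partial>\<mu>P) + ?b \<omega>" if i: "i \<in> {1..n}" for i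
    proof -
      have bnd: "0 \<le> \<tau> i \<omega>" "\<tau> i \<omega> \<le> T" using timesD(3,4)[OF \<tau>[OF i] elim(4)] by auto
      have g: "integrable \<mu>P (\<lambda>s. g i s \<omega>)" "integrable \<mu>P (\<lambda>s. g' i s \<omega>)" using elim(1) i by auto
      have "\<bar>LINT s:{0..\<tau> i \<omega>}|\<mu>P. ?k i s \<omega>\<bar> \<le> (\<integral>s. \<bar>?k i s \<omega>\<bar> \<partial>\<mu>P)"
        using g by (intro P.cut_integral_abs_le(1) bnd) auto
      moreover have "(LINT s:{0..\<tau> i \<omega>}|\<mu>P. ?k i s \<omega>)
          = (LINT s:{0..\<tau> i \<omega>}|\<mu>P. g i s \<omega>) - (LINT s:{0..\<tau> i \<omega>}|\<mu>P. g' i s \<omega>)"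
        using P.integrable_cut(1)[OF g(1), of "\<tau> i \<omega>"] P.integrable_cut(1)[OF g(2), of "\<tau> i \<omega>"] bnd
        by (simp add: P.set_integral_upto right_diff_distrib)
      moreover have "\<bar>LINT s:{\<tau> i \<omega><..T}|\<mu>A. ?w s \<omega> - ?w' s \<omega>\<bar> \<le> (\<integral>s. 4 * (\<Sum>i=1..n. \<bar>?h i s \<omega>\<bar>) \<partial>\<mu>A)"
      proof (rule A.cut_integral_abs_le(2))
        show "integrable \<mu>A (\<lambda>s. 4 * (\<Sum>i=1..n. \<bar>?h i s \<omega>\<bar>))" using elim(1) by auto
        show "\<bar>?w s \<omega> - ?w' s \<omega>\<bar> \<le> 4 * (\<Sum>i=1..n. \<bar>?h i s \<omega>\<bar>)" for s
          unfolding marginal_wage_diff by (rule order_trans[OF marginal_wage_bound wage_bound_le_sum[OF n_pos]])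
      qed (use elim(2,3) bnd in auto)
      moreover have "(\<integral>s. 4 * (\<Sum>i=1..n. \<bar>?h i s \<omega>\<bar>) \<partial>\<mu>A) = ?b \<omega>" using elim(1) by simp
      moreover have "(LINT s:{\<tau> i \<omega><..T}|\<mu>A. ?w s \<omega> - ?w' s \<omega>)
          = (LINT s:{\<tau> i \<omega><..T}|\<mu>A. ?w s \<omega>) - (LINT s:{\<tau> i \<omega><..T}|\<mu>A. ?w' s \<omega>)"
        using A.integrable_cut(2)[OF elim(2), of "\<tau> i \<omega>"] A.integrable_cut(2)[OF elim(3), of "\<tau> i \<omega>"] bnd
        by (simp add: A.set_integral_after right_diff_distrib)
      ultimately show ?thesis by linarith
    qed
    then have "(\<Sum>i=1..n. \<bar>((LINT s:{0..\<tau> i \<omega>}|\<mu>P. g i s \<omega>) - (LINT s:{\<tau> i \<omega><..T}|\<mu>A. ?w s \<omega>) - \<xi> \<omega>)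
        - ((LINT s:{0..\<tau> i \<omega>}|\<mu>P. g' i s \<omega>) - (LINT s:{\<tau> i \<omega><..T}|\<mu>A. ?w' s \<omega>) - \<xi> \<omega>)\<bar>)
      \<le> (\<Sum>i=1..n. (\<integral>s. \<bar>?k i s \<omega>\<bar> \<partial>\<mu>P) + ?b \<omega>)" by (intro sum_mono)
    also have "\<dots> = ?B \<omega>" by (simp add: sum.distrib)
    finally show ?case unfolding sum_subtractf[symmetric] by (rule order_trans[OF sum_abs])
  qed
  then have "(\<integral>\<omega>. \<bar>?X \<omega> - ?X' \<omega>\<bar> \<partial>M) \<le> (\<integral>\<omega>. ?B \<omega> \<partial>M)"
    using X X' B by (intro integral_mono_AE) auto
  moreover have "\<bar>\<integral>\<omega>. ?X \<omega> - ?X' \<omega> \<partial>M\<bar> \<le> (\<integral>\<omega>. \<bar>?X \<omega> - ?X' \<omega>\<bar> \<partial>M)" by (rule integral_abs_bound)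
  moreover have "(\<integral>\<omega>. ?X \<omega> - ?X' \<omega> \<partial>M) = W \<tau> - chain_value M T n \<mu>A \<mu>P f' g' \<xi> \<tau>"
    unfolding chain_value_def by (rule Bochner_Integration.integral_diff[OF X X'])
  moreover have "(\<integral>\<omega>. ?B \<omega> \<partial>M) = (\<Sum>i=1..n. \<integral>\<omega>. (\<integral>s. \<bar>?k i s \<omega>\<bar> \<partial>\<mu>P) \<partial>M)
      + real n * (4 * (\<Sum>i=1..n. \<integral>\<omega>. (\<integral>s. \<bar>?h i s \<omega>\<bar> \<partial>\<mu>A) \<partial>M))"
  proof -
    have "(\<integral>\<omega>. ?B \<omega> \<partial>M) = (\<integral>\<omega>. (\<Sum>i=1..n. \<integral>s. \<bar>?k i s \<omega>\<bar> \<partial>\<mu>P) \<partial>M) + (\<integral>\<omega>. real n * ?b \<omega> \<partial>M)"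
      by (intro Bochner_Integration.integral_add ksum integrable_mult_right b)
    also have "(\<integral>\<omega>. (\<Sum>i=1..n. \<integral>s. \<bar>?k i s \<omega>\<bar> \<partial>\<mu>P) \<partial>M) = (\<Sum>i=1..n. \<integral>\<omega>. (\<integral>s. \<bar>?k i s \<omega>\<bar> \<partial>\<mu>P) \<partial>M)"
      by (intro Bochner_Integration.integral_sum ki)
    also have "(\<integral>\<omega>. real n * ?b \<omega> \<partial>M) = real n * (4 * (\<integral>\<omega>. (\<Sum>i=1..n. \<integral>s. \<bar>?h i s \<omega>\<bar> \<partial>\<mu>A) \<partial>M))"
      by (simp only: integral_mult_right_zero)
    also have "(\<integral>\<omega>. (\<Sum>i=1..n. \<integral>s. \<bar>?h i s \<omega>\<bar> \<partial>\<mu>A) \<partial>M) = (\<Sum>i=1..n. \<integral>\<omega>. (\<integral>s. \<bar>?h i s \<omega>\<bar> \<partial>\<mu>A) \<partial>M)"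
      by (intro Bochner_Integration.integral_sum hi)
    finally show ?thesis .
  qed
  ultimately show ?thesis by linarith
qed

text \<open>
  For stopping times on the partition, discretizing the clocks amounts to rounding up the dates at
  which the rates are evaluated.
\<close>

lemma grid_chain_value_eq:
  assumes "atomless \<mu>A" "atomless \<mu>P" and p: "is_partition T m p"
    and \<tau>: "\<And>i. i \<in> {1..n} \<Longrightarrow> \<tau> i \<in> times (p ` {0..m})"
  defines "r \<equiv> roundup m p"
  shows "chain_value M T n (grid_measure \<mu>A m p) (grid_measure \<mu>P m p) f g \<xi> \<tau>
    = chain_value M T n \<mu>A \<mu>P (\<lambda>i s. f i (r s)) (\<lambda>i s. g i (r s)) \<xi> \<tau>"
proof -
  interpret AA: atomless_clock M F T \<mu>A by unfold_locales fact
  interpret PP: atomless_clock M F T \<mu>P by unfold_locales fact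
  interpret GA: clock M F T "grid_measure \<mu>A m p" by (rule AA.grid_clock[OF p])
  interpret GP: clock M F T "grid_measure \<mu>P m p" by (rule PP.grid_clock[OF p])
  show ?thesis
    unfolding chain_value_def
  proof (intro Bochner_Integration.integral_cong sum.cong refl arg_cong2[where f="(-)"])
    fix \<omega> i assume \<omega>: "\<omega> \<in> space M" and i: "i \<in> {1..n}"
    have bnd: "0 \<le> \<tau> i \<omega>" "\<tau> i \<omega> \<le> T" using timesD(3,4)[OF \<tau>[OF i] \<omega>] by auto
    have lt: "\<tau> j \<omega> < r s \<longleftrightarrow> \<tau> j \<omega> < s" "r s \<le> \<tau> j \<omega> \<longleftrightarrow> s \<le> \<tau> j \<omega>" if "j \<in> {1..n}" "s \<le> T" for j s
      unfolding r_def using less_roundup[OF p that(2) timesD(5)[OF \<tau>[OF that(1)] \<omega>]]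
        roundup(3)[OF p that(2) timesD(5)[OF \<tau>[OF that(1)] \<omega>]] by auto
    have gm: "(\<lambda>s. g i s \<omega>) \<in> borel_measurable \<mu>P"
      by (rule P.section_measurable[OF P.rate_measurable[OF g_rate[OF i]] \<omega>])
    have wm: "(\<lambda>s. marginal_wage n f \<tau> s \<omega>) \<in> borel_measurable \<mu>A"
      by (rule A.section_measurable[OF A.rate_measurable[OF marginal_wage_rate[OF \<tau>]] \<omega>])
    have cut: "(\<lambda>s. of_bool (s \<le> \<tau> i \<omega>)) \<in> borel_measurable \<mu>P" "(\<lambda>s. of_bool (\<tau> i \<omega> < s)) \<in> borel_measurable \<mu>A"
      by measurable
    have "(\<integral>s. of_bool (s \<le> \<tau> i \<omega>) * g i s \<omega> \<partial>grid_measure \<mu>P m p)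
        = (\<integral>s. of_bool (r s \<le> \<tau> i \<omega>) * g i (r s) \<omega> \<partial>\<mu>P)"
      unfolding r_def using cut gm by (intro PP.grid_integral[OF p] borel_measurable_times) auto
    also have "\<dots> = (\<integral>s. of_bool (s \<le> \<tau> i \<omega>) * g i (r s) \<omega> \<partial>\<mu>P)"
      using lt(2)[OF i] by (intro Bochner_Integration.integral_cong) (auto simp: P.space_clock)
    finally show "(LINT s:{0..\<tau> i \<omega>}|grid_measure \<mu>P m p. g i s \<omega>) = (LINT s:{0..\<tau> i \<omega>}|\<mu>P. g i (r s) \<omega>)"
      by (simp add: bnd GP.set_integral_upto P.set_integral_upto)
    have "(\<integral>s. of_bool (\<tau> i \<omega> < s) * marginal_wage n f \<tau> s \<omega> \<partial>grid_measure \<mu>A m p)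
        = (\<integral>s. of_bool (\<tau> i \<omega> < r s) * marginal_wage n f \<tau> (r s) \<omega> \<partial>\<mu>A)"
      unfolding r_def using cut wm by (intro AA.grid_integral[OF p] borel_measurable_times) auto
    also have "\<dots> = (\<integral>s. of_bool (\<tau> i \<omega> < s) * marginal_wage n (\<lambda>i s. f i (r s)) \<tau> s \<omega> \<partial>\<mu>A)"
      using lt(1) i unfolding marginal_wage_def
      by (intro Bochner_Integration.integral_cong refl arg_cong2[where f="(*)"] arg_cong2[where f="(+)"] sum.cong)
        (auto simp: A.space_clock)
    finally show "(LINT s:{\<tau> i \<omega><..T}|grid_measure \<mu>A m p. marginal_wage n f \<tau> s \<omega>)
        = (LINT s:{\<tau> i \<omega><..T}|\<mu>A. marginal_wage n (\<lambda>i s. f i (r s)) \<tau> s \<omega>)"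
      by (simp add: bnd GA.set_integral_after A.set_integral_after)
  qed
qed

text \<open>
  Both clocks being atomless, the finitely many dates at which the marginal wage or the range of
  integration is discontinuous in \<open>\<tau>\<close> carry no mass.
\<close>

lemma chain_value_tendsto:
  assumes "atomless \<mu>A" "atomless \<mu>P"
    and \<tau>s: "\<And>m i. i \<in> {1..n} \<Longrightarrow> \<tau>s m i \<in> times D" and \<tau>: "\<And>i. i \<in> {1..n} \<Longrightarrow> \<tau> i \<in> times D"
    and lim: "AE \<omega> in M. \<forall>i\<in>{1..n}. (\<lambda>m. \<tau>s m i \<omega>) \<longlonglongrightarrow> \<tau> i \<omega>"
  shows "(\<lambda>m. W (\<tau>s m)) \<longlonglongrightarrow> W \<tau>"
proof -
  interpret AA: atomless_clock M F T \<mu>A by unfold_locales fact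
  interpret PP: atomless_clock M F T \<mu>P by unfold_locales fact
  have w: "A.rate (marginal_wage n f (\<tau>s m))" "A.rate (marginal_wage n f \<tau>)" for m
    using marginal_wage_rate \<tau>s \<tau> by blast+
  have wsAE: "AE \<omega> in M. \<forall>m. integrable \<mu>A (\<lambda>s. marginal_wage n f (\<tau>s m) s \<omega>)"
    unfolding AE_all_countable using A.rate_AE[OF w(1)] by blast
  have W_\<tau>s: "W (\<tau>s m) = (\<Sum>i=1..n. (\<integral>\<omega>. (LINT s:{0..\<tau>s m i \<omega>}|\<mu>P. g i s \<omega>) \<partial>M)
    - (\<integral>\<omega>. (LINT s:{\<tau>s m i \<omega><..T}|\<mu>A. marginal_wage n f (\<tau>s m) s \<omega>) + \<xi> \<omega> \<partial>M))" for m
    by (rule chain_value_split) (rule \<tau>s)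
  have W_\<tau>: "W \<tau> = (\<Sum>i=1..n. (\<integral>\<omega>. (LINT s:{0..\<tau> i \<omega>}|\<mu>P. g i s \<omega>) \<partial>M)
    - (\<integral>\<omega>. (LINT s:{\<tau> i \<omega><..T}|\<mu>A. marginal_wage n f \<tau> s \<omega>) + \<xi> \<omega> \<partial>M))"
    by (rule chain_value_split) (rule \<tau>)
  show ?thesis
    unfolding W_\<tau>s W_\<tau>
  proof (intro tendsto_sum tendsto_diff)
    fix i assume i: "i \<in> {1..n}"
    note gi = P.rate_AE[OF g_rate[OF i]]
    show "(\<lambda>m. \<integral>\<omega>. (LINT s:{0..\<tau>s m i \<omega>}|\<mu>P. g i s \<omega>) \<partial>M) \<longlonglongrightarrow> (\<integral>\<omega>. (LINT s:{0..\<tau> i \<omega>}|\<mu>P. g i s \<omega>) \<partial>M)"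
    proof (rule integral_dominated_convergence[where w="\<lambda>\<omega>. \<integral>s. \<bar>g i s \<omega>\<bar> \<partial>\<mu>P"])
      show "integrable M (\<lambda>\<omega>. \<integral>s. \<bar>g i s \<omega>\<bar> \<partial>\<mu>P)" by (rule P.rate_integrable[OF P.rate_abs[OF g_rate[OF i]]])
      show "AE \<omega> in M. norm (LINT s:{0..\<tau>s m i \<omega>}|\<mu>P. g i s \<omega>) \<le> (\<integral>s. \<bar>g i s \<omega>\<bar> \<partial>\<mu>P)" for m
        unfolding real_norm_def using gi AE_space
        by eventually_elim (intro P.cut_integral_abs_le(1), use timesD(4)[OF \<tau>s[OF i]] in auto)
      show "AE \<omega> in M. (\<lambda>m. LINT s:{0..\<tau>s m i \<omega>}|\<mu>P. g i s \<omega>) \<longlonglongrightarrow> (LINT s:{0..\<tau> i \<omega>}|\<mu>P. g i s \<omega>)"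
        using lim gi AE_space
      proof eventually_elim
        case (elim \<omega>)
        have "(\<lambda>m. \<tau>s m i \<omega>) \<longlonglongrightarrow> \<tau> i \<omega>" using elim(1) i by blast
        from PP.upto_tendsto[OF elim(2) this] show ?case
          using timesD(4)[OF \<tau>s[OF i] elim(3)] timesD(4)[OF \<tau>[OF i] elim(3)] by (simp add: P.set_integral_upto)
      qed
    qed (use P.upto_integrable[OF g_rate[OF i] \<tau>[OF i]] P.upto_integrable[OF g_rate[OF i] \<tau>s[OF i]] in auto)
    show "(\<lambda>m. \<integral>\<omega>. (LINT s:{\<tau>s m i \<omega><..T}|\<mu>A. marginal_wage n f (\<tau>s m) s \<omega>) + \<xi> \<omega> \<partial>M)
      \<longlonglongrightarrow> (\<integral>\<omega>. (LINT s:{\<tau> i \<omega><..T}|\<mu>A. marginal_wage n f \<tau> s \<omega>) + \<xi> \<omega> \<partial>M)"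
    proof (rule integral_dominated_convergence[where w="\<lambda>\<omega>. (\<integral>s. wage_bound n f s \<omega> \<partial>\<mu>A) + \<bar>\<xi> \<omega>\<bar>"])
      show "integrable M (\<lambda>\<omega>. (\<integral>s. wage_bound n f s \<omega> \<partial>\<mu>A) + \<bar>\<xi> \<omega>\<bar>)"
        using A.rate_integrable[OF wage_bound_rate] \<xi>_integrable by auto
      show "AE \<omega> in M. norm ((LINT s:{\<tau>s m i \<omega><..T}|\<mu>A. marginal_wage n f (\<tau>s m) s \<omega>) + \<xi> \<omega>)
        \<le> (\<integral>s. wage_bound n f s \<omega> \<partial>\<mu>A) + \<bar>\<xi> \<omega>\<bar>" for m
        unfolding real_norm_def using A.rate_AE[OF w(1)[of m]] A.rate_AE[OF wage_bound_rate] AE_space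
      proof eventually_elim
        case (elim \<omega>)
        from A.cut_integral_abs_le(2)[OF elim(1,2) marginal_wage_bound timesD(3)[OF \<tau>s[OF i, of m] elim(3)]]
        show ?case by linarith
      qed
      show "AE \<omega> in M. (\<lambda>m. (LINT s:{\<tau>s m i \<omega><..T}|\<mu>A. marginal_wage n f (\<tau>s m) s \<omega>) + \<xi> \<omega>)
        \<longlonglongrightarrow> (LINT s:{\<tau> i \<omega><..T}|\<mu>A. marginal_wage n f \<tau> s \<omega>) + \<xi> \<omega>"
        using lim wsAE A.rate_AE[OF w(2)] A.rate_AE[OF wage_bound_rate] AE_space
      proof eventually_elim
        case (elim \<omega>)
        have "(\<lambda>m. \<integral>s. of_bool (\<tau>s m i \<omega> < s) * marginal_wage n f (\<tau>s m) s \<omega> \<partial>\<mu>A)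
          \<longlonglongrightarrow> (\<integral>s. of_bool (\<tau> i \<omega> < s) * marginal_wage n f \<tau> s \<omega> \<partial>\<mu>A)"
        proof (rule integral_dominated_convergence[where w="\<lambda>s. wage_bound n f s \<omega>"])
          have "AE s in \<mu>A. \<forall>k\<in>{1..n}. s \<noteq> \<tau> k \<omega>"
            using AA.singleton_null by (intro AE_finite_allI) auto
          then show "AE s in \<mu>A. (\<lambda>m. of_bool (\<tau>s m i \<omega> < s) * marginal_wage n f (\<tau>s m) s \<omega>)
            \<longlonglongrightarrow> of_bool (\<tau> i \<omega> < s) * marginal_wage n f \<tau> s \<omega>"
          proof eventually_elim
            fix s assume s: "\<forall>k\<in>{1..n}. s \<noteq> \<tau> k \<omega>"
            have "\<forall>\<^sub>F m in sequentially. (\<tau>s m k \<omega> < s) = (\<tau> k \<omega> < s)" if k: "k \<in> {1..n}" for k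
            proof (cases "\<tau> k \<omega> < s")
              case True
              have "(\<lambda>m. \<tau>s m k \<omega>) \<longlonglongrightarrow> \<tau> k \<omega>" using elim(1) k by blast
              from order_tendstoD(2)[OF this True] show ?thesis by (rule eventually_mono) (use True in auto)
            next
              case False
              then have lt: "s < \<tau> k \<omega>" using s k by force
              have "(\<lambda>m. \<tau>s m k \<omega>) \<longlonglongrightarrow> \<tau> k \<omega>" using elim(1) k by blast
              from order_tendstoD(1)[OF this lt] show ?thesis by (rule eventually_mono) (use lt in auto)
            qed
            then have "\<forall>\<^sub>F m in sequentially. \<forall>k\<in>{1..n}. (\<tau>s m k \<omega> < s) = (\<tau> k \<omega> < s)"
              by (intro eventually_ball_finite) auto
            then show "(\<lambda>m. of_bool (\<tau>s m i \<omega> < s) * marginal_wage n f (\<tau>s m) s \<omega>)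
              \<longlonglongrightarrow> of_bool (\<tau> i \<omega> < s) * marginal_wage n f \<tau> s \<omega>"
            proof (intro tendsto_eventually, elim eventually_mono)
              fix m assume "\<forall>k\<in>{1..n}. (\<tau>s m k \<omega> < s) = (\<tau> k \<omega> < s)"
              then show "of_bool (\<tau>s m i \<omega> < s) * marginal_wage n f (\<tau>s m) s \<omega>
                = of_bool (\<tau> i \<omega> < s) * marginal_wage n f \<tau> s \<omega>"
                using i unfolding marginal_wage_def
                by (intro arg_cong2[where f="(*)"] arg_cong2[where f="(+)"] sum.cong refl) auto
            qed
          qed
          show "AE s in \<mu>A. norm (of_bool (\<tau>s m i \<omega> < s) * marginal_wage n f (\<tau>s m) s \<omega>) \<le> wage_bound n f s \<omega>" for m
          proof (rule AE_I2)
            fix s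
            show "norm (of_bool (\<tau>s m i \<omega> < s) * marginal_wage n f (\<tau>s m) s \<omega>) \<le> wage_bound n f s \<omega>"
              using marginal_wage_bound[of n f "\<tau>s m" s \<omega>] by (cases "\<tau>s m i \<omega> < s") auto
          qed
        qed (use elim A.integrable_cut(2) in \<open>auto intro: borel_measurable_integrable\<close>)
        then show ?case
          using timesD(3)[OF \<tau>s[OF i] elim(5)] timesD(3)[OF \<tau>[OF i] elim(5)]
          by (intro tendsto_add tendsto_const) (simp add: A.set_integral_after)
      qed
    qed (use A.after_integrable[OF w(1) \<tau>s[OF i]] A.after_integrable[OF w(2) \<tau>[OF i]] \<xi>_integrable in auto)
  qed
qed

end

section \<open>Convergence of the principal's values\<close>

lemma ereal_tendsto_squeeze:
  fixes v :: "nat \<Rightarrow> ereal" and V :: ereal and e :: "nat \<Rightarrow> real"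
  assumes up: "\<And>m. v m \<le> V + ereal (e m)" and e: "e \<longlonglongrightarrow> 0" and low: "V \<le> liminf v"
  shows "v \<longlonglongrightarrow> V"
proof -
  have "(\<lambda>m. V + ereal (e m)) \<longlonglongrightarrow> V + ereal 0"
    using e by (intro tendsto_add_ereal_general1 tendsto_const) auto
  then have "limsup (\<lambda>m. V + ereal (e m)) = V" using lim_imp_Limsup[OF sequentially_bot] by fastforce
  moreover have "limsup v \<le> limsup (\<lambda>m. V + ereal (e m))"
    using up by (intro Limsup_mono always_eventually allI)
  ultimately have "limsup v \<le> V" by simp
  moreover have "liminf v \<le> limsup v" by (rule Liminf_le_Limsup[OF sequentially_bot])
  ultimately show ?thesis
    using low by (intro Liminf_eq_Limsup[OF sequentially_bot]) auto
qed

context filtered_prob_space begin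

lemma class_D_integrable:
  assumes Y: "class_D M F T Y" and \<sigma>: "\<sigma> \<in> times {0..T}"
  shows "integrable M (\<lambda>\<omega>. Y (\<sigma> \<omega>) \<omega>)"
proof -
  let ?\<X> = "(\<lambda>\<tau> \<omega>. Y (\<tau> \<omega>) \<omega>) ` stopping_times F T" and ?X = "\<lambda>\<omega>. Y (\<sigma> \<omega>) \<omega>"
  have X: "?X \<in> ?\<X>" using \<sigma> stopping_times_eq_times by auto
  have m: "?X \<in> borel_measurable M"
    using Y X unfolding class_D_def uniformly_integrable_def by auto
  have "((\<lambda>c. SUP X\<in>?\<X>. \<integral>\<^sup>+\<omega>\<in>{\<omega>. c < \<bar>X \<omega>\<bar>}. ennreal \<bar>X \<omega>\<bar> \<partial>M) \<longlongrightarrow> 0) (at_top :: real filter)"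
    using Y unfolding class_D_def uniformly_integrable_def by auto
  then have "\<forall>\<^sub>F c in at_top :: real filter. (SUP X\<in>?\<X>. \<integral>\<^sup>+\<omega>\<in>{\<omega>. c < \<bar>X \<omega>\<bar>}. ennreal \<bar>X \<omega>\<bar> \<partial>M) < 1"
    by (rule order_tendstoD(2)) simp
  then obtain c where c: "(SUP X\<in>?\<X>. \<integral>\<^sup>+\<omega>\<in>{\<omega>. c < \<bar>X \<omega>\<bar>}. ennreal \<bar>X \<omega>\<bar> \<partial>M) < 1"
    using eventually_happens'[OF trivial_limit_at_top_linorder] by blast
  have tail: "(\<integral>\<^sup>+\<omega>\<in>{\<omega>. c < \<bar>?X \<omega>\<bar>}. ennreal \<bar>?X \<omega>\<bar> \<partial>M) < 1"
    by (rule le_less_trans[OF SUP_upper[OF X] c])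
  have "(\<integral>\<^sup>+\<omega>. ennreal (norm (?X \<omega>)) \<partial>M)
      \<le> (\<integral>\<^sup>+\<omega>. ennreal \<bar>c\<bar> + ennreal \<bar>?X \<omega>\<bar> * indicator {\<omega>. c < \<bar>?X \<omega>\<bar>} \<omega> \<partial>M)"
  proof (rule nn_integral_mono)
    fix \<omega>
    show "ennreal (norm (?X \<omega>)) \<le> ennreal \<bar>c\<bar> + ennreal \<bar>?X \<omega>\<bar> * indicator {\<omega>. c < \<bar>?X \<omega>\<bar>} \<omega>"
    proof (cases "c < \<bar>?X \<omega>\<bar>")
      case False
      then have "ennreal (norm (?X \<omega>)) \<le> ennreal \<bar>c\<bar>" by (intro ennreal_leI) auto
      then show ?thesis using False by simp
    qed simp
  qed
  also have "\<dots> = ennreal \<bar>c\<bar> + (\<integral>\<^sup>+\<omega>\<in>{\<omega>. c < \<bar>?X \<omega>\<bar>}. ennreal \<bar>?X \<omega>\<bar> \<partial>M)"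
  proof (subst nn_integral_add)
    have "(\<lambda>\<omega>. ennreal \<bar>?X \<omega>\<bar> * indicator {\<omega>\<in>space M. c < \<bar>?X \<omega>\<bar>} \<omega>) \<in> borel_measurable M"
      using m by measurable
    then show "(\<lambda>\<omega>. ennreal \<bar>?X \<omega>\<bar> * indicator {\<omega>. c < \<bar>?X \<omega>\<bar>} \<omega>) \<in> borel_measurable M"
      by (subst measurable_cong[where g="\<lambda>\<omega>. ennreal \<bar>?X \<omega>\<bar> * indicator {\<omega>\<in>space M. c < \<bar>?X \<omega>\<bar>} \<omega>"])
        (auto simp: indicator_def)
  qed (auto simp: emeasure_space_1)
  also have "\<dots> < \<infinity>" using tail by (auto simp: less_top[symmetric] dest: less_trans)
  finally show ?thesis using m by (intro integrableI_bounded) auto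
qed

end

lemma (in atomless_clock) grid_chains:
  assumes p: "is_partition T m p" and \<tau>: "\<And>i. i \<in> {1..n} \<Longrightarrow> \<tau> i \<in> times (p ` {0..m})"
  shows "\<tau> \<in> clock.chains M F T (grid_measure \<mu> m p) (p ` {0..m}) n \<longleftrightarrow> \<tau> \<in> chains {0..T} n"
proof -
  interpret G: clock M F T "grid_measure \<mu> m p" by (rule grid_clock[OF p])
  have "emeasure (grid_measure \<mu> m p) {\<tau> k \<omega><..\<tau> (Suc k) \<omega>} = emeasure \<mu> {\<tau> k \<omega><..\<tau> (Suc k) \<omega>}"
    if "k \<in> {1..<n}" "\<omega> \<in> space M" for k \<omega>
    using that by (intro grid_interval_mass[OF p] timesD(5)[OF \<tau>]) auto
  then have "G.separated n \<tau> \<longleftrightarrow> separated n \<tau>"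
    unfolding G.separated_def separated_def
    by (intro ball_cong refl arg_cong2[where f="(\<longrightarrow>)"] AE_cong) simp
  moreover have "\<tau> i \<in> times {0..T}" if "i \<in> {1..n}" for i using \<tau>[OF that] times_subset by blast
  ultimately show ?thesis using \<tau> unfolding G.chains_def chains_def by auto
qed

lemma (in principal_agent) principal_value_le:
  assumes Y: "\<And>Y \<sigma>. Y \<in> K \<Longrightarrow> \<sigma> \<in> times D \<Longrightarrow> integrable M (\<lambda>\<omega>. Y (\<sigma> \<omega>) \<omega>)"
    and YT: "\<And>Y. Y \<in> K \<Longrightarrow> AE \<omega> in M. \<xi> \<omega> \<le> Y T \<omega>"
    and le: "\<And>\<tau>. \<tau> \<in> A.chains D n \<Longrightarrow> ereal (W \<tau>) \<le> v"
  shows "principal_value M n \<mu>A \<mu>P f g (times D) K \<le> v"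
  unfolding principal_value_def
proof (rule Sup_least)
  fix x assume "x \<in> {ereal (principal_payoff M n \<mu>P g Y \<tau>) |Y \<tau>.
    Y \<in> K \<and> (\<forall>i\<in>{1..n}. smallest_optimal M (times D) (agent_payoff M \<mu>A (f i) Y) (\<tau> i))}"
  then obtain Y' \<tau> where x: "x = ereal (principal_payoff M n \<mu>P g Y' \<tau>)" and K: "Y' \<in> K"
    and opt: "\<And>i. i \<in> {1..n} \<Longrightarrow> smallest_optimal M (times D) (agent_payoff M \<mu>A (f i) Y') (\<tau> i)" by auto
  obtain \<tau>' where "\<tau>' \<in> A.chains D n" "principal_payoff M n \<mu>P g Y' \<tau> \<le> W \<tau>'"
    using principal_payoff_le_chain_value[OF Y[OF K] YT[OF K] opt] by auto
  then show "x \<le> v" unfolding x using le[of \<tau>'] by (meson ereal_less_eq(3) order_trans)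
qed

theorem theorem3p3:
  fixes M :: "'a measure" and F :: "real \<Rightarrow> 'a measure" and T :: real and n :: nat
    and \<mu>A \<mu>P :: "real measure"
    and f g :: "nat \<Rightarrow> real \<Rightarrow> 'a \<Rightarrow> real" and \<xi> :: "'a \<Rightarrow> real"
    and p :: "nat \<Rightarrow> nat \<Rightarrow> real"
  assumes "prob_space M" and "complete_measure M"
    and "T > 0" and "n \<ge> 1"
    and "filtration (space M) F" and "\<And>t. sets (F t) \<subseteq> sets M"
    and "usual_conditions M F T"
    and "sets \<mu>A = sets (restrict_space borel {0..T})" and "finite_measure \<mu>A" and "atomless \<mu>A"
    and "sets \<mu>P = sets (restrict_space borel {0..T})" and "finite_measure \<mu>P" and "atomless \<mu>P"
    and "\<And>i. i \<in> {1..n} \<Longrightarrow> progressively_measurable F T (f i)"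
    and "\<And>i. i \<in> {1..n} \<Longrightarrow> progressively_measurable F T (g i)"
    and "\<xi> \<in> borel_measurable (F T)" and "integrable M \<xi>"
    and partition: "\<And>m. m \<ge> 1 \<Longrightarrow> is_partition T m (p m)"
    and mesh: "(\<lambda>m. mesh m (p m)) \<longlonglongrightarrow> 0"
    and ordered: "\<And>i j t \<omega>. 1 \<le> i \<Longrightarrow> i < j \<Longrightarrow> j \<le> n \<Longrightarrow> t \<in> {0..T} \<Longrightarrow> \<omega> \<in> space M \<Longrightarrow>
      f i t \<omega> < f j t \<omega>"
    and "\<And>i. i \<in> {1..n} \<Longrightarrow>
      (\<integral>\<^sup>+\<omega>. (\<integral>\<^sup>+t. ennreal \<bar>f i t \<omega>\<bar> \<partial>\<mu>A) + (\<integral>\<^sup>+t. ennreal \<bar>g i t \<omega>\<bar> \<partial>\<mu>P) \<partial>M) < \<infinity>"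
    and "\<And>i. i \<in> {1..n} \<Longrightarrow>
      (\<integral>\<^sup>+\<omega>. (SUP t\<in>{0..T}. ennreal \<bar>g i t \<omega>\<bar>) \<partial>M) +
      (\<integral>\<^sup>+\<omega>. (SUP t\<in>{0..T}. ennreal \<bar>f i t \<omega>\<bar>) \<partial>M) < \<infinity>"
    and "\<And>i. i \<in> {1..n} \<Longrightarrow> AE \<omega> in M.
      (\<lambda>m. \<Sum>j=1..m. \<integral>\<^sup>+t\<in>{p m (j - 1)<..p m j}. ennreal \<bar>f i t \<omega> - f i (p m j) \<omega>\<bar> \<partial>\<mu>A) \<longlonglongrightarrow> 0"
    and "\<And>i. i \<in> {1..n} \<Longrightarrow> AE \<omega> in M.
      (\<lambda>m. \<Sum>j=1..m. \<integral>\<^sup>+t\<in>{p m (j - 1)<..p m j}. ennreal \<bar>g i t \<omega> - g i (p m j) \<omega>\<bar> \<partial>\<mu>P) \<longlonglongrightarrow> 0"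
  shows "(\<lambda>m. V_P_grid M F T n \<mu>A \<mu>P f g \<xi> m (p m)) \<longlonglongrightarrow> V_P M F T n \<mu>A \<mu>P f g \<xi>"
  proof -
  interpret filtered_prob_space M F T
    using assms(1,3,5,6,7) by (auto simp: filtered_prob_space_def filtered_prob_space_axioms_def)
  interpret A: atomless_clock M F T \<mu>A
    using assms(8-10) by (intro atomless_clock.intro clock.intro clock_axioms.intro atomless_clock_axioms.intro filtered_prob_space_axioms)
  interpret P: atomless_clock M F T \<mu>P
    using assms(11-13) by (intro atomless_clock.intro clock.intro clock_axioms.intro atomless_clock_axioms.intro filtered_prob_space_axioms)
  note f_prog = assms(14) and g_prog = assms(15) and \<xi>T = assms(16) and \<xi>_int = assms(17)
  note sup = assms(22) and f_osc = assms(23) and g_osc = assms(24)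
  have into_M: "(\<lambda>(s, \<omega>). u s \<omega>) \<in> borel_measurable (\<mu> \<Otimes>\<^sub>M M)"
    if \<mu>: "sets \<mu> = sets (restrict_space borel {0..T})" and u: "progressively_measurable F T u"
    for u :: "real \<Rightarrow> 'a \<Rightarrow> real" and \<mu> :: "real measure"
  proof -
    have "(\<lambda>(s, \<omega>). u s \<omega>) \<in> borel_measurable (restrict_space borel {0..T} \<Otimes>\<^sub>M F T)"
      using u T_pos by (auto simp: progressively_measurable_def)
    then have u': "(\<lambda>(s, \<omega>). u s \<omega>) \<in> borel_measurable (\<mu> \<Otimes>\<^sub>M F T)"
      using measurable_cong_sets[OF sets_pair_measure_cong[OF \<mu> refl] refl] by blast
    have "(\<lambda>\<omega>. \<omega>) \<in> measurable M (F T)"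
      using sets_F[of T] space_F[of T] by (intro measurable_ident_sets[THEN measurable_from_subalg[rotated]]) (auto simp: subalgebra_def)
    then have "(\<lambda>z. (fst z, snd z)) \<in> measurable (\<mu> \<Otimes>\<^sub>M M) (\<mu> \<Otimes>\<^sub>M F T)"
      by (intro measurable_Pair measurable_fst measurable_compose[OF measurable_snd])
    from measurable_compose[OF this u'] show ?thesis by (simp add: case_prod_beta')
  qed
  note f_meas = into_M[OF assms(8) f_prog] and g_meas = into_M[OF assms(11) g_prog]
  define Sf where "Sf i \<omega> = (SUP t\<in>{0..T}. ennreal \<bar>f i t \<omega>\<bar>)" for i \<omega>
  define Sg where "Sg i \<omega> = (SUP t\<in>{0..T}. ennreal \<bar>g i t \<omega>\<bar>)" for i \<omega>
  have Sf: "ennreal \<bar>f i s \<omega>\<bar> \<le> Sf i \<omega>" if "s \<in> {0..T}" for i s \<omega> unfolding Sf_def using that by (rule SUP_upper)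
  have Sg: "ennreal \<bar>g i s \<omega>\<bar> \<le> Sg i \<omega>" if "s \<in> {0..T}" for i s \<omega> unfolding Sg_def using that by (rule SUP_upper)
  have S_fin: "(\<integral>\<^sup>+\<omega>. Sf i \<omega> \<partial>M) < \<infinity>" "(\<integral>\<^sup>+\<omega>. Sg i \<omega> \<partial>M) < \<infinity>" if "i \<in> {1..n}" for i
    using sup[OF that] unfolding Sf_def Sg_def by auto
  have f_rate: "A.rate (f i)" if "i \<in> {1..n}" for i
    by (rule A.rate_of_dominated[OF f_meas[OF that] Sf S_fin(1)[OF that]])
  have g_rate: "P.rate (g i)" if "i \<in> {1..n}" for i
    by (rule P.rate_of_dominated[OF g_meas[OF that] Sg S_fin(2)[OF that]])
  interpret C: principal_agent M F T \<mu>A \<mu>P "{0..T}" n f g \<xi>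
    using T_pos assms(4) f_rate g_rate ordered \<xi>_int by unfold_locales auto
  \<comment> \<open>Reindexed so that every index has a partition.\<close>
  define q where "q m = p (Suc m)" for m
  have q: "is_partition T (Suc m) (q m)" for m unfolding q_def using partition by simp
  let ?D = "\<lambda>m. q m ` {0..Suc m}"
  let ?\<nu>A = "\<lambda>m. grid_measure \<mu>A (Suc m) (q m)" and ?\<nu>P = "\<lambda>m. grid_measure \<mu>P (Suc m) (q m)"
  let ?r = "\<lambda>m. roundup (Suc m) (q m)"
  have TD: "T \<in> ?D m" for m using q[of m] by (auto simp: is_partition_def image_iff intro!: bexI[of _ "Suc m"])
  have G: "principal_agent M F T (?\<nu>A m) (?\<nu>P m) (?D m) n f g \<xi>" for m
  proof -
    interpret GA: clock M F T "?\<nu>A m" by (rule A.grid_clock[OF q])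
    interpret GP: clock M F T "?\<nu>P m" by (rule P.grid_clock[OF q])
    show ?thesis
      using A.roundup_rate(2)[OF q f_meas Sf S_fin(1)] P.roundup_rate(2)[OF q g_meas Sg S_fin(2)]
        TD assms(4) ordered \<xi>_int by unfold_locales auto
  qed
  define e where "e m = (\<Sum>i=1..n. \<integral>\<omega>. (\<integral>s. \<bar>g i s \<omega> - g i (?r m s) \<omega>\<bar> \<partial>\<mu>P) \<partial>M)
    + real n * (4 * (\<Sum>i=1..n. \<integral>\<omega>. (\<integral>s. \<bar>f i s \<omega> - f i (?r m s) \<omega>\<bar> \<partial>\<mu>A) \<partial>M))" for m
  have e: "e \<longlonglongrightarrow> 0"
  proof -
    have "(\<lambda>m. \<integral>\<omega>. (\<integral>s. \<bar>f i s \<omega> - f i (?r m s) \<omega>\<bar> \<partial>\<mu>A) \<partial>M) \<longlonglongrightarrow> 0" if i: "i \<in> {1..n}" for i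
    proof (rule A.deviation_tendsto[OF q f_meas[OF i] f_rate[OF i] Sf S_fin(1)[OF i]])
      show "AE \<omega> in M. (\<lambda>m. \<Sum>j=1..Suc m. \<integral>\<^sup>+s\<in>{q m (j - 1)<..q m j}. ennreal \<bar>f i s \<omega> - f i (q m j) \<omega>\<bar> \<partial>\<mu>A) \<longlonglongrightarrow> 0"
        using f_osc[OF i] unfolding q_def by eventually_elim (rule LIMSEQ_Suc)
    qed
    moreover have "(\<lambda>m. \<integral>\<omega>. (\<integral>s. \<bar>g i s \<omega> - g i (?r m s) \<omega>\<bar> \<partial>\<mu>P) \<partial>M) \<longlonglongrightarrow> 0" if i: "i \<in> {1..n}" for i
    proof (rule P.deviation_tendsto[OF q g_meas[OF i] g_rate[OF i] Sg S_fin(2)[OF i]])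
      show "AE \<omega> in M. (\<lambda>m. \<Sum>j=1..Suc m. \<integral>\<^sup>+s\<in>{q m (j - 1)<..q m j}. ennreal \<bar>g i s \<omega> - g i (q m j) \<omega>\<bar> \<partial>\<mu>P) \<longlonglongrightarrow> 0"
        using g_osc[OF i] unfolding q_def by eventually_elim (rule LIMSEQ_Suc)
    qed
    ultimately have "e \<longlonglongrightarrow> (\<Sum>i=1..n. 0) + real n * (4 * (\<Sum>i=1..n. 0))"
      unfolding e_def by (intro tendsto_add tendsto_sum tendsto_mult tendsto_const)
    then show ?thesis by simp
  qed
  have close: "\<bar>C.W \<tau> - chain_value M T n (?\<nu>A m) (?\<nu>P m) f g \<xi> \<tau>\<bar> \<le> e m"
    if \<tau>: "\<And>i. i \<in> {1..n} \<Longrightarrow> \<tau> i \<in> times (?D m)" for m \<tau>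
  proof -
    have eq: "chain_value M T n (?\<nu>A m) (?\<nu>P m) f g \<xi> \<tau>
        = chain_value M T n \<mu>A \<mu>P (\<lambda>i s. f i (?r m s)) (\<lambda>i s. g i (?r m s)) \<xi> \<tau>"
      by (rule C.grid_chain_value_eq[OF A.atomless P.atomless q]) (rule \<tau>)
    show ?thesis
      unfolding e_def eq
    proof (rule C.chain_value_lipschitz)
      show "A.rate (\<lambda>s. f i (?r m s))" if "i \<in> {1..n}" for i
        by (rule A.roundup_rate(1)[OF q f_meas[OF that] Sf S_fin(1)[OF that]])
      show "P.rate (\<lambda>s. g i (?r m s))" if "i \<in> {1..n}" for i
        by (rule P.roundup_rate(1)[OF q g_meas[OF that] Sg S_fin(2)[OF that]])
      show "\<tau> i \<in> times {0..T}" if "i \<in> {1..n}" for i using \<tau>[OF that] times_subset by blast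
    qed
  qed
  note v_def = V_P_grid_def grid_stopping_times_eq[OF q]
  have to_grid: "\<tau> \<in> A.chains {0..T} n \<longleftrightarrow> \<tau> \<in> clock.chains M F T (?\<nu>A m) (?D m) n"
    if "\<And>i. i \<in> {1..n} \<Longrightarrow> \<tau> i \<in> times (?D m)" for m \<tau>
    using A.grid_chains[OF q that] by simp
  let ?v = "\<lambda>m. V_P_grid M F T n \<mu>A \<mu>P f g \<xi> (Suc m) (q m)"
  let ?V = "V_P M F T n \<mu>A \<mu>P f g \<xi>"
  have up: "?v m \<le> ?V + ereal (e m)" for m
  proof -
    interpret G: principal_agent M F T "?\<nu>A m" "?\<nu>P m" "?D m" n f g \<xi> by (rule G)
    show ?thesis
      unfolding v_def
    proof (rule G.principal_value_le)
      fix Y \<sigma> assume Y: "Y \<in> grid_contracts M F T \<xi> (Suc m) (q m)"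
      show "AE \<omega> in M. \<xi> \<omega> \<le> Y T \<omega>" using Y by (simp add: grid_contracts_def)
      assume "\<sigma> \<in> times (?D m)"
      then show "integrable M (\<lambda>\<omega>. Y (\<sigma> \<omega>) \<omega>)"
      proof (rule finite_dates_integrable[rotated 2])
        fix d assume "d \<in> ?D m"
        then obtain j where "j \<le> Suc m" "d = q m j" by auto
        then show "integrable M (Y d)" using Y by (simp add: grid_contracts_def)
      qed simp
    next
      fix \<tau> assume \<tau>: "\<tau> \<in> G.A.chains (?D m) n"
      note S = G.chainsD(1)[OF \<tau>]
      have "\<tau> \<in> A.chains {0..T} n" using to_grid[of \<tau> m] S \<tau> by blast
      then have "ereal (C.W \<tau>) \<le> ?V" by (intro C.chain_value_le_continuous refl A.atomless \<xi>T f_prog)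
      then have V: "ereal (C.W \<tau>) + ereal (e m) \<le> ?V + ereal (e m)" by (rule add_right_mono)
      have "\<bar>C.W \<tau> - G.W \<tau>\<bar> \<le> e m" by (rule close) (rule S)
      then have "ereal (G.W \<tau>) \<le> ereal (C.W \<tau>) + ereal (e m)" by simp
      then show "ereal (G.W \<tau>) \<le> ?V + ereal (e m)" using V by (rule order_trans)
    qed
  qed
  have grid_low: "ereal (C.W \<tau> - e m) \<le> ?v m"
    if \<tau>: "\<tau> \<in> A.chains {0..T} n" and S: "\<And>i. i \<in> {1..n} \<Longrightarrow> \<tau> i \<in> times (?D m)" for m \<tau>
  proof -
    interpret G: principal_agent M F T "?\<nu>A m" "?\<nu>P m" "?D m" n f g \<xi> by (rule G)
    have "\<tau> \<in> G.A.chains (?D m) n" using to_grid[of \<tau> m] S \<tau> by blast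
    from G.grid_implementation[OF q refl \<xi>T this]
    obtain Y where Y: "Y \<in> grid_contracts M F T \<xi> (Suc m) (q m)"
      "\<forall>i\<in>{1..n}. smallest_optimal M (times (?D m)) (agent_payoff M (?\<nu>A m) (f i) Y) (\<tau> i)"
      "principal_payoff M n (?\<nu>P m) g Y \<tau> = G.W \<tau>" by auto
    have "\<bar>C.W \<tau> - G.W \<tau>\<bar> \<le> e m" by (rule close) (rule S)
    then have "C.W \<tau> - e m \<le> G.W \<tau>" by linarith
    then have "ereal (C.W \<tau> - e m) \<le> ereal (principal_payoff M n (?\<nu>P m) g Y \<tau>)" by (simp add: Y(3))
    also have "\<dots> \<le> ?v m"
      unfolding v_def principal_value_def by (rule Sup_upper) (use Y(1,2) in blast)
    finally show ?thesis .
  qed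
  have mesh_q: "(\<lambda>m. mesh (Suc m) (q m)) \<longlonglongrightarrow> 0" unfolding q_def using mesh by (rule LIMSEQ_Suc)
  have low: "?V \<le> liminf ?v"
    unfolding V_P_def stopping_times_eq_times
  proof (rule C.principal_value_le)
    fix Y \<sigma> assume Y: "Y \<in> contracts M F T \<xi>"
    show "AE \<omega> in M. \<xi> \<omega> \<le> Y T \<omega>" using Y by (simp add: contracts_def)
    assume "\<sigma> \<in> times {0..T}"
    then show "integrable M (\<lambda>\<omega>. Y (\<sigma> \<omega>) \<omega>)"
      using Y by (intro class_D_integrable) (auto simp: contracts_def)
  next
    fix \<tau> assume \<tau>: "\<tau> \<in> A.chains {0..T} n"
    note S = C.chainsD(1)[OF \<tau>] and ord = C.chainsD(2)[OF \<tau>]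
    let ?\<sigma> = "\<lambda>m i \<omega>. ?r m (\<tau> i \<omega>)"
    have \<sigma>: "?\<sigma> m i \<in> times (?D m)" if "i \<in> {1..n}" for m i by (rule roundup_times[OF q S[OF that]])
    have \<sigma>_mono: "?\<sigma> m i \<omega> \<le> ?\<sigma> m j \<omega>" if "\<tau> i \<omega> \<le> \<tau> j \<omega>" "j \<in> {1..n}" "\<omega> \<in> space M" for m i j \<omega>
      by (rule roundup_mono[OF q that(1) timesD(4)[OF S[OF that(2)] that(3)]])
    have \<sigma>_ord: "A.ordered n (?\<sigma> m)" for m
      unfolding A.ordered_def using \<sigma>_mono A.orderedD[OF ord] by simp
    \<comment> \<open>The chain is rounded up, and then moved down to restore separation.\<close>
    define good where "good m \<tau>' \<longleftrightarrow> \<tau>' \<in> A.chains (?D m) n \<and> (\<forall>i\<in>{1..n}.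
      (\<forall>\<omega>\<in>space M. \<exists>j\<in>{1..i}. \<tau>' i \<omega> = ?\<sigma> m j \<omega>) \<and> (AE \<omega> in M. emeasure \<mu>A {\<tau>' i \<omega><..?\<sigma> m i \<omega>} = 0))" for m \<tau>'
    have "\<exists>\<tau>'. good m \<tau>'" for m
      unfolding good_def Bex_def[symmetric]
    proof (rule A.separated_chain_below)
      show "?\<sigma> m i \<in> times (?D m)" if "i \<in> {1..n}" for i by (rule \<sigma>[OF that])
    qed (use \<sigma>_ord in auto)
    then obtain \<tau>' where good: "\<And>m. good m (\<tau>' m)" by metis
    have S': "\<tau>' m i \<in> times (?D m)" if "i \<in> {1..n}" for m i
      using good[of m] that by (simp add: good_def A.chains_def)
    have S'': "\<tau>' m i \<in> times {0..T}" if "i \<in> {1..n}" for m i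
      using S'[OF that] times_subset by blast
    have chain': "\<tau>' m \<in> A.chains {0..T} n" for m
      using good[of m] S'' by (simp add: good_def A.chains_def)
    have \<sigma>_lim: "(\<lambda>m. ?\<sigma> m i \<omega>) \<longlonglongrightarrow> \<tau> i \<omega>" if "i \<in> {1..n}" "\<omega> \<in> space M" for i \<omega>
    proof (rule tendsto_sandwich[OF _ _ tendsto_const])
      have b: "0 \<le> \<tau> i \<omega>" "\<tau> i \<omega> \<le> T" using timesD(3,4)[OF S[OF that(1)] that(2)] by auto
      show "\<forall>\<^sub>F m in sequentially. \<tau> i \<omega> \<le> ?\<sigma> m i \<omega>"
        by (intro always_eventually allI roundup(2)[OF q b(2)])
      have "?\<sigma> m i \<omega> \<le> \<tau> i \<omega> + mesh (Suc m) (q m)" for m using roundup_mesh[OF q b, of m] by simp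
      then show "\<forall>\<^sub>F m in sequentially. ?\<sigma> m i \<omega> \<le> \<tau> i \<omega> + mesh (Suc m) (q m)"
        by (intro always_eventually allI)
      show "(\<lambda>m. \<tau> i \<omega> + mesh (Suc m) (q m)) \<longlonglongrightarrow> \<tau> i \<omega>"
        using tendsto_add[OF tendsto_const mesh_q] by simp
    qed
    have "AE \<omega> in M. \<forall>i\<in>{1..n}. \<forall>\<^sub>F m in sequentially. \<tau>' m i \<omega> = ?\<sigma> m i \<omega>"
    proof (rule A.separated_approximation[OF \<tau> _ \<sigma>_ord \<sigma>_lim])
      fix m i assume i: "i \<in> {1..n}"
      show "?\<sigma> m i \<in> times {0..T}" using \<sigma>[OF i] times_subset by blast
      show "\<tau>' m i \<in> times {0..T}" by (rule S''[OF i])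
      show "AE \<omega> in M. emeasure \<mu>A {\<tau>' m i \<omega><..?\<sigma> m i \<omega>} = 0"
        using good[of m] i unfolding good_def by blast
      fix \<omega> assume \<omega>: "\<omega> \<in> space M"
      show "\<tau> i \<omega> \<le> ?\<sigma> m i \<omega>" by (rule roundup(2)[OF q timesD(4)[OF S[OF i] \<omega>]])
      show "\<exists>j\<in>{1..i}. \<tau>' m i \<omega> = ?\<sigma> m j \<omega>" using good[of m] i \<omega> unfolding good_def by blast
    qed (use \<sigma>_mono in auto)
    then have "AE \<omega> in M. \<forall>i\<in>{1..n}. (\<lambda>m. \<tau>' m i \<omega>) \<longlonglongrightarrow> \<tau> i \<omega>"
      using AE_space
    proof eventually_elim
      case (elim \<omega>)
      show ?case
      proof
        fix i assume i: "i \<in> {1..n}"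
        then have "\<forall>\<^sub>F m in sequentially. \<tau>' m i \<omega> = ?\<sigma> m i \<omega>" using elim(1) by blast
        then have "\<forall>\<^sub>F m in sequentially. ?\<sigma> m i \<omega> = \<tau>' m i \<omega>" by eventually_elim simp
        from Lim_transform_eventually[OF \<sigma>_lim[OF i elim(2)] this] show "(\<lambda>m. \<tau>' m i \<omega>) \<longlonglongrightarrow> \<tau> i \<omega>" .
      qed
    qed
    from C.chain_value_tendsto[OF A.atomless P.atomless S'' S this]
    have "(\<lambda>m. C.W (\<tau>' m) - e m) \<longlonglongrightarrow> C.W \<tau> - 0" using e by (intro tendsto_diff)
    then have "(\<lambda>m. ereal (C.W (\<tau>' m) - e m)) \<longlonglongrightarrow> ereal (C.W \<tau>)" by simp
    then have "ereal (C.W \<tau>) = liminf (\<lambda>m. ereal (C.W (\<tau>' m) - e m))"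
      by (rule lim_imp_Liminf[OF sequentially_bot, symmetric])
    also have "\<dots> \<le> liminf ?v"
      using grid_low[OF chain' S'] by (intro Liminf_mono always_eventually allI)
    finally show "ereal (C.W \<tau>) \<le> liminf ?v" .
  qed
  have "?v \<longlonglongrightarrow> ?V" by (rule ereal_tendsto_squeeze[OF up e low])
  then have "(\<lambda>m. V_P_grid M F T n \<mu>A \<mu>P f g \<xi> (Suc m) (p (Suc m))) \<longlonglongrightarrow> ?V" by (simp add: q_def)
  then show ?thesis by (rule LIMSEQ_imp_Suc)
qed

end
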